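(* Consider the distributionally robust LQG problem $$(P):\qquad \min_{\mathbf{x},\mathbf{u}}\ \max_{\mathbb{P}\in\mathcal{B}}\ \mathbb{E}_{\mathbb{P}}\left[\mathbf{u}^\top\mathbf{R}\mathbf{u}+\mathbf{x}^\top\mathbf{Q}\mathbf{x}\right]\quad\text{s.t. } \mathbf{u}\in\mathcal{U}_{\boldsymbol{\eta}},\ \ \mathbf{x}=\mathbf{H}\mathbf{u}+\mathbf{G}\mathbf{w},$$ with all objects as in the context. Then $(P)$ is solved by an affine policy and a Gaussian distribution: there exist $\mathbf{U}^\star\in\mathbb{R}^{mT\times pT}$, $\mathbf{q}^\star\in\mathbb{R}^{mT}$ and $\mathbb{P}^\star\in\mathcal{G}$ such that the policy $\mathbf{u}^\star=\mathbf{U}^\star\mathbf{y}+\mathbf{q}^\star$ is admissible and attains the outer minimum in $(P)$, and $\mathbb{P}^\star$ attains the inner maximum over $\mathcal{B}$ for the policy $\mathbf{u}^\star$.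
   Context: System: $x_{t+1}=Ax_t+Bu_t+w_t$, $y_t=Cx_t+v_t$, $t=0,\dots,T-1$, with $x_t\in\mathbb{R}^n$, $u_t\in\mathbb{R}^m$, $y_t\in\mathbb{R}^p$. The random vectors $x_0$, $w_0,\dots,w_{T-1}$, $v_0,\dots,v_{T-1}$ are mutually independent. Weights: $Q,Q_T\in\mathbb{S}^n_+$ (symmetric positive semidefinite), $R\in\mathbb{S}^m_{++}$ (symmetric positive definite). Stacked notation: $\mathbf{x}=(x_0,\dots,x_T)$, $\mathbf{u}=(u_0,\dots,u_{T-1})$, $\mathbf{y}=(y_0,\dots,y_{T-1})$, $\mathbf{w}=(x_0,w_0,\dots,w_{T-1})$, $\mathbf{v}=(v_0,\dots,v_{T-1})$; $\mathbf{Q}=\mathrm{diag}(Q,\dots,Q,Q_T)$, $\mathbf{R}=\mathrm{diag}(R,\dots,R)$. The matrix $\mathbf{C}\in\mathbb{R}^{pT\times n(T+1)}$ is block diagonal with blocks $C$, followed by a zero last block column; $\mathbf{G}\in\mathbb{R}^{n(T+1)\times n(T+1)}$ has $(t,s)$ block $A^{t-s}$ for $0\le s\le t\le T$ and $0$ otherwise; $\mathbf{H}\in\mathbb{R}^{n(T+1)\times mT}$ has $(t,s)$ block $A^{t-1-s}B$ for $0\le s<t\le T$ and $0$ otherwise. Thus the dynamics read $\mathbf{x}=\mathbf{H}\mathbf{u}+\mathbf{G}\mathbf{w}$, $\mathbf{y}=\mathbf{C}\mathbf{x}+\mathbf{v}$. Purified observations: let $\hat x_{t+1}=A\hat x_t+Bu_t$,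 $\hat x_0=0$, $\hat y_t=C\hat x_t$, and $\eta_t=y_t-\hat y_t$, $\boldsymbol{\eta}=(\eta_0,\dots,\eta_{T-1})$. Then $\boldsymbol{\eta}=\mathbf{D}\mathbf{w}+\mathbf{v}$ with $\mathbf{D}=\mathbf{C}\mathbf{G}$. $\mathcal{U}_{\boldsymbol{\eta}}$ is the set of all $\mathbf{u}$ with $u_t=\tilde\pi_t(\eta_0,\dots,\eta_t)$ for some measurable $\tilde\pi_t:\mathbb{R}^{p(t+1)}\to\mathbb{R}^m$, for every $t$; it coincides with the set of policies $u_t=\pi_t(y_0,\dots,y_t)$ with $\pi_t$ measurable. Ambiguity sets: $\mathcal{P}(\mathbb{R}^d)$ is the set of absolutely continuous probability distributions on $\mathbb{R}^d$ and $\mathcal{P}_{\mathcal{G}}(\mathbb{R}^d)$ its subset of Gaussians. $R(\mathbb{P}_2\|\mathbb{P}_1)=\int p_2\log(p_2/p_1)\,dx$ is the Kullback–Leibler divergence. The nominal distributions are $\hat{\mathbb{P}}_{x_0}=\mathcal{N}(0,\hat W_{-1})$, $\hat{\mathbb{P}}_{w_t}=\mathcal{N}(0,\hat W_t)$, $\hat{\mathbb{P}}_{v_t}=\mathcal{N}(0,\hat V_t)$ with $\hat W_t,\hat V_t\succ0$; radii $\rho_{x_0},\rho_{w_t},\rho_{v_t}\ge0$ are given. Let $\mathcal{B}=\mathcal{B}_{x_0}\otimes(\otimes_{t=0}^{T-1}\mathcal{B}_{w_t})\otimes(\otimes_{t=0}^{T-1}\mathcal{B}_{v_t})$ (independent couplings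 of elements of the factors), where $\mathcal{B}_{x_0}$ is the set of zero-mean $\mathbb{P}_{x_0}\in\mathcal{P}(\mathbb{R}^n)$ with $R(\mathbb{P}_{x_0}\|\hat{\mathbb{P}}_{x_0})\le\rho_{x_0}$, $\mathcal{B}_{w_t}$ is the set of zero-mean $\mathbb{P}_{w_t}\in\mathcal{P}(\mathbb{R}^n)$ with $R(\mathbb{P}_{w_t}\|\hat{\mathbb{P}}_{w_t})\le\rho_{w_t}$, and $\mathcal{B}_{v_t}$ is the set of zero-mean $\mathbb{P}_{v_t}\in\mathcal{P}(\mathbb{R}^p)$ with $R(\mathbb{P}_{v_t}\|\hat{\mathbb{P}}_{v_t})\le\rho_{v_t}$. $\mathcal{G}\subseteq\mathcal{B}$ is defined in the same way with every $\mathcal{P}(\cdot)$ replaced by $\mathcal{P}_{\mathcal{G}}(\cdot)$. *)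

theory Defs
  imports "HOL-Probability.Probability"
begin

section \<open>Matrices\<close>

definition psd :: "real^'n^'n \<Rightarrow> bool" where
  "psd M \<longleftrightarrow> transpose M = M \<and> (\<forall>x. 0 \<le> x \<bullet> (M *v x))"

definition pd :: "real^'n^'n \<Rightarrow> bool" where
  "pd M \<longleftrightarrow> transpose M = M \<and> (\<forall>x. x \<noteq> 0 \<longrightarrow> 0 < x \<bullet> (M *v x))"

text \<open>The class operation \<open>^\<close> is not used: it would not refer to the matrix product \<open>**\<close>.\<close>

primrec mpow :: "real^'n^'n \<Rightarrow> nat \<Rightarrow> real^'n^'n" where
  "mpow A 0 = mat 1"
| "mpow A (Suc k) = A ** mpow A k"

text \<open>
  Stacked vectors are functions from block indices to blocks, and stacked matrices are functions
  from pairs (block row, block column) to blocks. Only finitely many indices are meaningful; the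
  number of block columns is passed explicitly to the products below.
\<close>

definition bmv :: "nat \<Rightarrow> (nat \<Rightarrow> nat \<Rightarrow> real^'b^'a) \<Rightarrow> (nat \<Rightarrow> real^'b) \<Rightarrow> nat \<Rightarrow> real^'a" where
  "bmv N M z t = (\<Sum>s<N. M t s *v z s)"

definition bmm :: "nat \<Rightarrow> (nat \<Rightarrow> nat \<Rightarrow> real^'b^'a) \<Rightarrow> (nat \<Rightarrow> nat \<Rightarrow> real^'c^'b) \<Rightarrow>
    nat \<Rightarrow> nat \<Rightarrow> real^'c^'a" where
  "bmm N M M' t s = (\<Sum>r<N. M t r ** M' r s)"

definition bquad :: "nat \<Rightarrow> (nat \<Rightarrow> nat \<Rightarrow> real^'a^'a) \<Rightarrow> (nat \<Rightarrow> real^'a) \<Rightarrow> real" where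
  "bquad N M z = (\<Sum>t<N. z t \<bullet> bmv N M z t)"

section \<open>The stacked system\<close>

definition Gmat :: "real^'n^'n \<Rightarrow> nat \<Rightarrow> nat \<Rightarrow> real^'n^'n" where
  "Gmat A t s = (if s \<le> t then mpow A (t - s) else 0)"

definition Hmat :: "real^'n^'n \<Rightarrow> real^'m^'n \<Rightarrow> nat \<Rightarrow> nat \<Rightarrow> real^'m^'n" where
  "Hmat A B t s = (if s < t then mpow A (t - 1 - s) ** B else 0)"

text \<open>Used with \<open>T\<close> block rows and \<open>T + 1\<close> block columns, so that the last block column is zero.\<close>

definition Cmat :: "real^'n^'p \<Rightarrow> nat \<Rightarrow> nat \<Rightarrow> real^'n^'p" where
  "Cmat C t s = (if s = t then C else 0)"

definition Qmat :: "nat \<Rightarrow> real^'n^'n \<Rightarrow> real^'n^'n \<Rightarrow> nat \<Rightarrow> nat \<Rightarrow> real^'n^'n" where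
  "Qmat T Q Q\<^sub>T t s = (if s = t then (if t = T then Q\<^sub>T else Q) else 0)"

definition Rmat :: "real^'m^'m \<Rightarrow> nat \<Rightarrow> nat \<Rightarrow> real^'m^'m" where
  "Rmat R t s = (if s = t then R else 0)"

text \<open>
  A noise realization is a triple \<open>(x\<^sub>0, w, v)\<close>, where only \<open>w t\<close> and \<open>v t\<close> with \<open>t < T\<close> matter.
\<close>

type_synonym ('n, 'p) noise = "(real^'n) \<times> (nat \<Rightarrow> real^'n) \<times> (nat \<Rightarrow> real^'p)"

definition wstack :: "('n::finite, 'p::finite) noise \<Rightarrow> nat \<Rightarrow> real^'n" where
  "wstack \<omega> = case_nat (fst \<omega>) (fst (snd \<omega>))"

definition vstack :: "('n::finite, 'p::finite) noise \<Rightarrow> nat \<Rightarrow> real^'p" where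
  "vstack \<omega> = snd (snd \<omega>)"

definition trajectory :: "nat \<Rightarrow> real^'n^'n \<Rightarrow> real^'m^'n \<Rightarrow> (nat \<Rightarrow> real^'m) \<Rightarrow>
    ('n, 'p::finite) noise \<Rightarrow> nat \<Rightarrow> real^'n" where
  "trajectory T A B u \<omega> t = bmv T (Hmat A B) u t + bmv (Suc T) (Gmat A) (wstack \<omega>) t"

definition observation :: "nat \<Rightarrow> real^'n^'p \<Rightarrow> (nat \<Rightarrow> real^'n) \<Rightarrow> ('n, 'p) noise \<Rightarrow>
    nat \<Rightarrow> real^'p" where
  "observation T C x \<omega> t = bmv (Suc T) (Cmat C) x t + vstack \<omega> t"

primrec xhat :: "real^'n^'n \<Rightarrow> real^'m^'n \<Rightarrow> (nat \<Rightarrow> real^'m) \<Rightarrow> nat \<Rightarrow> real^'n" where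
  "xhat A B u 0 = 0"
| "xhat A B u (Suc t) = A *v xhat A B u t + B *v u t"

definition purified :: "nat \<Rightarrow> real^'n^'n \<Rightarrow> real^'m^'n \<Rightarrow> real^'n^'p \<Rightarrow> (nat \<Rightarrow> real^'m) \<Rightarrow>
    ('n, 'p) noise \<Rightarrow> nat \<Rightarrow> real^'p" where
  "purified T A B C u \<omega> t =
     observation T C (trajectory T A B u \<omega>) \<omega> t - C *v xhat A B u t"

section \<open>Admissible inputs and the objective\<close>

text \<open>
  Inputs and states are processes, i.e. functions of the noise realization; values at times
  beyond the horizon are irrelevant.
\<close>

definition admissible :: "nat \<Rightarrow> real^'n^'n \<Rightarrow> real^'m^'n \<Rightarrow> real^'n^'p \<Rightarrow>
    (('n, 'p) noise \<Rightarrow> nat \<Rightarrow> real^'m) set" where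
  "admissible T A B C =
     {u. \<exists>\<pi>. \<forall>t<T. \<pi> t \<in> borel_measurable (PiM {..t} (\<lambda>_. borel)) \<and>
            (\<forall>\<omega>. u \<omega> t = \<pi> t (restrict (purified T A B C (u \<omega>) \<omega>) {..t}))}"

definition feasible :: "nat \<Rightarrow> real^'n^'n \<Rightarrow> real^'m^'n \<Rightarrow> real^'n^'p \<Rightarrow>
    ((('n, 'p) noise \<Rightarrow> nat \<Rightarrow> real^'n) \<times> (('n, 'p) noise \<Rightarrow> nat \<Rightarrow> real^'m)) set" where
  "feasible T A B C =
     {(x, u). u \<in> admissible T A B C \<and> (\<forall>\<omega>. \<forall>t\<le>T. x \<omega> t = trajectory T A B (u \<omega>) \<omega> t)}"

text \<open>
  For positive semidefinite weights the integrand is nonnegative, so that the nonnegative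
  integral is the expectation, with value \<open>\<infinity>\<close> when the cost is not integrable.
\<close>

definition expected_cost :: "nat \<Rightarrow> real^'n^'n \<Rightarrow> real^'n^'n \<Rightarrow> real^'m^'m \<Rightarrow>
    (('n, 'p::finite) noise \<Rightarrow> nat \<Rightarrow> real^'n) \<Rightarrow> (('n, 'p) noise \<Rightarrow> nat \<Rightarrow> real^'m) \<Rightarrow>
    ('n, 'p) noise measure \<Rightarrow> ennreal" where
  "expected_cost T Q Q\<^sub>T R x u P =
     (\<integral>\<^sup>+\<omega>. ennreal (bquad T (Rmat R) (u \<omega>) + bquad (Suc T) (Qmat T Q Q\<^sub>T) (x \<omega>)) \<partial>P)"

section \<open>Ambiguity sets\<close>

definition ac_dists :: "(real^'d) measure set" where
  "ac_dists = {P. prob_space P \<and> sets P = sets borel \<and> absolutely_continuous lborel P}"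

definition gaussian :: "real^'d \<Rightarrow> real^'d^'d \<Rightarrow> (real^'d) measure" where
  "gaussian \<mu> \<Sigma> = density lborel (\<lambda>x. ennreal
     (exp (- ((x - \<mu>) \<bullet> (matrix_inv \<Sigma> *v (x - \<mu>))) / 2) / sqrt ((2 * pi) ^ CARD('d) * det \<Sigma>)))"

text \<open>An absolutely continuous Gaussian is one with a positive definite covariance matrix.\<close>

definition gaussian_dists :: "(real^'d) measure set" where
  "gaussian_dists = {P \<in> ac_dists. \<exists>\<mu> \<Sigma>. pd \<Sigma> \<and> P = gaussian \<mu> \<Sigma>}"

text \<open>
  \<open>KL_divergence\<close> is a Bochner integral and hence \<open>0\<close> if the log-density is not integrable.
  As its negative part is always integrable, the divergence is \<open>\<infinity>\<close> in that case. The first argument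
  of \<open>KL_divergence (exp 1)\<close> is the reference measure.
\<close>

definition rel_entropy :: "'a measure \<Rightarrow> 'a measure \<Rightarrow> ereal" where
  "rel_entropy P2 P1 =
     (if absolutely_continuous P1 P2 \<and> integrable P2 (entropy_density (exp 1) P1 P2)
      then ereal (KL_divergence (exp 1) P1 P2) else \<infinity>)"

definition kl_ball :: "(real^'d) measure set \<Rightarrow> (real^'d) measure \<Rightarrow> real \<Rightarrow> (real^'d) measure set" where
  "kl_ball \<P> P\<^sub>0 \<rho> =
     {P \<in> \<P>. integrable P (\<lambda>x. x) \<and> (\<integral>x. x \<partial>P) = 0 \<and> rel_entropy P P\<^sub>0 \<le> ereal \<rho>}"

definition independent_couplings :: "nat \<Rightarrow> (real^'n) measure set \<Rightarrow>
    (nat \<Rightarrow> (real^'n) measure set) \<Rightarrow> (nat \<Rightarrow> (real^'p) measure set) \<Rightarrow> ('n, 'p) noise measure set" where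
  "independent_couplings T \<B>\<^sub>x \<B>\<^sub>w \<B>\<^sub>v =
     {P\<^sub>x \<Otimes>\<^sub>M (PiM {..<T} P\<^sub>w \<Otimes>\<^sub>M PiM {..<T} P\<^sub>v) | P\<^sub>x P\<^sub>w P\<^sub>v.
        P\<^sub>x \<in> \<B>\<^sub>x \<and> (\<forall>t<T. P\<^sub>w t \<in> \<B>\<^sub>w t) \<and> (\<forall>t<T. P\<^sub>v t \<in> \<B>\<^sub>v t)}"

text \<open>
  \<open>W\<^sub>0\<close> is the nominal covariance of the initial state (not that of \<open>w 0\<close>), and \<open>W t\<close>, \<open>V t\<close> are
  the nominal covariances of \<open>w t\<close>, \<open>v t\<close>.
\<close>

definition ambiguity_set :: "nat \<Rightarrow> real^'n^'n \<Rightarrow> (nat \<Rightarrow> real^'n^'n) \<Rightarrow> (nat \<Rightarrow> real^'p^'p) \<Rightarrow>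
    real \<Rightarrow> (nat \<Rightarrow> real) \<Rightarrow> (nat \<Rightarrow> real) \<Rightarrow> ('n, 'p) noise measure set" where
  "ambiguity_set T W\<^sub>0 W V \<rho>\<^sub>x \<rho>\<^sub>w \<rho>\<^sub>v =
     independent_couplings T (kl_ball ac_dists (gaussian 0 W\<^sub>0) \<rho>\<^sub>x)
       (\<lambda>t. kl_ball ac_dists (gaussian 0 (W t)) (\<rho>\<^sub>w t))
       (\<lambda>t. kl_ball ac_dists (gaussian 0 (V t)) (\<rho>\<^sub>v t))"

definition gaussian_ambiguity_set :: "nat \<Rightarrow> real^'n^'n \<Rightarrow> (nat \<Rightarrow> real^'n^'n) \<Rightarrow> (nat \<Rightarrow> real^'p^'p) \<Rightarrow>
    real \<Rightarrow> (nat \<Rightarrow> real) \<Rightarrow> (nat \<Rightarrow> real) \<Rightarrow> ('n, 'p) noise measure set" where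
  "gaussian_ambiguity_set T W\<^sub>0 W V \<rho>\<^sub>x \<rho>\<^sub>w \<rho>\<^sub>v =
     independent_couplings T (kl_ball gaussian_dists (gaussian 0 W\<^sub>0) \<rho>\<^sub>x)
       (\<lambda>t. kl_ball gaussian_dists (gaussian 0 (W t)) (\<rho>\<^sub>w t))
       (\<lambda>t. kl_ball gaussian_dists (gaussian 0 (V t)) (\<rho>\<^sub>v t))"

section \<open>The stacked equations agree with the recursive ones\<close>

lemma trajectory_0: "trajectory T A B u \<omega> 0 = fst \<omega>"
proof -
  have "bmv (Suc T) (Gmat A) (wstack \<omega>) 0 = Gmat A 0 0 *v wstack \<omega> 0"
    unfolding bmv_def by (subst sum.remove[of _ 0]) (auto simp: Gmat_def intro!: sum.neutral)
  then show ?thesis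
    by (simp add: trajectory_def bmv_def Hmat_def Gmat_def wstack_def)
qed

lemma bmv_Hmat: "t \<le> T \<Longrightarrow> bmv T (Hmat A B) u t = (\<Sum>s<t. (mpow A (t - 1 - s) ** B) *v u s)"
  unfolding bmv_def by (rule sum.mono_neutral_cong_right) (auto simp: Hmat_def)

lemma bmv_Gmat: "t \<le> T \<Longrightarrow> bmv (Suc T) (Gmat A) z t = (\<Sum>s\<le>t. mpow A (t - s) *v z s)"
  unfolding bmv_def by (rule sum.mono_neutral_cong_right) (auto simp: Gmat_def)

lemma matrix_vector_mult_sum: "(A :: real^'n^'m) *v (\<Sum>s\<in>S. f s) = (\<Sum>s\<in>S. A *v f s)"
  by (induction S rule: infinite_finite_induct) (auto simp: matrix_vector_right_distrib)

lemma bmv_Hmat_Suc: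
  assumes "t < T"
  shows "bmv T (Hmat A B) u (Suc t) = A *v bmv T (Hmat A B) u t + B *v u t"
proof -
  have "(mpow A (t - s) ** B) *v u s = A *v ((mpow A (t - 1 - s) ** B) *v u s)" if "s < t" for s
  proof -
    have "t - s = Suc (t - 1 - s)" using that by simp
    then show ?thesis by (simp add: matrix_vector_mul_assoc matrix_mul_assoc)
  qed
  then show ?thesis
    using assms by (simp add: bmv_Hmat matrix_vector_mult_sum)
qed

lemma bmv_Gmat_Suc:
  assumes "t < T"
  shows "bmv (Suc T) (Gmat A) z (Suc t) = A *v bmv (Suc T) (Gmat A) z t + z (Suc t)"
proof -
  have "mpow A (Suc t - s) *v z s = A *v (mpow A (t - s) *v z s)" if "s \<le> t" for s
    using that by (simp add: Suc_diff_le matrix_vector_mul_assoc)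
  then show ?thesis
    using assms by (simp add: bmv_Gmat matrix_vector_mult_sum)
qed

lemma trajectory_Suc:
  assumes "t < T"
  shows "trajectory T A B u \<omega> (Suc t) =
    A *v trajectory T A B u \<omega> t + B *v u t + fst (snd \<omega>) t"
  using assms
  by (simp add: trajectory_def bmv_Hmat_Suc bmv_Gmat_Suc matrix_vector_right_distrib wstack_def)

lemma observation_eq:
  assumes "t < T"
  shows "observation T C x \<omega> t = C *v x t + vstack \<omega> t"
proof -
  have "bmv (Suc T) (Cmat C) x t = (\<Sum>s<Suc T. if s = t then C *v x s else 0)"
    unfolding bmv_def Cmat_def by (intro sum.cong) auto
  then show ?thesis using assms by (simp add: observation_def)
qed

lemma xhat_eq: "t \<le> T \<Longrightarrow> xhat A B u t = bmv T (Hmat A B) u t"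
proof (induction t)
  case 0
  then show ?case by (simp add: bmv_Hmat)
next
  case (Suc t)
  then show ?case by (simp add: bmv_Hmat_Suc)
qed

lemma purified_eq:
  assumes "t < T"
  shows "purified T A B C u \<omega> t =
    bmv (Suc T) (bmm (Suc T) (Cmat C) (Gmat A)) (wstack \<omega>) t + vstack \<omega> t"
proof -
  have "bmm (Suc T) (Cmat C) (Gmat A) t s = C ** Gmat A t s" for s
  proof -
    have "bmm (Suc T) (Cmat C) (Gmat A) t s = (\<Sum>r<Suc T. if r = t then C ** Gmat A r s else 0)"
      unfolding bmm_def Cmat_def by (intro sum.cong) auto
    then show ?thesis using assms by simp
  qed
  then have "bmv (Suc T) (bmm (Suc T) (Cmat C) (Gmat A)) (wstack \<omega>) t =
      C *v bmv (Suc T) (Gmat A) (wstack \<omega>) t"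
    by (simp add: bmv_def matrix_vector_mult_sum matrix_vector_mul_assoc matrix_vector_right_distrib)
  then show ?thesis
    using assms
    by (simp add: purified_def observation_eq trajectory_def xhat_eq[of t T] matrix_vector_right_distrib)
qed

end

theory Submission
  imports Defs
begin

text \<open>
  The theorem is a saddle point statement. A linear policy \<open>u\<close> of the purified observations and a Gaussian
  distribution \<open>P\<close> of the ambiguity set are exhibited such that no element of the ambiguity set makes \<open>u\<close>
  costlier than \<open>P\<close> does, and no admissible policy is cheaper under \<open>P\<close> than \<open>u\<close> is. Minimality of the
  worst case of \<open>u\<close> follows, since the worst case of any competitor is at least its cost under \<open>P\<close>.
  By symmetry of the problem the affine term \<open>q\<close> can be taken to be \<open>0\<close>.

  \<^bold>\<open>Reduction to covariances.\<close> Purified observations do not depend on the inputs, so under a linear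
  policy the cost is a quadratic form of the independent centered noise blocks, and its expectation
  is a linear function of the block covariances (\<open>noise_quadratic_expectation\<close>). The Gibbs variational
  inequality, tested with all Gaussian competitors, confines the covariances that occur in a relative
  entropy ball to an intersection of half-spaces, \<open>kl_cov_set\<close> (\<open>kl_ball_second_moment\<close>). Conversely,
  testing with the Gaussian of covariance \<open>S\<close> itself shows that each \<open>S\<close> in that set is the covariance of a
  Gaussian in the ball (\<open>kl_cov_set_gaussian\<close>). Hence the ball and its Gaussian part have the same
  covariances, and these form a compact convex set of positive definite matrices.

  \<^bold>\<open>The saddle point in covariances.\<close> The optimal value over linear gains is a concave upper
  semicontinuous function of the covariances and attains its maximum at some \<open>\<sigma>\<close>. At \<open>\<sigma>\<close> the normal
  equations have a solution, the gain \<open>c\<close>. If some \<open>\<tau>\<close> made \<open>c\<close> costlier, then the value at a slight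
  mixture of \<open>\<sigma>\<close> and \<open>\<tau>\<close> would exceed the value at \<open>\<sigma>\<close>: a gain far from \<open>c\<close> is too expensive under \<open>\<sigma>\<close>,
  and one close to \<open>c\<close> is too expensive under \<open>\<tau>\<close> (\<open>saddle_point\<close>).

  \<^bold>\<open>Optimality among all causal policies.\<close> By the normal equations, the gradient of the cost with
  respect to the input at time \<open>t\<close> is a linear statistic of the noise that is uncorrelated with the
  purified observations up to time \<open>t\<close>. Translating Gaussian noise by \<open>s\<close> times the covariance applied to
  the coefficients of this statistic fixes these observations and, by the Cameron--Martin formula,
  multiplies the law by an exponential of the statistic. Differentiation at \<open>s = 0\<close> shows that the
  gradient is orthogonal to every square-integrable function of the observations
  (\<open>cameron_martin_orthogonal\<close>), and convexity of the cost turns this into optimality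
  (\<open>gaussian_optimal\<close>). Only translation invariance of Lebesgue measure enters, so that the formula
  passes to products of blocks of different dimensions by Fubini's theorem, without any joint density.

  Finally, a causal linear policy of the purified observations is one of the observations, because
  purified and actual observations at time \<open>t\<close> differ by a linear function of the inputs before \<open>t\<close>
  (\<open>output_feedback_gain\<close>).
\<close>

section \<open>Positive definite matrices\<close>

lemma psd_inner_commute: "transpose M = M \<Longrightarrow> x \<bullet> (M *v y) = y \<bullet> (M *v x)" for M :: "real^'n^'n"
  by (metis dot_lmul_matrix inner_commute transpose_matrix_vector)

lemma pd_imp_psd: "pd M \<Longrightarrow> psd M"
  unfolding pd_def psd_def by (metis inner_zero_left less_eq_real_def)

lemma pd_invertible:
  assumes "pd M" shows "invertible M"
proof -
  have "M *v x = 0 \<Longrightarrow> x = 0" for x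
    using assms unfolding pd_def by (metis inner_zero_right less_irrefl)
  then show ?thesis
    by (simp add: invertible_left_inverse matrix_left_invertible_ker)
qed

lemma matrix_inv_mult:
  fixes M :: "real^'n^'n" assumes "invertible M"
  shows "M ** matrix_inv M = mat 1" "matrix_inv M ** M = mat 1"
proof -
  have "\<exists>N. M ** N = mat 1 \<and> N ** M = mat 1" using assms by (simp add: invertible_def)
  from someI_ex[OF this] show "M ** matrix_inv M = mat 1" "matrix_inv M ** M = mat 1"
    unfolding matrix_inv_def by auto
qed

lemma pd_matrix_inv:
  fixes M :: "real^'n^'n" assumes "pd M"
  shows "pd (matrix_inv M)"
proof -
  note inv = matrix_inv_mult[OF pd_invertible[OF assms]]
  have sym: "transpose M = M" using assms by (simp add: pd_def)
  have "transpose (matrix_inv M) = transpose (matrix_inv M) ** (M ** matrix_inv M)"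
    by (simp add: inv)
  also have "\<dots> = transpose (M ** matrix_inv M) ** matrix_inv M"
    by (simp add: matrix_transpose_mul sym matrix_mul_assoc)
  finally have t: "transpose (matrix_inv M) = matrix_inv M" by (simp add: inv)
  have "0 < x \<bullet> (matrix_inv M *v x)" if "x \<noteq> 0" for x
  proof -
    define y where "y = matrix_inv M *v x"
    have x: "x = M *v y" by (simp add: y_def matrix_vector_mul_assoc inv)
    then have "y \<noteq> 0" using that by auto
    then have "0 < y \<bullet> (M *v y)" using assms by (simp add: pd_def)
    also have "\<dots> = x \<bullet> (matrix_inv M *v x)" by (simp add: x[symmetric] y_def[symmetric] inner_commute)
    finally show ?thesis .
  qed
  with t show ?thesis by (simp add: pd_def)
qed

text \<open>
  Gram--Schmidt orthonormalization for the inner product with Gram matrix \<open>L\<close>: the columns of \<open>B\<close> are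
  an orthonormal basis. This replaces a matrix square root.
\<close>

lemma pd_congruence_identity:
  fixes L :: "real^'n^'n" assumes "pd L"
  obtains B :: "real^'n^'n" where "invertible B" "transpose B ** L ** B = mat 1"
proof -
  have sym: "transpose L = L" using assms by (simp add: pd_def)
  have ex: "\<exists>b. \<forall>i\<in>S. \<forall>j\<in>S. b i \<bullet> (L *v b j) = (if i = j then 1 else 0)" if "finite S" for S :: "'n set"
    using that
  proof (induction S)
    case (insert k S)
    then obtain b where b: "\<And>i j. i \<in> S \<Longrightarrow> j \<in> S \<Longrightarrow> b i \<bullet> (L *v b j) = (if i = j then 1 else 0)"
      by blast
    have "S \<subset> UNIV" using insert by auto
    then have c: "card S < CARD('n)" by (intro psubset_card_mono) auto
    have "dim (b ` S) \<le> card S"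
      by (meson card_image_le dim_le_card' finite_imageI insert.hyps(1) le_trans)
    have "span (b ` S) \<noteq> UNIV"
    proof -
      have "dim (span (b ` S)) < CARD('n)" using c \<open>dim (b ` S) \<le> card S\<close> by simp
      moreover have "dim (UNIV :: (real^'n) set) = CARD('n)" by simp
      ultimately show ?thesis by force
    qed
    then obtain x where x: "x \<notin> span (b ` S)" by auto
    \<comment> \<open>The part of \<open>x\<close> orthogonal to the vectors chosen so far.\<close>
    define y where "y = x - (\<Sum>i\<in>S. (b i \<bullet> (L *v x)) *\<^sub>R b i)"
    have "(\<Sum>i\<in>S. (b i \<bullet> (L *v x)) *\<^sub>R b i) \<in> span (b ` S)"
      by (intro span_sum span_scale span_base) auto
    then have "y \<noteq> 0" using x by (auto simp: y_def)
    then have yp: "0 < y \<bullet> (L *v y)" using assms by (simp add: pd_def)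
    have yb: "y \<bullet> (L *v b j) = 0" if "j \<in> S" for j
    proof -
      have "(\<Sum>i\<in>S. (b i \<bullet> (L *v x)) * (b i \<bullet> (L *v b j))) = (\<Sum>i\<in>S. if i = j then b i \<bullet> (L *v x) else 0)"
        using that by (intro sum.cong) (auto simp: b)
      then show ?thesis
        using that insert.hyps(1) psd_inner_commute[OF sym, of x "b j"] by (simp add: y_def inner_diff_left inner_sum_left)
    qed
    define z where "z = (1 / sqrt (y \<bullet> (L *v y))) *\<^sub>R y"
    have zz: "z \<bullet> (L *v z) = 1"
      using yp by (simp add: z_def matrix_vector_mult_scaleR field_simps)
    have zb: "z \<bullet> (L *v b j) = 0" "b j \<bullet> (L *v z) = 0" if "j \<in> S" for j
      using yb[OF that] psd_inner_commute[OF sym, of "b j" z] by (simp_all add: z_def)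
    show ?case
      using insert.hyps(2) by (intro exI[of _ "b(k := z)"]) (auto simp: b zz zb)
  qed simp
  from ex[OF finite[of UNIV]] obtain b where b: "\<And>i j::'n. b i \<bullet> (L *v b j) = (if i = j then 1 else 0)"
    by auto
  define B :: "real^'n^'n" where "B = (\<chi> i j. b j $ i)"
  have col: "column j B = b j" for j by (simp add: B_def column_def vec_eq_iff)
  have "transpose B ** L ** B = mat 1"
  proof -
    have "(transpose B ** L ** B) $ i $ j = b i \<bullet> (L *v b j)" for i j
    proof -
      have "(transpose B ** L ** B) $ i $ j = (transpose B ** (L ** B)) $ i $ j"
        by (simp add: matrix_mul_assoc)
      also have "\<dots> = (\<Sum>k\<in>UNIV. b i $ k * (L *v b j) $ k)"
        by (simp add: matrix_matrix_mult_def transpose_def B_def matrix_vector_mult_def)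
      finally show ?thesis by (simp add: inner_vec_def)
    qed
    then show ?thesis by (simp add: vec_eq_iff mat_def b)
  qed
  moreover from this have "invertible B"
    by (metis invertible_left_inverse)
  ultimately show ?thesis using that by blast
qed

section \<open>Linear change of variables and Gaussian normalization\<close>

lemma borel_measurable_matrix_vector_mult[measurable]:
  "(*v) M \<in> borel_measurable borel" for M :: "real^'n^'m"
  by (intro borel_measurable_continuous_onI linear_continuous_on)
     (simp add: matrix_vector_mul_bounded_linear)

lemma prod_Basis_cart: "(\<Prod>b\<in>Basis. h (x \<bullet> b)) = (\<Prod>i\<in>UNIV. h (x $ i))" for x :: "real^'n"
proof -
  have B: "(Basis :: (real^'n) set) = range (\<lambda>i. axis i 1)"
    by (auto simp: Basis_vec_def)
  have "inj (\<lambda>i::'n. axis i (1::real))" by (auto simp: inj_def axis_eq_axis)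
  then show ?thesis unfolding B by (subst prod.reindex) (auto simp: cart_eq_inner_axis)
qed

text \<open>
  A shear translates along the coordinate \<open>m\<close> by an amount that depends on the other coordinates only, so
  Fubini's theorem and translation invariance in dimension one apply.
\<close>

lemma nn_integral_lborel_shear:
  fixes f :: "real^'n \<Rightarrow> ennreal"
  assumes [measurable]: "f \<in> borel_measurable borel" and "m \<noteq> n"
  shows "(\<integral>\<^sup>+x. f (x + (c * x $ n) *\<^sub>R axis m 1) \<partial>lborel) = (\<integral>\<^sup>+x. f x \<partial>lborel)"
proof -
  interpret product_sigma_finite "\<lambda>_::real^'n. lborel :: real measure" ..
  let ?m = "axis m 1 :: real^'n"
  define J where "J = (Basis :: (real^'n) set) - {?m}"
  have B: "Basis = insert ?m J" "?m \<notin> J" "finite J" by (auto simp: J_def)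
  define g :: "(real^'n \<Rightarrow> real) \<Rightarrow> real^'n" where "g z = (\<Sum>b\<in>Basis. z b *\<^sub>R b)" for z
  have [measurable]: "g \<in> borel_measurable (PiM Basis (\<lambda>_. lborel))" unfolding g_def by measurable
  have gm[measurable]: "g \<in> borel_measurable (PiM (insert ?m J) (\<lambda>_. lborel))" 
    using \<open>g \<in> borel_measurable (PiM Basis (\<lambda>_. lborel))\<close> by (simp only: B(1)[symmetric])
  have gu: "g (z(?m := t)) = (\<Sum>b\<in>J. z b *\<^sub>R b) + t *\<^sub>R ?m" for z t
  proof -
    have "(\<Sum>b\<in>J. (z(?m := t)) b *\<^sub>R b) = (\<Sum>b\<in>J. z b *\<^sub>R b)"
      using B by (intro sum.cong) auto
    then show ?thesis unfolding g_def B(1) using B(2,3) by (simp add: add.commute)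
  qed
  have gn: "g (z(?m := t)) $ n = (\<Sum>b\<in>J. z b *\<^sub>R b) $ n" for z t
    unfolding gu using \<open>m \<noteq> n\<close> by (simp add: axis_def)
  have red: "(\<integral>\<^sup>+x. h x \<partial>lborel) = (\<integral>\<^sup>+z. (\<integral>\<^sup>+t. h (g (z(?m := t))) \<partial>lborel) \<partial>PiM J (\<lambda>_. lborel))"
    if [measurable]: "h \<in> borel_measurable borel" for h :: "real^'n \<Rightarrow> ennreal"
  proof -
    have "(\<integral>\<^sup>+x. h x \<partial>lborel) = (\<integral>\<^sup>+z. h (g z) \<partial>PiM Basis (\<lambda>_. lborel))"
      by (subst lborel_eq) (simp add: nn_integral_distr g_def)
    also have "\<dots> = (\<integral>\<^sup>+z. (\<integral>\<^sup>+t. h (g (z(?m := t))) \<partial>lborel) \<partial>PiM J (\<lambda>_. lborel))"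
      unfolding B(1) by (intro product_nn_integral_insert) (use B in auto)
    finally show ?thesis .
  qed
  have M: "(\<lambda>x. f (x + (c * x $ n) *\<^sub>R ?m)) \<in> borel_measurable borel" by measurable
  have "(\<integral>\<^sup>+t. f (g (z(?m := t)) + (c * g (z(?m := t)) $ n) *\<^sub>R ?m) \<partial>lborel)
      = (\<integral>\<^sup>+t. f (g (z(?m := t))) \<partial>lborel)" for z
  proof -
    let ?a = "\<Sum>b\<in>J. z b *\<^sub>R b"
    have "(\<integral>\<^sup>+t. f (?a + t *\<^sub>R ?m) \<partial>lborel) = (\<integral>\<^sup>+t. f (?a + t *\<^sub>R ?m) \<partial>distr lborel borel ((+) (c * ?a $ n)))"
      by (simp add: lborel_distr_plus)
    also have "\<dots> = (\<integral>\<^sup>+t. f (?a + (c * ?a $ n + t) *\<^sub>R ?m) \<partial>lborel)"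
      by (subst nn_integral_distr) auto
    finally show ?thesis unfolding gn unfolding gu by (simp add: algebra_simps)
  qed
  note inner = this
  show ?thesis
    by (rule trans[OF red[OF M] trans[OF _ red[OF assms(1), symmetric]]], rule nn_integral_cong, rule inner)
qed

text \<open>
  The property is multiplicative in \<open>B\<close>, so it is enough to check diagonal matrices, transpositions of
  coordinates and shears; a matrix with a zero row is excluded by its determinant.
\<close>

lemma nn_integral_lborel_linear:
  fixes B :: "real^'n^'n" and f :: "real^'n \<Rightarrow> ennreal"
  assumes "det B \<noteq> 0" and "f \<in> borel_measurable borel"
  shows "(\<integral>\<^sup>+x. f x \<partial>lborel) = ennreal \<bar>det B\<bar> * (\<integral>\<^sup>+x. f (B *v x) \<partial>lborel)"
proof -
  define P where "P B \<longleftrightarrow> (det B \<noteq> 0 \<longrightarrow> (\<forall>f::real^'n \<Rightarrow> ennreal. f \<in> borel_measurable borel \<longrightarrow>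
      (\<integral>\<^sup>+x. f x \<partial>lborel) = ennreal \<bar>det B\<bar> * (\<integral>\<^sup>+x. f (B *v x) \<partial>lborel)))" for B :: "real^'n^'n"
  have "P B"
  proof (rule induct_matrix_elementary[where P = P])
    fix A B :: "real^'n^'n" assume A: "P A" and B: "P B"
    show "P (A ** B)"
      unfolding P_def
    proof (intro impI allI)
      fix f :: "real^'n \<Rightarrow> ennreal"
      assume d: "det (A ** B) \<noteq> 0" and f[measurable]: "f \<in> borel_measurable borel"
      have "(\<integral>\<^sup>+x. f x \<partial>lborel) = ennreal \<bar>det A\<bar> * (\<integral>\<^sup>+x. f (A *v x) \<partial>lborel)"
        using A[unfolded P_def, THEN mp, THEN spec, THEN mp] d f by (simp only: det_mul mult_eq_0_iff) blast
      also have "(\<integral>\<^sup>+x. f (A *v x) \<partial>lborel) = ennreal \<bar>det B\<bar> * (\<integral>\<^sup>+x. f (A *v (B *v x)) \<partial>lborel)"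
      proof -
        have "(\<lambda>x. f (A *v x)) \<in> borel_measurable borel" by measurable
        then show ?thesis using B[unfolded P_def, THEN mp, THEN spec, THEN mp] d by (simp only: det_mul mult_eq_0_iff) blast
      qed
      finally show "(\<integral>\<^sup>+x. f x \<partial>lborel) = ennreal \<bar>det (A ** B)\<bar> * (\<integral>\<^sup>+x. f ((A ** B) *v x) \<partial>lborel)"
        by (simp only: det_mul abs_mult ennreal_mult abs_ge_zero mult.assoc matrix_vector_mul_assoc)
    qed
  next
    fix A :: "real^'n^'n" and i assume "row i A = 0"
    then show "P A" unfolding P_def using det_zero_row(2)[of i A] by (simp add: vec_eq_iff)
  next
    fix A :: "real^'n^'n" assume d: "\<And>i j. i \<noteq> j \<Longrightarrow> A $ i $ j = 0"
    have dA: "det A = (\<Prod>i\<in>UNIV. A $ i $ i)" using d by (rule det_diagonal)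
    show "P A"
      unfolding P_def
    proof (intro impI allI)
      fix f :: "real^'n \<Rightarrow> ennreal"
      assume nz: "det A \<noteq> 0" and f[measurable]: "f \<in> borel_measurable borel"
      define v :: "real^'n" where "v = (\<chi> i. A $ i $ i)"
      have v0: "v $ i \<noteq> 0" for i using nz by (auto simp: dA v_def)
      have c: "v \<bullet> j \<noteq> 0" if "j \<in> Basis" for j
        using that v0 by (auto simp: Basis_vec_def cart_eq_inner_axis[symmetric])
      have Av: "(\<Sum>j\<in>Basis. (v \<bullet> j * (x \<bullet> j)) *\<^sub>R j) = A *v x" for x
      proof (rule vec_eq_iff[THEN iffD2], rule allI)
        fix i
        have "(A *v x) $ i = (\<Sum>k\<in>UNIV. if k = i then v $ i * x $ i else 0)"
          unfolding matrix_vector_mult_def vec_lambda_beta by (rule sum.cong) (auto simp: v_def d)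
        moreover have "(\<Sum>j\<in>Basis. (v \<bullet> j * (x \<bullet> j)) *\<^sub>R j) $ i = (\<Sum>j\<in>Basis. (v \<bullet> j * (x \<bullet> j)) *\<^sub>R j) \<bullet> axis i 1"
          by (simp add: cart_eq_inner_axis)
        moreover have "\<dots> = v $ i * x $ i"
          by (subst inner_sum_left_Basis) (simp_all add: axis_in_Basis_iff cart_eq_inner_axis)
        ultimately show "(\<Sum>j\<in>Basis. (v \<bullet> j * (x \<bullet> j)) *\<^sub>R j) $ i = (A *v x) $ i" by simp
      qed
      have ab: "(\<Prod>j\<in>Basis. \<bar>v \<bullet> j\<bar>) = \<bar>det A\<bar>"
        unfolding prod_Basis_cart dA v_def by (simp add: abs_prod)
      have "lborel = density (distr lborel borel (\<lambda>x. A *v x)) (\<lambda>_. ennreal \<bar>det A\<bar>)"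
        using lborel_affine_euclidean[of "\<lambda>j. v \<bullet> j" 0] c by (simp add: Av ab)
      then have "(\<integral>\<^sup>+x. f x \<partial>lborel) = (\<integral>\<^sup>+x. f x \<partial>density (distr lborel borel (\<lambda>x. A *v x)) (\<lambda>_. ennreal \<bar>det A\<bar>))"
        by simp
      also have "\<dots> = ennreal \<bar>det A\<bar> * (\<integral>\<^sup>+x. f (A *v x) \<partial>lborel)"
        by (subst nn_integral_density, simp, simp, subst nn_integral_distr, simp, simp)
           (simp add: nn_integral_cmult)
      finally show "(\<integral>\<^sup>+x. f x \<partial>lborel) = ennreal \<bar>det A\<bar> * (\<integral>\<^sup>+x. f (A *v x) \<partial>lborel)" .
    qed
  next
    fix m n :: 'n assume "m \<noteq> n"
    let ?t = "Transposition.transpose m n"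
    define S :: "real^'n^'n" where "S = (\<chi> i j. mat 1 $ i $ ?t j)"
    have Sx: "(S *v x) $ i = x $ ?t i" for x i
    proof -
      have "(S *v x) $ i = (\<Sum>j\<in>UNIV. if j = ?t i then x $ j else 0)"
        unfolding matrix_vector_mult_def S_def mat_def vec_lambda_beta
        by (rule sum.cong) (auto simp: transpose_eq_iff)
      then show ?thesis by simp
    qed
    have SS: "S *v (S *v x) = x" for x by (simp add: vec_eq_iff Sx)
    then have "S ** S = mat 1"
      by (metis matrix_eq matrix_vector_mul_assoc matrix_vector_mul_lid)
    then have "det S * det S = 1" using det_mul[of S S] by simp
    then have dS: "\<bar>det S\<bar> = 1"
      by (metis abs_square_eq_1 power2_eq_square)
    have eq: "lborel = distr lborel borel ((*v) S)"
    proof (rule lborel_eqI)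
      fix l u :: "real^'n" assume lu: "\<And>b. b \<in> Basis \<Longrightarrow> l \<bullet> b \<le> u \<bullet> b"
      have lu': "l $ i \<le> u $ i" for i
        using lu[of "axis i 1"] by (simp add: cart_eq_inner_axis axis_in_Basis_iff)
      have im: "(*v) S -` box l u = box (S *v l) (S *v u)"
        unfolding set_eq_iff mem_box_cart vimage_eq Sx by (metis transpose_involutory)
      have "emeasure (distr lborel borel ((*v) S)) (box l u) = emeasure lborel (box (S *v l) (S *v u))"
        by (simp add: emeasure_distr im)
      also have "\<dots> = ennreal (\<Prod>b\<in>Basis. (S *v u - S *v l) \<bullet> b)"
      proof (rule emeasure_lborel_box)
        fix b :: "real^'n" assume "b \<in> Basis"
        then obtain i where "b = axis i 1" by (auto simp: Basis_vec_def)
        then show "(S *v l) \<bullet> b \<le> (S *v u) \<bullet> b"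
          using lu'[of "?t i"] by (simp add: cart_eq_inner_axis[symmetric] Sx)
      qed
      also have "(\<Prod>b\<in>Basis. (S *v u - S *v l) \<bullet> b) = (\<Prod>i\<in>UNIV. (u - l) $ ?t i)"
        by (simp only: prod_Basis_cart[where h = "\<lambda>x. x"]) (simp add: Sx)
      also have "\<dots> = (\<Prod>i\<in>UNIV. (u - l) $ i)"
        using prod.reindex_bij_betw[OF bij_transpose[of m n], of "\<lambda>i. (u - l) $ i"] by simp
      also have "\<dots> = (\<Prod>b\<in>Basis. (u - l) \<bullet> b)" by (simp only: prod_Basis_cart[where h = "\<lambda>x. x"])
      finally show "emeasure (distr lborel borel ((*v) S)) (box l u) = ennreal (\<Prod>b\<in>Basis. (u - l) \<bullet> b)" .
    qed simp
    have int: "(\<integral>\<^sup>+x. f x \<partial>lborel) = (\<integral>\<^sup>+x. f (S *v x) \<partial>lborel)"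
      if "f \<in> borel_measurable borel" for f :: "real^'n \<Rightarrow> ennreal"
      by (rule trans[OF arg_cong[OF eq, of "\<lambda>M. integral\<^sup>N M f"] nn_integral_distr]) (use that in auto)
    show "P (\<chi> i j. mat 1 $ i $ ?t j)" unfolding S_def[symmetric] P_def dS
    proof (intro impI allI)
      fix f :: "real^'n \<Rightarrow> ennreal" assume "f \<in> borel_measurable borel"
      from int[OF this] show "(\<integral>\<^sup>+x. f x \<partial>lborel) = ennreal 1 * (\<integral>\<^sup>+x. f (S *v x) \<partial>lborel)"
        by (simp only: ennreal_1 mult_1)
    qed
  next
    fix m n :: 'n and c :: real assume mn: "m \<noteq> n"
    define S :: "real^'n^'n" where "S = (\<chi> i j. if i = m \<and> j = n then c else of_bool (i = j))"
    have "S = (\<chi> k. if k = m then row m (mat 1) + c *s row n (mat 1) else row k (mat 1))"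
      using mn by (auto simp: S_def vec_eq_iff row_def mat_def)
    then have dS: "det S = 1" using det_row_operation[OF mn, of "mat 1 :: real^'n^'n" c] by simp
    have Sx: "S *v x = x + (c * x $ n) *\<^sub>R axis m 1" for x
    proof (rule vec_eq_iff[THEN iffD2], rule allI)
      fix i
      have "(S *v x) $ i = (\<Sum>j\<in>UNIV. (if j = i then x $ i else 0) + (if j = n then (if i = m then c * x $ n else 0) else 0))"
        unfolding matrix_vector_mult_def S_def vec_lambda_beta using mn by (intro sum.cong) auto
      then show "(S *v x) $ i = (x + (c * x $ n) *\<^sub>R axis m 1) $ i"
        by (simp add: sum.distrib axis_def)
    qed
    show "P (\<chi> i j. if i = m \<and> j = n then c else of_bool (i = j))"
      unfolding S_def[symmetric] P_def dS Sx
    proof (intro impI allI)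
      fix f :: "real^'n \<Rightarrow> ennreal" assume "f \<in> borel_measurable borel"
      from nn_integral_lborel_shear[OF this mn, of c]
      show "(\<integral>\<^sup>+x. f x \<partial>lborel) = ennreal \<bar>1\<bar> * (\<integral>\<^sup>+x. f (x + (c * x $ n) *\<^sub>R axis m 1) \<partial>lborel)"
        by (simp only: abs_one ennreal_1 mult_1)
    qed
  qed
  from mp[OF spec[OF mp[OF this[unfolded P_def] assms(1)], of f] assms(2)] show ?thesis .
qed

text \<open>
  The integrand is the product of the unnormalized standard normal densities of the coordinates.
\<close>

lemma nn_integral_std_normal_vec:
  "(\<integral>\<^sup>+x. ennreal (exp (- (x \<bullet> x) / 2)) \<partial>(lborel :: (real^'n) measure)) = ennreal (sqrt ((2 * pi) ^ CARD('n)))"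
proof -
  interpret product_sigma_finite "\<lambda>_::real^'n. lborel :: real measure" ..
  have card: "card (Basis :: (real^'n) set) = CARD('n)" by simp
  have sq: "(\<Sum>b\<in>Basis. f b *\<^sub>R b) \<bullet> (\<Sum>b\<in>Basis. f b *\<^sub>R b) = (\<Sum>b\<in>Basis. (f b)\<^sup>2)" for f :: "real^'n \<Rightarrow> real"
    by (subst euclidean_inner) (simp add: power2_eq_square)
  have one: "(\<integral>\<^sup>+x. ennreal (exp (- x\<^sup>2 / 2)) \<partial>lborel) = ennreal (sqrt (2 * pi))"
  proof -
    have "1 = (\<integral>\<^sup>+x. ennreal (std_normal_density x) \<partial>lborel)"
      using prob_space.emeasure_space_1[OF prob_space_normal_density[of 1 0]]
      by (simp add: emeasure_density)
    then have "ennreal (sqrt (2*pi)) = ennreal (sqrt (2*pi)) * (\<integral>\<^sup>+x. ennreal (std_normal_density x) \<partial>lborel)"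
      by simp
    also have "\<dots> = (\<integral>\<^sup>+x. ennreal (sqrt (2*pi)) * ennreal (std_normal_density x) \<partial>lborel)"
      by (subst nn_integral_cmult) auto
    also have "\<dots> = (\<integral>\<^sup>+x. ennreal (exp (- x\<^sup>2 / 2)) \<partial>lborel)"
      by (intro nn_integral_cong) (simp add: ennreal_mult'[symmetric] std_normal_density_def)
    finally show ?thesis by simp
  qed
  have "(\<integral>\<^sup>+x. ennreal (exp (- (x \<bullet> x) / 2)) \<partial>(lborel :: (real^'n) measure))
      = (\<integral>\<^sup>+f. ennreal (exp (- ((\<Sum>b\<in>Basis. f b *\<^sub>R b) \<bullet> (\<Sum>b\<in>Basis. f b *\<^sub>R b)) / 2)) \<partial>(\<Pi>\<^sub>M b\<in>(Basis :: (real^'n) set). lborel))"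
    by (subst lborel_eq) (simp add: nn_integral_distr)
  also have "\<dots> = (\<integral>\<^sup>+f. (\<Prod>b\<in>Basis. ennreal (exp (- (f b)\<^sup>2 / 2))) \<partial>(\<Pi>\<^sub>M b\<in>(Basis :: (real^'n) set). lborel))"
  proof (intro nn_integral_cong)
    fix f :: "real^'n \<Rightarrow> real"
    have "exp (- (\<Sum>b\<in>Basis. (f b)\<^sup>2) / 2) = (\<Prod>b\<in>Basis. exp (- (f b)\<^sup>2 / 2))"
      by (simp add: exp_sum[symmetric] sum_negf sum_divide_distrib)
    then show "ennreal (exp (- ((\<Sum>b\<in>Basis. f b *\<^sub>R b) \<bullet> (\<Sum>b\<in>Basis. f b *\<^sub>R b)) / 2)) = (\<Prod>b\<in>Basis. ennreal (exp (- (f b)\<^sup>2 / 2)))"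
      by (simp add: sq prod_ennreal)
  qed
  also have "\<dots> = (\<Prod>b\<in>(Basis :: (real^'n) set). ennreal (sqrt (2 * pi)))"
    by (subst product_nn_integral_prod) (simp_all only: one finite_Basis, simp_all)
  also have "\<dots> = ennreal (sqrt ((2 * pi) ^ CARD('n)))"
    by (simp add: card ennreal_power real_sqrt_mult real_sqrt_power power_mult_distrib)
  finally show ?thesis .
qed

lemma pd_det_matrix_inv:
  fixes S :: "real^'n^'n"
  assumes "pd S" shows "0 < det S" "det (matrix_inv S) = 1 / det S"
proof -
  obtain B :: "real^'n^'n" where B: "invertible B" "transpose B ** matrix_inv S ** B = mat 1"
    using pd_congruence_identity[OF pd_matrix_inv[OF assms]] by blast
  have 1: "det B * det (matrix_inv S) * det B = 1"
    using arg_cong[OF B(2), of det] by (simp add: det_mul)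
  have 2: "det S * det (matrix_inv S) = 1"
    using arg_cong[OF matrix_inv_mult(1)[OF pd_invertible[OF assms]], of det] by (simp add: det_mul)
  have "det S = (det B)\<^sup>2"
  proof -
    have "det S = det S * (det B * det (matrix_inv S) * det B)" using 1 by simp
    also have "\<dots> = (det S * det (matrix_inv S)) * (det B)\<^sup>2" by (simp add: power2_eq_square)
    finally show ?thesis using 2 by simp
  qed
  then show "0 < det S" using 1 by auto
  then show "det (matrix_inv S) = 1 / det S" using 2 by (simp add: field_simps)
qed

text \<open>
  With columns orthonormal for the precision matrix, the substitution \<open>x = m + B y\<close> turns the density into
  the standard one, and \<open>det S = (det B)\<^sup>2\<close> matches the normalizing constant.
\<close>

lemma prob_space_gaussian:
  fixes S :: "real^'n^'n"
  assumes "pd S" shows "prob_space (gaussian m S)"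
proof
  let ?L = "matrix_inv S"
  let ?Z = "sqrt ((2 * pi) ^ CARD('n) * det S)"
  obtain B :: "real^'n^'n" where B: "invertible B" "transpose B ** ?L ** B = mat 1"
    using pd_congruence_identity[OF pd_matrix_inv[OF assms]] by blast
  have q: "(B *v y) \<bullet> (?L *v (B *v y)) = y \<bullet> y" for y
  proof -
    have "(B *v y) \<bullet> (?L *v (B *v y)) = y \<bullet> (transpose B *v (?L *v (B *v y)))"
      by (metis dot_lmul_matrix inner_commute transpose_matrix_vector transpose_transpose)
    also have "\<dots> = y \<bullet> ((transpose B ** ?L ** B) *v y)"
      by (simp add: matrix_vector_mul_assoc matrix_mul_assoc)
    finally show ?thesis by (simp add: B(2))
  qed
  have "det B * det ?L * det B = 1"
    using arg_cong[OF B(2), of det] by (simp add: det_mul)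
  then have dB: "det S = \<bar>det B\<bar>\<^sup>2"
    using pd_det_matrix_inv[OF assms] by (simp add: field_simps power2_eq_square)
  have Z: "?Z = sqrt ((2 * pi) ^ CARD('n)) * \<bar>det B\<bar>" by (simp add: dB real_sqrt_mult)
  have Zp: "?Z > 0" using pd_det_matrix_inv[OF assms] by simp
  have "emeasure (gaussian m S) (space (gaussian m S)) =
      (\<integral>\<^sup>+x. ennreal (exp (- ((x - m) \<bullet> (?L *v (x - m))) / 2) / ?Z) \<partial>(lborel :: (real^'n) measure))"
    by (simp add: gaussian_def emeasure_density)
  also have "\<dots> = (\<integral>\<^sup>+x. ennreal (exp (- ((x - m) \<bullet> (?L *v (x - m))) / 2) / ?Z) \<partial>distr lborel borel ((+) m))"
    by (simp add: lborel_distr_plus)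
  also have "\<dots> = (\<integral>\<^sup>+x. ennreal (exp (- (x \<bullet> (?L *v x)) / 2) / ?Z) \<partial>(lborel :: (real^'n) measure))"
    by (subst nn_integral_distr) auto
  also have "\<dots> = ennreal \<bar>det B\<bar> * (\<integral>\<^sup>+y. ennreal (exp (- (y \<bullet> y) / 2) / ?Z) \<partial>(lborel :: (real^'n) measure))"
    by (subst nn_integral_lborel_linear[of B]) (use B(1) in \<open>simp_all add: q invertible_det_nz\<close>)
  also have "\<dots> = (\<integral>\<^sup>+y. ennreal \<bar>det B\<bar> * ennreal (exp (- (y \<bullet> y) / 2) / ?Z) \<partial>(lborel :: (real^'n) measure))"
    by (simp add: nn_integral_cmult)
  also have "\<dots> = (\<integral>\<^sup>+y. ennreal (\<bar>det B\<bar> / ?Z) * ennreal (exp (- (y \<bullet> y) / 2)) \<partial>(lborel :: (real^'n) measure))"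
    using Zp by (intro nn_integral_cong) (simp add: ennreal_mult'[symmetric])
  also have "\<dots> = ennreal (\<bar>det B\<bar> / ?Z) * ennreal (sqrt ((2 * pi) ^ CARD('n)))"
    by (subst nn_integral_cmult) (simp_all only: nn_integral_std_normal_vec, simp)
  also have "\<dots> = ennreal (\<bar>det B\<bar> / ?Z * sqrt ((2 * pi) ^ CARD('n)))"
    using Zp by (subst ennreal_mult') auto
  also have "\<bar>det B\<bar> / ?Z * sqrt ((2 * pi) ^ CARD('n)) = 1"
    using Zp unfolding Z by (auto simp: field_simps)
  finally show "emeasure (gaussian m S) (space (gaussian m S)) = 1" by simp
qed


text \<open>
  Translation by the flow \<open>S\<close> changes the law \<open>M\<close> by the density \<open>exp (s * l - s\<^sup>2 * g / 2)\<close>. For a Gaussian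
  law, \<open>l\<close> is a linear functional with variance \<open>g\<close> and \<open>S s\<close> is the translation by \<open>s\<close> times the covariance
  applied to it. All moment and independence properties of Gaussians used below are consequences.
\<close>

section \<open>The Cameron--Martin formula\<close>

definition cameron_martin :: "'w measure \<Rightarrow> (real \<Rightarrow> 'w \<Rightarrow> 'w) \<Rightarrow> ('w \<Rightarrow> real) \<Rightarrow> real \<Rightarrow> bool" where
  "cameron_martin M S l g \<longleftrightarrow> prob_space M \<and> l \<in> borel_measurable M \<and>
     (\<forall>s. S s \<in> measurable M M) \<and> (\<forall>s \<omega>. l (S s \<omega>) = l \<omega> + s * g) \<and>
     (\<forall>s F. F \<in> borel_measurable M \<longrightarrow>
        (\<integral>\<^sup>+\<omega>. F (S s \<omega>) \<partial>M) = (\<integral>\<^sup>+\<omega>. F \<omega> * ennreal (exp (s * l \<omega> - s\<^sup>2 * g / 2)) \<partial>M))"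

lemma cameron_martin_integral:
  fixes F :: "'w \<Rightarrow> real"
  assumes cm: "cameron_martin M S l g" and F[measurable]: "F \<in> borel_measurable M"
  shows "(\<integral>\<omega>. F \<omega> * exp (s * l \<omega>) \<partial>M) = exp (s\<^sup>2 * g / 2) * (\<integral>\<omega>. F (S s \<omega>) \<partial>M)"
proof -
  have S[measurable]: "S s \<in> measurable M M" and l[measurable]: "l \<in> borel_measurable M"
    using cm by (auto simp: cameron_martin_def)
  have shift: "(\<integral>\<^sup>+\<omega>. F (S s \<omega>) \<partial>M) = (\<integral>\<^sup>+\<omega>. F \<omega> * ennreal (exp (s * l \<omega> - s\<^sup>2 * g / 2)) \<partial>M)"
    if "F \<in> borel_measurable M" for F
    using cm that unfolding cameron_martin_def by blast
  have "distr M M (S s) = density M (\<lambda>\<omega>. ennreal (exp (s * l \<omega> - s\<^sup>2 * g / 2)))"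
  proof (rule measure_eqI)
    fix A assume "A \<in> sets (distr M M (S s))"
    then have A[measurable]: "A \<in> sets M" by simp
    have "emeasure (distr M M (S s)) A = (\<integral>\<^sup>+\<omega>. indicator A \<omega> \<partial>distr M M (S s))" by simp
    also have "\<dots> = (\<integral>\<^sup>+\<omega>. indicator A (S s \<omega>) \<partial>M)" by (subst nn_integral_distr) auto
    also have "\<dots> = emeasure (density M (\<lambda>\<omega>. ennreal (exp (s * l \<omega> - s\<^sup>2 * g / 2)))) A"
      by (subst shift) (auto simp: emeasure_density mult.commute)
    finally show "emeasure (distr M M (S s)) A = emeasure (density M (\<lambda>\<omega>. ennreal (exp (s * l \<omega> - s\<^sup>2 * g / 2)))) A" .
  qed simp
  then have "(\<integral>\<omega>. F (S s \<omega>) \<partial>M) = integral\<^sup>L (density M (\<lambda>\<omega>. ennreal (exp (s * l \<omega> - s\<^sup>2 * g / 2)))) F"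
    using integral_distr[OF S F] by simp
  also have "\<dots> = (\<integral>\<omega>. exp (s * l \<omega> - s\<^sup>2 * g / 2) *\<^sub>R F \<omega> \<partial>M)"
    by (subst integral_density) auto
  also have "\<dots> = (\<integral>\<omega>. exp (- (s\<^sup>2 * g / 2)) * (F \<omega> * exp (s * l \<omega>)) \<partial>M)"
  proof (intro Bochner_Integration.integral_cong refl)
    have "exp (x - y) = exp (- y) * exp x" for x y :: real by (simp add: mult_exp_exp)
    then show "exp (s * l \<omega> - s\<^sup>2 * g / 2) *\<^sub>R F \<omega> = exp (- (s\<^sup>2 * g / 2)) * (F \<omega> * exp (s * l \<omega>))" for \<omega>
      by (simp only: real_scaleR_def) (simp only: ac_simps)
  qed
  finally show ?thesis by (simp add: exp_minus field_simps)
qed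

text \<open>
  Taking the constant \<open>1\<close> as integrand computes the exponential moments of \<open>l\<close>.
\<close>

lemma cameron_martin_exp_integrable:
  assumes cm: "cameron_martin M S l g"
  shows "integrable M (\<lambda>\<omega>. exp (c * \<bar>l \<omega>\<bar>))"
proof -
  interpret prob_space M using cm by (simp add: cameron_martin_def)
  have l[measurable]: "l \<in> borel_measurable M"
    using cm by (auto simp: cameron_martin_def)
  have e: "integrable M (\<lambda>\<omega>. exp (s * l \<omega>))" for s
  proof -
    have "(\<integral>\<^sup>+\<omega>. 1 * ennreal (exp (s * l \<omega> - s\<^sup>2 * g / 2)) \<partial>M) = (\<integral>\<^sup>+\<omega>. (\<lambda>_. 1) (S s \<omega>) \<partial>M)"
    proof -
      have "\<forall>F. F \<in> borel_measurable M \<longrightarrow>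
        (\<integral>\<^sup>+\<omega>. F (S s \<omega>) \<partial>M) = (\<integral>\<^sup>+\<omega>. F \<omega> * ennreal (exp (s * l \<omega> - s\<^sup>2 * g / 2)) \<partial>M)"
        using cm unfolding cameron_martin_def by blast
      from mp[OF spec[OF this, of "\<lambda>_. 1"]] show ?thesis by simp
    qed
    also have "\<dots> = 1" by (simp add: emeasure_space_1)
    finally have "integrable M (\<lambda>\<omega>. exp (s * l \<omega> - s\<^sup>2 * g / 2))"
      by (intro integrableI_nonneg) auto
    then have "integrable M (\<lambda>\<omega>. exp (s\<^sup>2 * g / 2) * exp (s * l \<omega> - s\<^sup>2 * g / 2))"
      by (rule integrable_mult_right)
    then show ?thesis by (simp add: exp_add[symmetric])
  qed
  show ?thesis
  proof (rule Bochner_Integration.integrable_bound)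
    show "integrable M (\<lambda>\<omega>. exp (c * l \<omega>) + exp ((-c) * l \<omega>))" using e by (intro Bochner_Integration.integrable_add)
    show "AE \<omega> in M. norm (exp (c * \<bar>l \<omega>\<bar>)) \<le> norm (exp (c * l \<omega>) + exp ((-c) * l \<omega>))"
    proof (rule AE_I2)
      fix \<omega>
      have "exp (c * \<bar>l \<omega>\<bar>) \<le> exp (c * l \<omega>) + exp ((-c) * l \<omega>)"
        by (cases "l \<omega> \<ge> 0") (auto simp: abs_if)
      then show "norm (exp (c * \<bar>l \<omega>\<bar>)) \<le> norm (exp (c * l \<omega>) + exp ((-c) * l \<omega>))" by simp
    qed
  qed simp
qed

lemma tendsto_exp_quotient:
  "(\<lambda>n. real (Suc n) * (exp (x / real (Suc n)) - 1)) \<longlonglongrightarrow> x"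
proof -
  have "((\<lambda>h. exp (x * h)) has_real_derivative x) (at 0)"
    by (auto intro!: derivative_eq_intros)
  then have lim: "((\<lambda>h. (exp (x * h) - 1) / h) \<longlongrightarrow> x) (at 0)"
    by (simp add: has_field_derivative_iff)
  have "filterlim (\<lambda>n. 1 / real (Suc n)) (at 0) sequentially"
    by (intro filterlim_atI LIMSEQ_Suc[OF lim_1_over_n]) auto
  from filterlim_compose[OF lim this] show ?thesis by (simp add: field_simps)
qed

text \<open>
  Differentiation of the expectation of \<open>F * exp (s * l)\<close> at \<open>s = 0\<close> along \<open>s = 1 / (n + 1)\<close>, by dominated
  convergence: the difference quotients of the exponential are bounded by \<open>exp (2 * \<bar>l\<bar>)\<close>.
\<close>

lemma cameron_martin_derivative:
  fixes F :: "'w \<Rightarrow> real"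
  assumes cm: "cameron_martin M S l g" and F[measurable]: "F \<in> borel_measurable M"
    and int: "integrable M (\<lambda>\<omega>. \<bar>F \<omega>\<bar> * exp (2 * \<bar>l \<omega>\<bar>))"
  shows "integrable M (\<lambda>\<omega>. F \<omega> * l \<omega>)"
    and "(\<lambda>n. real (Suc n) * ((\<integral>\<omega>. F \<omega> * exp (1 / real (Suc n) * l \<omega>) \<partial>M) - (\<integral>\<omega>. F \<omega> \<partial>M)))
      \<longlonglongrightarrow> (\<integral>\<omega>. F \<omega> * l \<omega> \<partial>M)"
proof -
  have l[measurable]: "l \<in> borel_measurable M"
    using cm by (auto simp: cameron_martin_def)
  have xe: "\<bar>x\<bar> \<le> exp \<bar>x\<bar>" for x :: real
    using exp_ge_add_one_self[of "\<bar>x\<bar>"] by linarith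
  have e1: "\<bar>exp y - 1\<bar> \<le> \<bar>y\<bar> * exp \<bar>y\<bar>" for y :: real
  proof -
    have "exp y * (1 - y) \<le> exp y * exp (- y)"
      using exp_ge_add_one_self[of "- y"] by (intro mult_left_mono) auto
    then have 1: "exp y - 1 \<le> y * exp y" by (simp add: mult_exp_exp algebra_simps)
    have 2: "1 - exp y \<le> - y" using exp_ge_add_one_self[of y] by linarith
    show ?thesis
    proof (cases "y \<ge> 0")
      case False
      then have "- y * 1 \<le> - y * exp (- y)" by (intro mult_left_mono) auto
      moreover have "\<bar>exp y - 1\<bar> = 1 - exp y" "\<bar>y\<bar> = - y" using False by auto
      ultimately show ?thesis using 2 by (simp only:)
    qed (use 1 in \<open>simp add: abs_if\<close>)
  qed
  have b: "\<bar>real (Suc n) * (exp (x / real (Suc n)) - 1)\<bar> \<le> exp (2 * \<bar>x\<bar>)" for x n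
  proof -
    have "\<bar>x / real (Suc n)\<bar> \<le> \<bar>x\<bar>"
      by (simp add: field_simps mult_le_cancel_left1 abs_mult)
    then have "\<bar>exp (x / real (Suc n)) - 1\<bar> \<le> \<bar>x / real (Suc n)\<bar> * exp \<bar>x\<bar>"
      by (intro order.trans[OF e1] mult_left_mono) auto
    then have "real (Suc n) * \<bar>exp (x / real (Suc n)) - 1\<bar> \<le> real (Suc n) * (\<bar>x / real (Suc n)\<bar> * exp \<bar>x\<bar>)"
      by (intro mult_left_mono) auto
    also have "\<dots> = \<bar>x\<bar> * exp \<bar>x\<bar>" by simp
    also have "\<dots> \<le> exp \<bar>x\<bar> * exp \<bar>x\<bar>" by (intro mult_right_mono xe) auto
    also have "\<dots> = exp (2 * \<bar>x\<bar>)" by (simp add: exp_add[symmetric])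
    finally show ?thesis by (simp add: abs_mult)
  qed
  show "integrable M (\<lambda>\<omega>. F \<omega> * l \<omega>)"
  proof (rule Bochner_Integration.integrable_bound[OF int])
    have "\<bar>x\<bar> \<le> exp (2 * \<bar>x\<bar>)" for x :: real
      by (rule order.trans[OF xe]) simp
    then show "AE \<omega> in M. norm (F \<omega> * l \<omega>) \<le> norm (\<bar>F \<omega>\<bar> * exp (2 * \<bar>l \<omega>\<bar>))"
      by (auto simp: abs_mult intro!: mult_left_mono)
  qed simp
  have intF: "integrable M F"
    by (rule Bochner_Integration.integrable_bound[OF int]) (auto simp: abs_mult mult_le_cancel_left1)
  have conv: "(\<lambda>n. \<integral>\<omega>. F \<omega> * (real (Suc n) * (exp (l \<omega> / real (Suc n)) - 1)) \<partial>M) \<longlonglongrightarrow> (\<integral>\<omega>. F \<omega> * l \<omega> \<partial>M)"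
  proof (rule integral_dominated_convergence[OF _ _ int])
    show "AE \<omega> in M. (\<lambda>n. F \<omega> * (real (Suc n) * (exp (l \<omega> / real (Suc n)) - 1))) \<longlonglongrightarrow> F \<omega> * l \<omega>"
      by (intro AE_I2 tendsto_mult tendsto_const tendsto_exp_quotient)
    show "AE \<omega> in M. norm (F \<omega> * (real (Suc n) * (exp (l \<omega> / real (Suc n)) - 1))) \<le> \<bar>F \<omega>\<bar> * exp (2 * \<bar>l \<omega>\<bar>)" for n
      unfolding real_norm_def abs_mult[of "F _"] by (intro AE_I2 mult_left_mono b) auto
  qed simp_all
  have "(\<integral>\<omega>. F \<omega> * (real (Suc n) * (exp (l \<omega> / real (Suc n)) - 1)) \<partial>M)
     = real (Suc n) * ((\<integral>\<omega>. F \<omega> * exp (1 / real (Suc n) * l \<omega>) \<partial>M) - (\<integral>\<omega>. F \<omega> \<partial>M))" for n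
  proof -
    have "integrable M (\<lambda>\<omega>. F \<omega> * exp (1 / real (Suc n) * l \<omega>))"
    proof (rule Bochner_Integration.integrable_bound[OF int])
      have "1 / real (Suc n) * x \<le> 2 * \<bar>x\<bar>" for x
      proof -
        have "1 / real (Suc n) * x \<le> 1 / real (Suc n) * \<bar>x\<bar>" by (intro mult_left_mono) auto
        also have "\<dots> \<le> 1 * \<bar>x\<bar>" by (intro mult_right_mono) auto
        finally show ?thesis by simp
      qed
      then show "AE \<omega> in M. norm (F \<omega> * exp (1 / real (Suc n) * l \<omega>)) \<le> norm (\<bar>F \<omega>\<bar> * exp (2 * \<bar>l \<omega>\<bar>))"
        by (intro AE_I2) (simp only: real_norm_def abs_mult abs_exp_cancel abs_abs exp_le_cancel_iff mult_left_mono abs_ge_zero)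
    qed simp
    note i = this
    have "(\<integral>\<omega>. F \<omega> * (real (Suc n) * (exp (l \<omega> / real (Suc n)) - 1)) \<partial>M)
       = (\<integral>\<omega>. real (Suc n) * (F \<omega> * exp (1 / real (Suc n) * l \<omega>) - F \<omega>) \<partial>M)"
      by (intro Bochner_Integration.integral_cong) (auto simp: algebra_simps)
    also have "\<dots> = real (Suc n) * (\<integral>\<omega>. F \<omega> * exp (1 / real (Suc n) * l \<omega>) - F \<omega> \<partial>M)"
      by (rule integral_mult_right_zero)
    also have "(\<integral>\<omega>. F \<omega> * exp (1 / real (Suc n) * l \<omega>) - F \<omega> \<partial>M) = (\<integral>\<omega>. F \<omega> * exp (1 / real (Suc n) * l \<omega>) \<partial>M) - (\<integral>\<omega>. F \<omega> \<partial>M)"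
      by (rule Bochner_Integration.integral_diff[OF i intF])
    finally show ?thesis .
  qed
  with conv show "(\<lambda>n. real (Suc n) * ((\<integral>\<omega>. F \<omega> * exp (1 / real (Suc n) * l \<omega>) \<partial>M) - (\<integral>\<omega>. F \<omega> \<partial>M)))
      \<longlonglongrightarrow> (\<integral>\<omega>. F \<omega> * l \<omega> \<partial>M)" by simp
qed

lemma tendsto_gaussian_quotient:
  "(\<lambda>n. real (Suc n) * (exp ((1 / real (Suc n))\<^sup>2 * g / 2) - 1)) \<longlonglongrightarrow> 0"
proof -
  have "((\<lambda>h. exp (h\<^sup>2 * g / 2)) has_real_derivative 0) (at 0)"
    by (auto intro!: derivative_eq_intros)
  then have lim: "((\<lambda>h. (exp (h\<^sup>2 * g / 2) - 1) / h) \<longlongrightarrow> 0) (at 0)"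
    by (simp add: has_field_derivative_iff)
  have "filterlim (\<lambda>n. 1 / real (Suc n)) (at 0) sequentially"
    by (intro filterlim_atI LIMSEQ_Suc[OF lim_1_over_n]) auto
  from filterlim_compose[OF lim this] show ?thesis by (simp add: field_simps)
qed

text \<open>
  If \<open>F\<close> is invariant under the flow, the expectation of \<open>F * exp (s * l)\<close> is that of \<open>F\<close> times
  \<open>exp (s\<^sup>2 * g / 2)\<close>, whose derivative at \<open>0\<close> vanishes. Applied to functions \<open>F\<close> of statistics uncorrelated
  with \<open>l\<close>, this is the independence of uncorrelated jointly Gaussian variables in the form needed here.
\<close>

lemma cameron_martin_orthogonal:
  fixes F :: "'w \<Rightarrow> real"
  assumes cm: "cameron_martin M S l g" and F[measurable]: "F \<in> borel_measurable M"
    and sq: "integrable M (\<lambda>\<omega>. (F \<omega>)\<^sup>2)"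
    and inv: "\<And>s \<omega>. \<omega> \<in> space M \<Longrightarrow> F (S s \<omega>) = F \<omega>"
  shows "integrable M (\<lambda>\<omega>. F \<omega> * l \<omega>)" and "(\<integral>\<omega>. F \<omega> * l \<omega> \<partial>M) = 0"
proof -
  have l[measurable]: "l \<in> borel_measurable M"
    using cm by (auto simp: cameron_martin_def)
  have int: "integrable M (\<lambda>\<omega>. \<bar>F \<omega>\<bar> * exp (2 * \<bar>l \<omega>\<bar>))"
  proof (rule Bochner_Integration.integrable_bound)
    show "integrable M (\<lambda>\<omega>. (F \<omega>)\<^sup>2 + exp (4 * \<bar>l \<omega>\<bar>))"
      by (intro Bochner_Integration.integrable_add sq cameron_martin_exp_integrable[OF cm])
    have "\<bar>a\<bar> * exp (2 * b) \<le> a\<^sup>2 + exp (4 * b)" for a b :: real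
    proof -
      have "2 * (\<bar>a\<bar> * exp (2 * b)) \<le> a\<^sup>2 + (exp (2 * b))\<^sup>2"
        using sum_squares_bound[of "\<bar>a\<bar>" "exp (2 * b)"] by (simp add: mult.assoc)
      moreover have "exp (4 * b) = (exp (2 * b))\<^sup>2" by (simp add: power2_eq_square mult_exp_exp)
      moreover have "0 \<le> \<bar>a\<bar> * exp (2 * b)" by simp
      ultimately show ?thesis by linarith
    qed
    then show "AE \<omega> in M. norm (\<bar>F \<omega>\<bar> * exp (2 * \<bar>l \<omega>\<bar>)) \<le> norm ((F \<omega>)\<^sup>2 + exp (4 * \<bar>l \<omega>\<bar>))"
      by (auto simp: abs_mult)
  qed simp
  note D = cameron_martin_derivative[OF cm F int]
  show "integrable M (\<lambda>\<omega>. F \<omega> * l \<omega>)" by (rule D(1))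
  have "(\<integral>\<omega>. F \<omega> * exp (s * l \<omega>) \<partial>M) = exp (s\<^sup>2 * g / 2) * (\<integral>\<omega>. F \<omega> \<partial>M)" for s
    unfolding cameron_martin_integral[OF cm F] by (simp add: inv cong: Bochner_Integration.integral_cong)
  then have "(\<lambda>n. real (Suc n) * ((\<integral>\<omega>. F \<omega> * exp (1 / real (Suc n) * l \<omega>) \<partial>M) - (\<integral>\<omega>. F \<omega> \<partial>M)))
     = (\<lambda>n. real (Suc n) * (exp ((1 / real (Suc n))\<^sup>2 * g / 2) - 1) * (\<integral>\<omega>. F \<omega> \<partial>M))"
    by (simp only:) (simp add: algebra_simps)
  moreover have "\<dots> \<longlonglongrightarrow> 0 * (\<integral>\<omega>. F \<omega> \<partial>M)"
    by (intro tendsto_mult tendsto_gaussian_quotient tendsto_const)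
  ultimately show "(\<integral>\<omega>. F \<omega> * l \<omega> \<partial>M) = 0"
    using D(2) LIMSEQ_unique by force
qed

text \<open>
  The mean is the orthogonality to constants. For the second moment the same derivative is computed with
  \<open>F = l\<close>, which the flow moves by \<open>s * g\<close>.
\<close>

lemma cameron_martin_moments:
  assumes cm: "cameron_martin M S l g"
  shows "integrable M l" "(\<integral>\<omega>. l \<omega> \<partial>M) = 0"
    "integrable M (\<lambda>\<omega>. (l \<omega>)\<^sup>2)" "(\<integral>\<omega>. (l \<omega>)\<^sup>2 \<partial>M) = g"
proof -
  interpret prob_space M using cm by (simp add: cameron_martin_def)
  have l[measurable]: "l \<in> borel_measurable M" and shift: "\<And>s \<omega>. l (S s \<omega>) = l \<omega> + s * g"
    using cm by (auto simp: cameron_martin_def)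
  from cameron_martin_orthogonal[OF cm, of "\<lambda>_. 1"]
  show il: "integrable M l" and ml: "(\<integral>\<omega>. l \<omega> \<partial>M) = 0" by simp_all
  have int: "integrable M (\<lambda>\<omega>. \<bar>l \<omega>\<bar> * exp (2 * \<bar>l \<omega>\<bar>))"
  proof (rule Bochner_Integration.integrable_bound[OF cameron_martin_exp_integrable[OF cm, of 3]])
    have "\<bar>x\<bar> * exp (2 * \<bar>x\<bar>) \<le> exp (3 * \<bar>x\<bar>)" for x :: real
    proof -
      have "\<bar>x\<bar> \<le> exp \<bar>x\<bar>" using exp_ge_add_one_self[of "\<bar>x\<bar>"] by linarith
      then have "\<bar>x\<bar> * exp (2 * \<bar>x\<bar>) \<le> exp \<bar>x\<bar> * exp (2 * \<bar>x\<bar>)" by (intro mult_right_mono) auto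
      then show ?thesis by (simp add: exp_add[symmetric])
    qed
    then show "AE \<omega> in M. norm (\<bar>l \<omega>\<bar> * exp (2 * \<bar>l \<omega>\<bar>)) \<le> norm (exp (3 * \<bar>l \<omega>\<bar>))"
      by (auto simp: abs_mult)
  qed simp
  note D = cameron_martin_derivative[OF cm l int]
  show "integrable M (\<lambda>\<omega>. (l \<omega>)\<^sup>2)" using D(1) by (simp add: power2_eq_square)
  have "(\<integral>\<omega>. l \<omega> * exp (s * l \<omega>) \<partial>M) = exp (s\<^sup>2 * g / 2) * (s * g)" for s
    unfolding cameron_martin_integral[OF cm l] shift using il by (simp add: ml prob_space)
  then have "(\<lambda>n. real (Suc n) * ((\<integral>\<omega>. l \<omega> * exp (1 / real (Suc n) * l \<omega>) \<partial>M) - (\<integral>\<omega>. l \<omega> \<partial>M)))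
     = (\<lambda>n. exp ((1 / real (Suc n))\<^sup>2 * g / 2) * g)"
    by (simp only: ml) (simp add: fun_eq_iff)
  moreover have "\<dots> \<longlonglongrightarrow> exp (0\<^sup>2 * g / 2) * g"
    by (intro tendsto_intros LIMSEQ_Suc[OF lim_1_over_n]) auto
  ultimately show "(\<integral>\<omega>. (l \<omega>)\<^sup>2 \<partial>M) = g"
    using D(2) LIMSEQ_unique by (fastforce simp: power2_eq_square)
qed

lemma sets_gaussian[simp, measurable_cong]: "sets (gaussian m S) = sets borel"
  and space_gaussian[simp]: "space (gaussian m S) = UNIV"
  by (simp_all add: gaussian_def)

text \<open>
  Lebesgue measure is translation invariant and the exponent of the density is quadratic; the
  precision matrix cancels the covariance in the cross term.
\<close>

lemma cameron_martin_gaussian: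
  fixes S :: "real^'n^'n"
  assumes S: "pd S"
  shows "cameron_martin (gaussian 0 S) (\<lambda>s x. x + s *\<^sub>R (S *v a)) (\<lambda>x. a \<bullet> x) (a \<bullet> (S *v a))"
  unfolding cameron_martin_def
proof (intro conjI allI impI)
  show "prob_space (gaussian 0 S)" by (rule prob_space_gaussian[OF S])
  show "a \<bullet> (x + s *\<^sub>R (S *v a)) = a \<bullet> x + s * (a \<bullet> (S *v a))" for x s
    by (simp add: inner_add_right)
  let ?L = "matrix_inv S"
  let ?Z = "sqrt ((2 * pi) ^ CARD('n) * det S)"
  define p where "p x = exp (- (x \<bullet> (?L *v x)) / 2) / ?Z" for x
  have p: "gaussian 0 S = density lborel (\<lambda>x. ennreal (p x))"
    by (simp add: gaussian_def p_def)
  have [measurable]: "p \<in> borel_measurable borel" unfolding p_def by measurable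
  have Zp: "?Z > 0" using pd_det_matrix_inv[OF S] by simp
  fix s and F :: "real^'n \<Rightarrow> ennreal" assume "F \<in> borel_measurable (gaussian 0 S)"
  then have F[measurable]: "F \<in> borel_measurable borel" by (simp add: measurable_def)
  define u where "u = s *\<^sub>R (S *v a)"
  have sym: "transpose ?L = ?L" using pd_matrix_inv[OF S] by (simp add: pd_def)
  have Lu: "?L *v u = s *\<^sub>R a"
    by (simp add: u_def matrix_vector_mult_scaleR matrix_vector_mul_assoc matrix_inv_mult[OF pd_invertible[OF S]])
  have pu: "p (x - u) = p x * exp (s * (a \<bullet> x) - s\<^sup>2 * (a \<bullet> (S *v a)) / 2)" for x
  proof -
    have "(x - u) \<bullet> (?L *v (x - u)) = x \<bullet> (?L *v x) - 2 * (s * (a \<bullet> x)) + s\<^sup>2 * (a \<bullet> (S *v a))"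
    proof -
      have "u \<bullet> (?L *v x) = s * (a \<bullet> x)"
        using psd_inner_commute[OF sym, of u x] by (simp add: Lu inner_commute)
      moreover have "u \<bullet> a = s * (a \<bullet> (S *v a))" by (simp add: u_def inner_commute)
      ultimately show ?thesis
        by (simp add: matrix_vector_mult_diff_distrib inner_diff_left inner_diff_right Lu inner_commute[of x a])
           (simp add: power2_eq_square algebra_simps)
    qed
    then show ?thesis
      by (simp add: p_def exp_add[symmetric] field_simps)
  qed
  have pp: "0 \<le> p x" for x using Zp by (simp add: p_def)
  have "(\<integral>\<^sup>+x. F (x + s *\<^sub>R (S *v a)) \<partial>gaussian 0 S) = (\<integral>\<^sup>+x. ennreal (p x) * F (x + u) \<partial>lborel)"
    unfolding p u_def[symmetric] by (subst nn_integral_density) auto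
  also have "\<dots> = (\<integral>\<^sup>+x. ennreal (p (u + x - u)) * F (u + x) \<partial>lborel)" by (simp add: add.commute)
  also have "\<dots> = (\<integral>\<^sup>+x. ennreal (p (x - u)) * F x \<partial>distr lborel borel ((+) u))"
    by (subst nn_integral_distr) auto
  also have "\<dots> = (\<integral>\<^sup>+x. ennreal (p (x - u)) * F x \<partial>lborel)" by (simp add: lborel_distr_plus)
  also have "\<dots> = (\<integral>\<^sup>+x. ennreal (p x) * (F x * ennreal (exp (s * (a \<bullet> x) - s\<^sup>2 * (a \<bullet> (S *v a)) / 2))) \<partial>lborel)"
    by (intro nn_integral_cong) (simp add: pu ennreal_mult' pp ac_simps)
  also have "\<dots> = (\<integral>\<^sup>+x. F x * ennreal (exp (s * (a \<bullet> x) - s\<^sup>2 * (a \<bullet> (S *v a)) / 2)) \<partial>gaussian 0 S)"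
    unfolding p by (subst nn_integral_density) auto
  finally show "(\<integral>\<^sup>+x. F (x + s *\<^sub>R (S *v a)) \<partial>gaussian 0 S)
     = (\<integral>\<^sup>+x. F x * ennreal (exp (s * (a \<bullet> x) - s\<^sup>2 * (a \<bullet> (S *v a)) / 2)) \<partial>gaussian 0 S)" .
qed simp_all


section \<open>Second moments\<close>

lemma inner_matrix_vector_mult_sum:
  "x \<bullet> (M *v y) = (\<Sum>i\<in>UNIV. \<Sum>j\<in>UNIV. M $ i $ j * (x $ i * y $ j))" for M :: "real^'m^'n"
  by (simp add: inner_vec_def matrix_vector_mult_def sum_distrib_left ac_simps)

lemma inner_matrix_sum: "M \<bullet> N = (\<Sum>i\<in>UNIV. \<Sum>j\<in>UNIV. M $ i $ j * N $ i $ j)" for M :: "real^'m^'n"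
  by (simp add: inner_vec_def)

definition centered_second_moment :: "(real^'n) measure \<Rightarrow> real^'n^'n \<Rightarrow> bool" where
  "centered_second_moment P S \<longleftrightarrow> prob_space P \<and> sets P = sets borel \<and>
     (\<forall>a. integrable P (\<lambda>x. a \<bullet> x) \<and> (\<integral>x. a \<bullet> x \<partial>P) = 0) \<and>
     (\<forall>a b. integrable P (\<lambda>x. (a \<bullet> x) * (b \<bullet> x)) \<and> (\<integral>x. (a \<bullet> x) * (b \<bullet> x) \<partial>P) = a \<bullet> (S *v b))"

lemma centered_second_moment_quadratic:
  assumes P: "centered_second_moment P S"
  shows "integrable P (\<lambda>x. x \<bullet> (M *v x))" "(\<integral>x. x \<bullet> (M *v x) \<partial>P) = M \<bullet> S"
proof -
  have c: "integrable P (\<lambda>x. x $ i * x $ j) \<and> (\<integral>x. x $ i * x $ j \<partial>P) = S $ i $ j" for i j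
  proof -
    have "axis i 1 \<bullet> (S *v axis j 1) = S $ i $ j"
      by (simp add: matrix_vector_mult_basis inner_axis' column_def)
    moreover have "x $ i * x $ j = (axis i 1 \<bullet> x) * (axis j 1 \<bullet> x)" for x
      by (simp add: inner_axis')
    ultimately show ?thesis using P by (simp add: centered_second_moment_def)
  qed
  show "integrable P (\<lambda>x. x \<bullet> (M *v x))" unfolding inner_matrix_vector_mult_sum
    using c by (intro Bochner_Integration.integrable_sum integrable_mult_right) auto
  show "(\<integral>x. x \<bullet> (M *v x) \<partial>P) = M \<bullet> S" unfolding inner_matrix_vector_mult_sum inner_matrix_sum
    using c by (subst Bochner_Integration.integral_sum, (intro Bochner_Integration.integrable_sum integrable_mult_right; simp)+,
        intro sum.cong refl, subst Bochner_Integration.integral_sum) auto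
qed

text \<open>
  Variances come from the Cameron--Martin formula, covariances by polarization.
\<close>

lemma centered_second_moment_gaussian:
  fixes S :: "real^'n^'n"
  assumes S: "pd S" shows "centered_second_moment (gaussian 0 S) S"
  unfolding centered_second_moment_def
proof (intro conjI allI)
  note m = cameron_martin_moments[OF cameron_martin_gaussian[OF S]]
  fix a b :: "real^'n"
  show "prob_space (gaussian 0 S)" by (rule prob_space_gaussian[OF S])
  show "integrable (gaussian 0 S) ((\<bullet>) a)" "integral\<^sup>L (gaussian 0 S) ((\<bullet>) a) = 0"
    using m(1,2)[of a] by simp_all
  have e: "(a \<bullet> x) * (b \<bullet> x) = 1/4 * (((a + b) \<bullet> x)\<^sup>2 - ((a - b) \<bullet> x)\<^sup>2)" for x
    by (simp add: inner_add_left inner_diff_left power2_eq_square algebra_simps)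
  show "integrable (gaussian 0 S) (\<lambda>x. (a \<bullet> x) * (b \<bullet> x))"
    unfolding e by (intro integrable_mult_right Bochner_Integration.integrable_diff m(3))
  have sym: "transpose S = S" using S by (simp add: pd_def)
  show "(\<integral>x. (a \<bullet> x) * (b \<bullet> x) \<partial>gaussian 0 S) = a \<bullet> (S *v b)"
    unfolding e integral_mult_right_zero Bochner_Integration.integral_diff[OF m(3) m(3)] m(4)
    using psd_inner_commute[OF sym, of a b]
    by (simp add: matrix_vector_right_distrib matrix_vector_mult_diff_distrib inner_add_left inner_add_right inner_diff_left inner_diff_right)
qed simp

text \<open>
  The common source of the Cauchy--Schwarz inequalities for semidefinite forms below.
\<close>

lemma nonneg_quadratic_discriminant:
  fixes \<alpha> \<beta> \<kappa> :: real
  assumes "\<And>s. 0 \<le> \<alpha> + 2 * s * \<beta> + s\<^sup>2 * \<kappa>"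
  shows "\<beta>\<^sup>2 \<le> \<alpha> * \<kappa>"
proof (cases "\<kappa> = 0")
  case True
  have "\<beta> = 0"
  proof (rule ccontr)
    assume "\<beta> \<noteq> 0"
    with assms[of "- (\<alpha> + 1) / (2 * \<beta>)"] True show False by (simp add: field_simps)
  qed
  then show ?thesis using True by simp
next
  case False
  have k: "\<kappa> > 0"
  proof (rule ccontr)
    assume "\<not> \<kappa> > 0"
    then have k: "\<kappa> < 0" using False by simp
    define s where "s = (\<bar>\<alpha>\<bar> + 2 * \<bar>\<beta>\<bar> + 1) / (- \<kappa>) + 1"
    have s: "s \<ge> 1" using k by (simp add: s_def divide_nonneg_neg)
    have sk: "s * \<kappa> \<le> - (\<bar>\<alpha>\<bar> + 2 * \<bar>\<beta>\<bar> + 1)" using k by (simp add: s_def field_simps)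
    have "\<alpha> + 2 * s * \<beta> + s\<^sup>2 * \<kappa> \<le> s * (\<bar>\<alpha>\<bar> + 2 * \<bar>\<beta>\<bar> + s * \<kappa>)"
    proof -
      have "\<alpha> \<le> s * \<bar>\<alpha>\<bar>" using mult_right_mono[OF s, of "\<bar>\<alpha>\<bar>"] by linarith
      moreover have "s * \<beta> \<le> s * \<bar>\<beta>\<bar>" using s by (intro mult_left_mono) auto
      ultimately show ?thesis by (simp add: algebra_simps power2_eq_square)
    qed
    also have "\<dots> \<le> s * (-1)" using s sk by (intro mult_left_mono) auto
    finally show False using assms[of s] s by simp
  qed
  have "0 \<le> \<kappa> * (\<alpha> + 2 * (- \<beta> / \<kappa>) * \<beta> + (- \<beta> / \<kappa>)\<^sup>2 * \<kappa>)"
    by (rule mult_nonneg_nonneg[OF less_imp_le[OF k] assms])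
  also have "\<dots> = \<alpha> * \<kappa> - \<beta>\<^sup>2" using k by (simp add: field_simps power2_eq_square)
  finally show ?thesis by simp
qed

lemma psd_Cauchy_Schwarz:
  fixes M :: "real^'n^'n"
  assumes "psd M" shows "(x \<bullet> (M *v y))\<^sup>2 \<le> (x \<bullet> (M *v x)) * (y \<bullet> (M *v y))"
proof (rule nonneg_quadratic_discriminant)
  fix s
  have "0 \<le> (x + s *\<^sub>R y) \<bullet> (M *v (x + s *\<^sub>R y))" using assms by (simp add: psd_def)
  also have "\<dots> = x \<bullet> (M *v x) + 2 * s * (x \<bullet> (M *v y)) + s\<^sup>2 * (y \<bullet> (M *v y))"
    using assms psd_inner_commute[of M y x]
    by (simp add: psd_def matrix_vector_right_distrib matrix_vector_mult_scaleR inner_add_left inner_add_right power2_eq_square algebra_simps)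
  finally show "0 \<le> x \<bullet> (M *v x) + 2 * s * (x \<bullet> (M *v y)) + s\<^sup>2 * (y \<bullet> (M *v y))" .
qed

text \<open>
  The Cauchy--Schwarz inequality for the form of \<open>W\<close>, with \<open>x\<close> written as \<open>W\<close> applied to \<open>matrix_inv W *v x\<close>.
\<close>

lemma pd_inner_le:
  fixes W :: "real^'n^'n"
  assumes "pd W" shows "(a \<bullet> x)\<^sup>2 \<le> (a \<bullet> (W *v a)) * (x \<bullet> (matrix_inv W *v x))"
proof -
  note inv = matrix_inv_mult[OF pd_invertible[OF assms]]
  let ?y = "matrix_inv W *v x"
  have Wy: "W *v ?y = x" by (simp add: matrix_vector_mul_assoc inv)
  have "(a \<bullet> (W *v ?y))\<^sup>2 \<le> (a \<bullet> (W *v a)) * (?y \<bullet> (W *v ?y))"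
    by (rule psd_Cauchy_Schwarz[OF pd_imp_psd[OF assms]])
  then show ?thesis by (simp add: Wy inner_commute)
qed

text \<open>
  The logarithm of the density of the centered Gaussian with precision matrix \<open>L\<close> with respect to the
  one with covariance \<open>W\<close>.
\<close>

section \<open>The Gibbs inequality on a relative entropy ball\<close>

definition log_ratio :: "real^'n^'n \<Rightarrow> real^'n^'n \<Rightarrow> real^'n \<Rightarrow> real" where
  "log_ratio W L x = (x \<bullet> ((matrix_inv W - L) *v x) + ln (det W) + ln (det L)) / 2"

lemma log_ratio_measurable[measurable]: "log_ratio W L \<in> borel_measurable borel"
  unfolding log_ratio_def[abs_def] by measurable

lemma gaussian_eq_density_gaussian:
  fixes S W :: "real^'n^'n"
  assumes S: "pd S" and W: "pd W"
  shows "gaussian 0 S = density (gaussian 0 W) (\<lambda>x. ennreal (exp (log_ratio W (matrix_inv S) x)))"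
proof -
  have d: "det S > 0" "det W > 0" "det (matrix_inv S) = 1 / det S"
    using pd_det_matrix_inv[OF S] pd_det_matrix_inv[OF W] by auto
  let ?c = "(2 * pi) ^ CARD('n)"
  have "exp (- (x \<bullet> (matrix_inv W *v x)) / 2) / sqrt (?c * det W) * exp (log_ratio W (matrix_inv S) x)
      = exp (- (x \<bullet> (matrix_inv S *v x)) / 2) / sqrt (?c * det S)" for x
  proof -
    have "log_ratio W (matrix_inv S) x = x \<bullet> (matrix_inv W *v x) / 2 + - (x \<bullet> (matrix_inv S *v x)) / 2 + ln (det W / det S) / 2"
      using d by (simp add: log_ratio_def matrix_vector_mult_diff_rdistrib inner_diff_right ln_div diff_divide_distrib add_divide_distrib)
    then have lr: "exp (log_ratio W (matrix_inv S) x) = exp (x \<bullet> (matrix_inv W *v x) / 2) * exp (- (x \<bullet> (matrix_inv S *v x)) / 2) * exp (ln (det W / det S) / 2)"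
      by (simp only: exp_add)
    have w: "exp (ln (det W / det S) / 2) = sqrt (det W) / sqrt (det S)"
    proof -
      have "0 < sqrt (det W / det S)" using d by simp
      then have "sqrt (det W / det S) = exp (ln (sqrt (det W / det S)))" by simp
      also have "\<dots> = exp (ln (det W / det S) / 2)" using d by (simp add: ln_sqrt)
      finally show ?thesis by (simp add: real_sqrt_divide)
    qed
    have "exp (- u / 2) / sqrt (?c * det W) * (exp (u / 2) * v * (sqrt (det W) / sqrt (det S))) = v / sqrt (?c * det S)" for u v
    proof -
      have "exp (- u / 2) * exp (u / 2) = 1" by (simp add: mult_exp_exp)
      then have "exp (- u / 2) / sqrt (?c * det W) * (exp (u / 2) * v * (sqrt (det W) / sqrt (det S)))
        = 1 * v * (sqrt (det W) / sqrt (det S)) / sqrt (?c * det W)" by (metis (no_types, opaque_lifting) mult.assoc times_divide_eq_left times_divide_eq_right)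
      also have "\<dots> = v / sqrt (?c * det S)" using d by (simp add: real_sqrt_mult)
      finally show ?thesis .
    qed
    then show ?thesis unfolding lr w .
  qed
  then have "ennreal (exp (- (x \<bullet> (matrix_inv W *v x)) / 2) / sqrt (?c * det W)) * ennreal (exp (log_ratio W (matrix_inv S) x))
      = ennreal (exp (- (x \<bullet> (matrix_inv S *v x)) / 2) / sqrt (?c * det S))" for x
    using d by (subst ennreal_mult'[symmetric]) auto
  then show ?thesis
    unfolding gaussian_def by (subst density_density_eq) (auto intro!: density_cong)
qed

lemma matrix_inv_matrix_inv: "invertible M \<Longrightarrow> matrix_inv (matrix_inv M) = M" for M :: "real^'n^'n"
proof -
  assume "invertible M"
  note inv = matrix_inv_mult[OF this]
  then have "invertible (matrix_inv M)" unfolding invertible_def by blast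
  note inv2 = matrix_inv_mult[OF this]
  have "matrix_inv (matrix_inv M) = (M ** matrix_inv M) ** matrix_inv (matrix_inv M)" by (simp add: inv)
  also have "\<dots> = M" by (simp add: matrix_mul_assoc[symmetric] inv2)
  finally show ?thesis .
qed

lemma log_ratio_integral:
  assumes "centered_second_moment P S"
  shows "integrable P (log_ratio W L)"
    and "(\<integral>x. log_ratio W L x \<partial>P) = ((matrix_inv W - L) \<bullet> S + ln (det W) + ln (det L)) / 2"
proof -
  interpret prob_space P using assms by (simp add: centered_second_moment_def)
  note q = centered_second_moment_quadratic[OF assms]
  show "integrable P (log_ratio W L)" unfolding log_ratio_def[abs_def]
    using q(1)[of "matrix_inv W - L"] by simp
  show "(\<integral>x. log_ratio W L x \<partial>P) = ((matrix_inv W - L) \<bullet> S + ln (det W) + ln (det L)) / 2"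
    unfolding log_ratio_def using q[of "matrix_inv W - L"] by (simp add: prob_space)
qed

text \<open>
  For positive definite \<open>S\<close> the supremum of the left-hand side over \<open>L\<close> is attained at the inverse of \<open>S\<close> and
  equals twice the relative entropy of \<open>gaussian 0 S\<close> with respect to \<open>gaussian 0 W\<close>. Written as a family of
  linear inequalities in \<open>S\<close>, the constraint is visibly closed and convex, and no concavity of the
  logarithm of the determinant has to be proved.
\<close>

definition kl_cov_set :: "real^'n^'n \<Rightarrow> real \<Rightarrow> (real^'n^'n) set" where
  "kl_cov_set W r = {S. psd S \<and> (\<forall>L. pd L \<longrightarrow> (matrix_inv W - L) \<bullet> S + ln (det W) + ln (det L) \<le> 2 * r)}"

text \<open>
  The Donsker--Varadhan inequality for the Gaussian competitor with precision \<open>L\<close>. If \<open>f\<close> is the density of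
  \<open>P\<close> with respect to the nominal law, then \<open>log_ratio = ln f + ln (exp log_ratio / f)\<close>, and \<open>ln x \<le> x - 1\<close> bounds the
  second term by a function with nonpositive mean. The bound is stated through an integrable majorant
  because integrability of \<open>log_ratio\<close> itself is not yet known.
\<close>

lemma Gibbs_inequality:
  fixes W L :: "real^'n^'n"
  assumes W: "pd W" and L: "pd L" and P: "prob_space P" "sets P = sets borel"
    and ent: "rel_entropy P (gaussian 0 W) \<le> ereal r"
  obtains G where "integrable P G" "(\<integral>x. G x \<partial>P) \<le> r" "AE x in P. log_ratio W L x \<le> G x"
proof -
  let ?N = "gaussian 0 W" and ?h = "log_ratio W L"
  interpret N: prob_space ?N by (rule prob_space_gaussian[OF W])
  interpret P: prob_space P by fact
  have ac: "absolutely_continuous ?N P" and int: "integrable P (entropy_density (exp 1) ?N P)"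
    and kl: "KL_divergence (exp 1) ?N P \<le> r"
    using ent by (auto simp: rel_entropy_def split: if_splits)
  define f where "f = RN_deriv ?N P"
  have [measurable]: "f \<in> borel_measurable borel" unfolding f_def by measurable
  have sP: "sets P = sets ?N" using P(2) by simp
  have Pf: "density ?N f = P" unfolding f_def by (rule N.density_RN_deriv[OF ac sP])
  have "sigma_finite_measure P" ..
  from N.RN_deriv_finite[OF this ac sP] have "AE x in ?N. f x \<noteq> \<infinity>" by (simp add: f_def)
  then have ffin: "AE x in P. f x \<noteq> \<infinity>" by (rule absolutely_continuous_AE[OF _ ac, rotated]) (use sP in simp)
  have fpos: "AE x in P. f x \<noteq> 0"
    unfolding Pf[symmetric] by (subst AE_density) auto
  have L': "pd (matrix_inv L)" by (rule pd_matrix_inv[OF L])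
  have LL: "matrix_inv (matrix_inv L) = L" by (rule matrix_inv_matrix_inv[OF pd_invertible[OF L]])
  have one: "(\<integral>\<^sup>+x. ennreal (exp (?h x)) \<partial>?N) = 1"
    using prob_space.emeasure_space_1[OF prob_space_gaussian[OF L', of 0]]
    unfolding gaussian_eq_density_gaussian[OF L' W] LL by (simp add: emeasure_density)
  define e where "e x = exp (?h x) / enn2real (f x)" for x
  have [measurable]: "e \<in> borel_measurable borel" unfolding e_def by measurable
  then have [measurable]: "e \<in> borel_measurable P" using P(2) by (simp add: measurable_def sets_eq_imp_space_eq[OF P(2)])
  have e0: "0 \<le> e x" for x by (simp add: e_def)
  have "(\<integral>\<^sup>+x. ennreal (e x) \<partial>P) = (\<integral>\<^sup>+x. f x * ennreal (e x) \<partial>?N)"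
    unfolding Pf[symmetric] by (subst nn_integral_density) auto
  also have "\<dots> \<le> (\<integral>\<^sup>+x. ennreal (exp (?h x)) \<partial>?N)"
  proof (rule nn_integral_mono_AE, use \<open>AE x in ?N. f x \<noteq> \<infinity>\<close> in eventually_elim)
    fix x assume "f x \<noteq> \<infinity>"
    then have fx: "f x = ennreal (enn2real (f x))" by (simp add: less_top)
    have "f x * ennreal (e x) = ennreal (enn2real (f x) * e x)"
      by (subst fx) (simp add: ennreal_mult' e0)
    also have "\<dots> \<le> ennreal (exp (?h x))" by (intro ennreal_leI) (simp add: e_def)
    finally show "f x * ennreal (e x) \<le> ennreal (exp (?h x))" .
  qed
  finally have e1: "(\<integral>\<^sup>+x. ennreal (e x) \<partial>P) \<le> 1" by (simp add: one)
  have ie: "integrable P e"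
    by (rule integrableI_nonneg) (auto simp: e0 intro: le_less_trans[OF e1])
  have Ie: "(\<integral>x. e x \<partial>P) \<le> 1"
    using e1 nn_integral_eq_integral[OF ie] e0 by simp
  have ed: "entropy_density (exp 1) ?N P x = ln (enn2real (f x))" for x
    by (simp add: entropy_density_def f_def log_def)
  show ?thesis
  proof (rule that[of "\<lambda>x. entropy_density (exp 1) ?N P x + (e x - 1)"])
    show "integrable P (\<lambda>x. entropy_density (exp 1) ?N P x + (e x - 1))"
      using int ie by simp
    have "(\<integral>x. entropy_density (exp 1) ?N P x + (e x - 1) \<partial>P) = KL_divergence (exp 1) ?N P + ((\<integral>x. e x \<partial>P) - 1)"
      using int ie by (simp add: KL_divergence_def P.prob_space)
    then show "(\<integral>x. entropy_density (exp 1) ?N P x + (e x - 1) \<partial>P) \<le> r" using kl Ie by simp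
    show "AE x in P. ?h x \<le> entropy_density (exp 1) ?N P x + (e x - 1)"
      using ffin fpos
    proof eventually_elim
      fix x assume "f x \<noteq> \<infinity>" "f x \<noteq> 0"
      then have fp: "enn2real (f x) > 0" by (simp add: enn2real_positive_iff less_top zero_less_iff_neq_zero)
      then have ep: "e x > 0" by (simp add: e_def)
      have "?h x = ln (enn2real (f x)) + ln (e x)"
        using fp by (simp add: e_def ln_div)
      also have "\<dots> \<le> ln (enn2real (f x)) + (e x - 1)" using ln_le_minus_one[OF ep] by simp
      finally show "?h x \<le> entropy_density (exp 1) ?N P x + (e x - 1)" by (simp add: ed)
    qed
  qed
qed

lemma scaleR_matrix_vector: "(c *\<^sub>R M) *v x = c *\<^sub>R (M *v x)" for M :: "real^'n^'m"
  by (simp add: vec_eq_iff matrix_vector_mult_def sum_distrib_left mult.assoc)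

lemma pd_scaleR: "pd M \<Longrightarrow> 0 < c \<Longrightarrow> pd (c *\<^sub>R M)"
  unfolding pd_def by (auto simp: scaleR_matrix_vector) (auto simp: transpose_def vec_eq_iff)

text \<open>
  The competitor with precision half of the nominal one has a log-ratio that grows quadratically, so the
  Gibbs inequality first yields finite second moments. Then the log-ratios of all Gaussian competitors are
  integrable, and the Gibbs inequality becomes membership of the covariance in \<open>kl_cov_set\<close>.
\<close>

lemma kl_ball_second_moment:
  fixes W :: "real^'n^'n"
  assumes W: "pd W" and P: "P \<in> kl_ball ac_dists (gaussian 0 W) r"
  obtains S where "S \<in> kl_cov_set W r" "centered_second_moment P S"
proof -
  have ps: "prob_space P" and sP: "sets P = sets borel" and i1: "integrable P (\<lambda>x. x)" and m: "(\<integral>x. x \<partial>P) = 0"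
    and ent: "rel_entropy P (gaussian 0 W) \<le> ereal r"
    using P by (auto simp: kl_ball_def ac_dists_def)
  interpret prob_space P by fact
  have mP: "borel_measurable P = borel_measurable borel"
    using sP sets_eq_imp_space_eq[OF sP] by (auto simp: measurable_def)
  let ?Wi = "matrix_inv W"
  have Wi: "pd ?Wi" by (rule pd_matrix_inv[OF W])
  define L where "L = (1/2) *\<^sub>R ?Wi"
  have L: "pd L" unfolding L_def by (rule pd_scaleR[OF Wi]) simp
  obtain G where G: "integrable P G" "AE x in P. log_ratio W L x \<le> G x"
    using Gibbs_inequality[OF W L ps sP ent] by blast
  let ?q = "\<lambda>x. x \<bullet> (?Wi *v x)"
  define c where "c = ln (det W) + ln (det L)"
  have h: "log_ratio W L x = ?q x / 4 + c / 2" for x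
  proof -
    have "?Wi - L = (1/2) *\<^sub>R ?Wi" by (simp add: L_def vec_eq_iff)
    then show ?thesis by (simp add: log_ratio_def scaleR_matrix_vector c_def)
  qed
  have q0: "0 \<le> ?q x" for x using pd_imp_psd[OF Wi] by (simp add: psd_def)
  have iq: "integrable P ?q"
  proof (rule Bochner_Integration.integrable_bound)
    show "integrable P (\<lambda>x. 4 * \<bar>G x\<bar> + 2 * \<bar>c\<bar>)" using G(1) by simp
    show "AE x in P. norm (?q x) \<le> norm (4 * \<bar>G x\<bar> + 2 * \<bar>c\<bar>)"
      using G(2)
    proof eventually_elim
      fix x assume "log_ratio W L x \<le> G x"
      then have "?q x \<le> 4 * \<bar>G x\<bar> + 2 * \<bar>c\<bar>" unfolding h by linarith
      then show "norm (?q x) \<le> norm (4 * \<bar>G x\<bar> + 2 * \<bar>c\<bar>)" using q0[of x] by simp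
    qed
  qed (simp add: mP)
  have i2: "integrable P (\<lambda>x. (a \<bullet> x) * (b \<bullet> x))" for a b
  proof (rule Bochner_Integration.integrable_bound)
    show "integrable P (\<lambda>x. (a \<bullet> (W *v a) + b \<bullet> (W *v b)) * ?q x)" using iq by simp
    show "AE x in P. norm ((a \<bullet> x) * (b \<bullet> x)) \<le> norm ((a \<bullet> (W *v a) + b \<bullet> (W *v b)) * ?q x)"
    proof (rule AE_I2)
      fix x
      have "2 * (\<bar>a \<bullet> x\<bar> * \<bar>b \<bullet> x\<bar>) \<le> (a \<bullet> x)\<^sup>2 + (b \<bullet> x)\<^sup>2"
        using sum_squares_bound[of "\<bar>a \<bullet> x\<bar>" "\<bar>b \<bullet> x\<bar>"] by (simp add: mult.assoc)
      moreover have "0 \<le> \<bar>a \<bullet> x\<bar> * \<bar>b \<bullet> x\<bar>" by simp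
      ultimately have "\<bar>a \<bullet> x\<bar> * \<bar>b \<bullet> x\<bar> \<le> (a \<bullet> x)\<^sup>2 + (b \<bullet> x)\<^sup>2" by linarith
      also have "\<dots> \<le> (a \<bullet> (W *v a) + b \<bullet> (W *v b)) * ?q x"
        using pd_inner_le[OF W, of a x] pd_inner_le[OF W, of b x] by (simp add: algebra_simps)
      also have "\<dots> \<le> \<bar>(a \<bullet> (W *v a) + b \<bullet> (W *v b)) * ?q x\<bar>" by (rule abs_ge_self)
      finally show "norm ((a \<bullet> x) * (b \<bullet> x)) \<le> norm ((a \<bullet> (W *v a) + b \<bullet> (W *v b)) * ?q x)"
        by (simp only: abs_mult real_norm_def)
    qed
  qed (simp add: mP)
  define S :: "real^'n^'n" where "S = (\<chi> i j. \<integral>x. (axis i 1 \<bullet> x) * (axis j 1 \<bullet> x) \<partial>P)"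
  have S: "(\<integral>x. (a \<bullet> x) * (b \<bullet> x) \<partial>P) = a \<bullet> (S *v b)" for a b
  proof -
    have "(a \<bullet> x) * (b \<bullet> x) = (\<Sum>i\<in>UNIV. \<Sum>j\<in>UNIV. (a $ i * b $ j) * ((axis i 1 \<bullet> x) * (axis j 1 \<bullet> x)))" for x
      by (simp add: inner_axis') (simp add: inner_vec_def sum_product ac_simps)
    then have "(\<integral>x. (a \<bullet> x) * (b \<bullet> x) \<partial>P) = (\<Sum>i\<in>UNIV. \<Sum>j\<in>UNIV. (a $ i * b $ j) * S $ i $ j)"
      by (simp add: Bochner_Integration.integral_sum Bochner_Integration.integrable_sum i2 S_def)
    then show ?thesis by (simp add: inner_matrix_vector_mult_sum ac_simps)
  qed
  have csm: "centered_second_moment P S"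
    unfolding centered_second_moment_def using ps sP i1 m i2 S by simp
  have "psd S"
    unfolding psd_def
  proof (intro conjI allI)
    show "transpose S = S" by (simp add: S_def transpose_def mult.commute)
    show "0 \<le> x \<bullet> (S *v x)" for x unfolding S[symmetric] by (rule Bochner_Integration.integral_nonneg) simp
  qed
  moreover have "(matrix_inv W - M) \<bullet> S + ln (det W) + ln (det M) \<le> 2 * r" if M: "pd M" for M
  proof -
    obtain G where G: "integrable P G" "(\<integral>x. G x \<partial>P) \<le> r" "AE x in P. log_ratio W M x \<le> G x"
      using Gibbs_inequality[OF W M ps sP ent] by blast
    note lr = log_ratio_integral[OF csm, of W M]
    have "(\<integral>x. log_ratio W M x \<partial>P) \<le> (\<integral>x. G x \<partial>P)"
      by (rule integral_mono_AE[OF lr(1) G(1,3)])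
    with G(2) lr(2) show ?thesis by simp
  qed
  ultimately have "S \<in> kl_cov_set W r" by (simp add: kl_cov_set_def)
  then show ?thesis using csm by (rule that)
qed


text \<open>
  In an orthonormal basis containing the null direction \<open>a\<close> of \<open>M\<close>, scale the coordinate along \<open>a\<close> by \<open>s\<close>: the
  determinant is \<open>s\<close> while the pairing with \<open>M\<close> does not see \<open>s\<close>.
\<close>

section \<open>The covariances of a relative entropy ball\<close>

lemma log_det_unbounded:
  fixes a :: "real^'n" and M :: "real^'n^'n"
  assumes "norm a = 1" "psd M" "a \<bullet> (M *v a) = 0"
  shows "\<exists>c L. \<forall>s::real. 0 < s \<longrightarrow> pd (L s) \<and> L s \<bullet> M = c \<and> det (L s) = s"
proof -
  fix k :: 'n
  obtain A where A: "orthogonal_matrix A" "A *v axis k 1 = a"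
    using orthogonal_matrix_exists_basis[OF assms(1)] by metis
  have AA: "transpose A ** A = mat 1" "A ** transpose A = mat 1"
    using A(1) by (auto simp: orthogonal_matrix_def)
  define D :: "real \<Rightarrow> real^'n^'n" where "D s = (\<chi> i j. if i = j then (if i = k then s else 1) else 0)" for s
  define L where "L s = A ** D s ** transpose A" for s
  have trD: "transpose (D s) = D s" for s by (auto simp: D_def transpose_def vec_eq_iff)
  have Dq: "y \<bullet> (D s *v y) = (\<Sum>i\<in>UNIV. (if i = k then s else 1) * (y $ i)\<^sup>2)" for y s
    by (simp add: inner_matrix_vector_mult_sum D_def if_distrib[of "\<lambda>x. x * _"] power2_eq_square cong: if_cong)
  have q: "x \<bullet> (L s *v x) = (transpose A *v x) \<bullet> (D s *v (transpose A *v x))" for x s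
    by (simp add: L_def matrix_vector_mul_assoc[symmetric]) (metis dot_lmul_matrix inner_commute transpose_matrix_vector)
  have pd: "pd (L s)" if "0 < s" for s
    unfolding pd_def
  proof (intro conjI allI impI)
    show "transpose (L s) = L s" by (simp add: L_def matrix_transpose_mul trD matrix_mul_assoc)
    fix x :: "real^'n" assume "x \<noteq> 0"
    have "A *v (transpose A *v x) = x" by (simp only: matrix_vector_mul_assoc AA matrix_vector_mul_lid)
    then have "transpose A *v x \<noteq> 0" using \<open>x \<noteq> 0\<close> by auto
    then obtain i where i: "(transpose A *v x) $ i \<noteq> 0" by (auto simp: vec_eq_iff)
    show "0 < x \<bullet> (L s *v x)" unfolding q Dq
      by (rule sum_pos2[where i = i]) (use i that in auto)
  qed
  have det: "det (L s) = s" for s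
  proof -
    have "det A * det A = 1" using arg_cong[OF AA(1), of det] by (simp add: det_mul)
    moreover have "det (D s) = (\<Prod>i\<in>UNIV. D s $ i $ i)" by (rule det_diagonal) (simp add: D_def)
    moreover have "(\<Prod>i\<in>UNIV. D s $ i $ i) = s" by (simp add: D_def)
    ultimately show ?thesis by (simp add: L_def det_mul)
  qed
  have LM: "L s \<bullet> M = (\<Sum>i\<in>UNIV. (if i = k then s else 1) * (column i A \<bullet> (M *v column i A)))" for s
  proof -
    have Ls: "L s $ i $ j = (\<Sum>l\<in>UNIV. (if l = k then s else 1) * (A $ i $ l * A $ j $ l))" for i j
    proof -
      have "(A ** D s) $ i $ l = A $ i $ l * (if l = k then s else 1)" for l
        unfolding matrix_matrix_mult_def D_def vec_lambda_beta
        by (subst sum.remove[of _ l]) (auto intro!: sum.neutral)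
      then show ?thesis by (simp add: L_def matrix_matrix_mult_def[of "A ** D s"] transpose_def ac_simps)
    qed
    have "L s \<bullet> M = (\<Sum>i\<in>UNIV. \<Sum>j\<in>UNIV. \<Sum>l\<in>UNIV. (if l = k then s else 1) * (M $ i $ j * (A $ i $ l * A $ j $ l)))"
      by (simp add: inner_matrix_sum Ls sum_distrib_left sum_distrib_right ac_simps)
    also have "\<dots> = (\<Sum>i\<in>UNIV. \<Sum>l\<in>UNIV. \<Sum>j\<in>UNIV. (if l = k then s else 1) * (M $ i $ j * (A $ i $ l * A $ j $ l)))"
      by (intro sum.cong refl sum.swap)
    also have "\<dots> = (\<Sum>l\<in>UNIV. \<Sum>i\<in>UNIV. \<Sum>j\<in>UNIV. (if l = k then s else 1) * (M $ i $ j * (A $ i $ l * A $ j $ l)))"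
      by (rule sum.swap)
    finally show ?thesis by (simp only: inner_matrix_vector_mult_sum sum_distrib_left column_def vec_lambda_beta)
  qed
  have ck: "column k A = a" using A(2) by (simp add: matrix_vector_mult_basis)
  have c: "L s \<bullet> M = (\<Sum>i\<in>UNIV - {k}. column i A \<bullet> (M *v column i A))" for s
  proof -
    have "L s \<bullet> M = s * (a \<bullet> (M *v a)) + (\<Sum>i\<in>UNIV - {k}. (if i = k then s else 1) * (column i A \<bullet> (M *v column i A)))"
      unfolding LM by (subst sum.remove[of _ k]) (simp_all add: ck)
    also have "(\<Sum>i\<in>UNIV - {k}. (if i = k then s else 1) * (column i A \<bullet> (M *v column i A))) = (\<Sum>i\<in>UNIV - {k}. column i A \<bullet> (M *v column i A))"
      by (rule sum.cong) auto
    finally show ?thesis by (simp add: assms(3))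
  qed
  show ?thesis by (intro exI[of _ "\<Sum>i\<in>UNIV - {k}. column i A \<bullet> (M *v column i A)"] exI[of _ L] allI impI conjI pd c det)
qed

text \<open>
  A degenerate \<open>S\<close> has infinite relative entropy: along the precision matrices of \<open>log_det_unbounded\<close> the
  defining inequality would bound the logarithm from above.
\<close>

lemma kl_cov_set_pd:
  fixes W :: "real^'n^'n"
  assumes S: "S \<in> kl_cov_set W r"
  shows "pd S"
proof (rule ccontr)
  have psd: "psd S" and le: "\<And>L. pd L \<Longrightarrow> (matrix_inv W - L) \<bullet> S + ln (det W) + ln (det L) \<le> 2 * r"
    using S by (auto simp: kl_cov_set_def)
  assume "\<not> pd S"
  then obtain x where x: "x \<noteq> 0" "\<not> 0 < x \<bullet> (S *v x)" using psd by (auto simp: pd_def psd_def)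
  define a where "a = (1 / norm x) *\<^sub>R x"
  have a: "norm a = 1" "a \<bullet> (S *v a) = 0"
    using x psd by (auto simp: a_def psd_def matrix_vector_mult_scaleR not_less intro: antisym)
  from log_det_unbounded[OF a(1) psd a(2)] obtain c L
    where cL: "\<forall>s::real. 0 < s \<longrightarrow> pd (L s) \<and> L s \<bullet> S = c \<and> det (L s) = s" by (elim exE)
  then have L: "pd (L s)" "L s \<bullet> S = c" "det (L s) = s" if "0 < s" for s
    using that by simp_all
  define K where "K = 2 * r - matrix_inv W \<bullet> S + c - ln (det W)"
  have "ln s \<le> K" if "0 < s" for s
    using le[OF L(1)[OF that]] unfolding L(3)[OF that] inner_diff_left L(2)[OF that] K_def by linarith
  from this[of "exp (K + 1)"] show False by simp
qed

text \<open>
  The defining inequality of \<open>kl_cov_set\<close> at the inverse of \<open>S\<close> is the bound on the relative entropy of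
  \<open>gaussian 0 S\<close>, because the log-density of one Gaussian with respect to the other is \<open>log_ratio\<close>.
\<close>

lemma kl_cov_set_gaussian:
  fixes W :: "real^'n^'n"
  assumes W: "pd W" and S: "S \<in> kl_cov_set W r"
  shows "gaussian 0 S \<in> kl_ball gaussian_dists (gaussian 0 W) r"
proof -
  have pS: "pd S" by (rule kl_cov_set_pd[OF S])
  let ?P = "gaussian 0 S" and ?N = "gaussian 0 W" and ?h = "log_ratio W (matrix_inv S)"
  interpret P: prob_space ?P by (rule prob_space_gaussian[OF pS])
  interpret N: prob_space ?N by (rule prob_space_gaussian[OF W])
  note eq = gaussian_eq_density_gaussian[OF pS W]
  note csm = centered_second_moment_gaussian[OF pS]
  have acl: "absolutely_continuous lborel ?P"
    unfolding gaussian_def by (rule absolutely_continuousI_density) measurable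
  have ac: "absolutely_continuous ?N ?P"
    unfolding eq by (rule absolutely_continuousI_density) measurable
  have gd: "?P \<in> gaussian_dists"
    using pS acl P.prob_space_axioms by (auto simp: gaussian_dists_def ac_dists_def)
  have "AE x in ?N. ennreal (exp (?h x)) = RN_deriv ?N ?P x"
    by (rule N.RN_deriv_unique) (auto simp: eq[symmetric])
  then have "AE x in ?P. ennreal (exp (?h x)) = RN_deriv ?N ?P x"
    by (rule absolutely_continuous_AE[OF _ ac, rotated]) simp
  then have ae: "AE x in ?P. ?h x = entropy_density (exp 1) ?N ?P x"
    by eventually_elim (simp add: entropy_density_def log_def, metis enn2real_ennreal exp_ge_zero ln_exp)
  note lr = log_ratio_integral[OF csm, of W "matrix_inv S"]
  have m: "entropy_density (exp 1) ?N ?P \<in> borel_measurable ?P"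
    using measurable_entropy_density[of "exp 1" ?N ?P] by (simp add: measurable_def)
  have int: "integrable ?P (entropy_density (exp 1) ?N ?P)"
    using integrable_cong_AE[THEN iffD1, OF _ m ae] lr(1) by simp
  have "KL_divergence (exp 1) ?N ?P = (\<integral>x. ?h x \<partial>?P)"
    unfolding KL_divergence_def by (rule integral_cong_AE[symmetric, OF _ m ae]) simp
  also have "\<dots> \<le> r"
  proof -
    have "(matrix_inv W - matrix_inv S) \<bullet> S + ln (det W) + ln (det (matrix_inv S)) \<le> 2 * r"
      using S pd_matrix_inv[OF pS] unfolding kl_cov_set_def by blast
    moreover have "x \<le> 2 * r \<Longrightarrow> x / 2 \<le> r" for x :: real by simp
    ultimately show ?thesis unfolding lr(2) by blast
  qed
  finally have "rel_entropy ?P ?N \<le> ereal r"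
    using ac int by (simp add: rel_entropy_def)
  moreover have "integrable ?P (\<lambda>x. x)" "(\<integral>x. x \<partial>?P) = 0"
  proof -
    have c: "integrable ?P (\<lambda>x. b \<bullet> x)" "(\<integral>x. b \<bullet> x \<partial>?P) = 0" for b
      using csm by (auto simp: centered_second_moment_def)
    have "integrable ?P (\<lambda>x. \<Sum>b\<in>Basis. (b \<bullet> x) *\<^sub>R b)" using c(1) by simp
    then show i: "integrable ?P (\<lambda>x. x)" by (simp add: inner_commute[of _ "_::real^'n"] euclidean_representation)
    show "(\<integral>x. x \<partial>?P) = 0"
      by (rule euclidean_eqI) (use c(2) i in \<open>simp add: inner_commute[of "integral\<^sup>L _ _"] integral_inner_right[symmetric] del: integral_inner_right\<close>)
  qed
  ultimately show ?thesis using gd by (simp add: kl_ball_def)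
qed

lemma kl_cov_set_convex: "convex (kl_cov_set W r)" for W :: "real^'n^'n"
proof (rule convexI)
  fix S S' :: "real^'n^'n" and u v :: real
  assume S: "S \<in> kl_cov_set W r" and S': "S' \<in> kl_cov_set W r" and uv: "0 \<le> u" "0 \<le> v" "u + v = 1"
  have "transpose (u *\<^sub>R S + v *\<^sub>R S') = u *\<^sub>R transpose S + v *\<^sub>R transpose S'"
    by (simp add: transpose_def vec_eq_iff)
  moreover have "0 \<le> x \<bullet> ((u *\<^sub>R S + v *\<^sub>R S') *v x)" for x
    using S S' uv by (simp add: kl_cov_set_def psd_def matrix_vector_mult_add_rdistrib scaleR_matrix_vector inner_add_right)
  ultimately have psd: "psd (u *\<^sub>R S + v *\<^sub>R S')"
    using S S' by (simp add: kl_cov_set_def psd_def)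
  moreover have "(matrix_inv W - L) \<bullet> (u *\<^sub>R S + v *\<^sub>R S') + ln (det W) + ln (det L) \<le> 2 * r" if "pd L" for L
  proof -
    let ?c = "ln (det W) + ln (det L)"
    have "u * ((matrix_inv W - L) \<bullet> S + ?c) + v * ((matrix_inv W - L) \<bullet> S' + ?c) \<le> u * (2 * r) + v * (2 * r)"
      using S S' uv that by (intro add_mono mult_left_mono) (auto simp: kl_cov_set_def add.assoc)
    moreover have "u * ?c + v * ?c = ?c" "u * (2 * r) + v * (2 * r) = 2 * r"
      using uv(3) by (metis distrib_right mult_1)+
    ultimately show ?thesis by (simp add: inner_add_right distrib_left)
  qed
  ultimately show "u *\<^sub>R S + v *\<^sub>R S' \<in> kl_cov_set W r" by (simp add: kl_cov_set_def)
qed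

text \<open>
  Boundedness comes from the competitor with precision half of the nominal one, which bounds the pairing of
  \<open>S\<close> with the nominal precision; this controls the diagonal of \<open>S\<close>, and semidefiniteness the other entries.
\<close>

lemma kl_cov_set_compact:
  fixes W :: "real^'n^'n"
  assumes W: "pd W"
  shows "compact (kl_cov_set W r)"
proof -
  let ?Wi = "matrix_inv W"
  have "kl_cov_set W r = {S. transpose S = S} \<inter> (\<Inter>x. {S. 0 \<le> x \<bullet> (S *v x)}) \<inter>
      (\<Inter>L\<in>{L. pd L}. {S. (?Wi - L) \<bullet> S + ln (det W) + ln (det L) \<le> 2 * r})"
    by (auto simp: kl_cov_set_def psd_def)
  moreover have "closed {S :: real^'n^'n. transpose S = S}"
    unfolding transpose_def by (intro closed_Collect_eq continuous_intros)
  moreover have "closed {S :: real^'n^'n. 0 \<le> x \<bullet> (S *v x)}" for x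
    unfolding inner_matrix_vector_mult_sum by (intro closed_Collect_le continuous_intros)
  moreover have "closed {S :: real^'n^'n. (?Wi - L) \<bullet> S + ln (det W) + ln (det L) \<le> 2 * r}" for L
    by (intro closed_Collect_le continuous_intros)
  ultimately have cl: "closed (kl_cov_set W r)"
    by (simp only:) (intro closed_Int closed_INT ballI)
  have Wi: "pd ?Wi" by (rule pd_matrix_inv[OF W])
  define L where "L = (1/2) *\<^sub>R ?Wi"
  have L: "pd L" unfolding L_def by (rule pd_scaleR[OF Wi]) simp
  \<comment> \<open>The bound on the pairing with the nominal precision that \<open>L\<close> provides.\<close>
  define K where "K = 2 * (2 * r - ln (det W) - ln (det L))"
  define b where "b = (\<Sum>i\<in>UNIV. W $ i $ i) * K"
  have tr: "?Wi \<bullet> S \<le> K" if "S \<in> kl_cov_set W r" for S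
  proof -
    have "?Wi - L = (1/2) *\<^sub>R ?Wi" by (simp add: L_def vec_eq_iff)
    then show ?thesis using that L unfolding kl_cov_set_def K_def by (auto dest!: spec[of _ L])
  qed
  have diag: "a \<bullet> (S *v a) \<le> (a \<bullet> (W *v a)) * K" if S: "S \<in> kl_cov_set W r" for S a
  proof -
    note csm = centered_second_moment_gaussian[OF kl_cov_set_pd[OF S]]
    note q = centered_second_moment_quadratic[OF csm, of ?Wi]
    have "a \<bullet> (S *v a) = (\<integral>x. (a \<bullet> x) * (a \<bullet> x) \<partial>gaussian 0 S)"
      using csm by (simp add: centered_second_moment_def)
    also have "\<dots> \<le> (\<integral>x. (a \<bullet> (W *v a)) * (x \<bullet> (?Wi *v x)) \<partial>gaussian 0 S)"
      using csm q(1) pd_inner_le[OF W] by (intro integral_mono) (auto simp: centered_second_moment_def power2_eq_square)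
    also have "\<dots> = (a \<bullet> (W *v a)) * (?Wi \<bullet> S)" by (simp add: q(2))
    also have "\<dots> \<le> (a \<bullet> (W *v a)) * K"
      using tr[OF S] pd_imp_psd[OF W] by (intro mult_left_mono) (auto simp: psd_def)
    finally show ?thesis .
  qed
  have ii: "axis i 1 \<bullet> (S *v axis j 1) = S $ i $ j" for S :: "real^'n^'n" and i j
    by (simp add: matrix_vector_mult_basis inner_axis' column_def)
  have K0: "0 \<le> K" if S: "S \<in> kl_cov_set W r" for S
  proof -
    note q = centered_second_moment_quadratic[OF centered_second_moment_gaussian[OF kl_cov_set_pd[OF S]], of ?Wi]
    have "0 \<le> ?Wi \<bullet> S" unfolding q(2)[symmetric]
      using pd_imp_psd[OF Wi] by (intro Bochner_Integration.integral_nonneg) (simp add: psd_def)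
    then show ?thesis using tr[OF S] by linarith
  qed
  have entry: "\<bar>S $ i $ j\<bar> \<le> b" if S: "S \<in> kl_cov_set W r" for S i j
  proof -
    have psd: "psd S" using S by (simp add: kl_cov_set_def)
    have W0: "0 \<le> W $ i $ i" for i using pd_imp_psd[OF W] ii[of i W i] by (metis psd_def)
    have S0: "0 \<le> S $ i $ i" for i using psd ii[of i S i] by (metis psd_def)
    have d: "S $ i $ i \<le> b" for i
    proof -
      have "S $ i $ i \<le> W $ i $ i * K" using diag[OF S, of "axis i 1"] by (simp add: ii)
      also have "\<dots> \<le> b" unfolding b_def using W0 K0[OF S]
        by (intro mult_right_mono member_le_sum) auto
      finally show ?thesis .
    qed
    have "b \<ge> 0" using d[of i] S0[of i] by linarith
    have "(S $ i $ j)\<^sup>2 \<le> (S $ i $ i) * (S $ j $ j)"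
      using psd_Cauchy_Schwarz[OF psd, of "axis i 1" "axis j 1"] by (simp add: ii)
    also have "\<dots> \<le> b * b" using d S0 \<open>b \<ge> 0\<close> by (intro mult_mono) auto
    finally show ?thesis using \<open>b \<ge> 0\<close> by (metis abs_le_square_iff abs_of_nonneg power2_eq_square)
  qed
  have "norm S \<le> (\<Sum>i\<in>(UNIV::'n set). \<Sum>j\<in>(UNIV::'n set). b)" if S: "S \<in> kl_cov_set W r" for S
  proof -
    have "norm S \<le> (\<Sum>i\<in>UNIV. norm (S $ i))"
      by (simp add: norm_vec_def) (rule L2_set_le_sum, simp)
    also have "\<dots> \<le> (\<Sum>i\<in>UNIV. \<Sum>j\<in>UNIV. \<bar>S $ i $ j\<bar>)"
      by (intro sum_mono norm_le_l1_cart)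
    also have "\<dots> \<le> (\<Sum>i\<in>(UNIV::'n set). \<Sum>j\<in>(UNIV::'n set). b)"
      by (intro sum_mono entry[OF S])
    finally show ?thesis .
  qed
  then have "bounded (kl_cov_set W r)" by (auto simp: bounded_iff)
  with cl show ?thesis by (simp add: compact_eq_bounded_closed)
qed

text \<open>
  The nominal covariance belongs to the set, because the nominal law has relative entropy \<open>0\<close> to itself.
\<close>

lemma kl_cov_set_nonempty:
  fixes W :: "real^'n^'n"
  assumes W: "pd W" and r: "0 \<le> r"
  shows "kl_cov_set W r \<noteq> {}"
proof -
  let ?N = "gaussian 0 W"
  interpret N: prob_space ?N by (rule prob_space_gaussian[OF W])
  have "AE x in ?N. (1::ennreal) = RN_deriv ?N ?N x"
    by (rule N.RN_deriv_unique) (auto simp: density_1)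
  then have ae: "AE x in ?N. 0 = entropy_density (exp 1) ?N ?N x"
  proof eventually_elim
    fix x assume "(1::ennreal) = RN_deriv ?N ?N x"
    from this[symmetric] show "0 = entropy_density (exp 1) ?N ?N x" by (simp add: entropy_density_def)
  qed
  have m: "entropy_density (exp 1) ?N ?N \<in> borel_measurable ?N" by measurable
  have i: "integrable ?N (entropy_density (exp 1) ?N ?N)"
    using integrable_cong_AE[THEN iffD1, OF _ m ae] by simp
  have ent: "rel_entropy ?N ?N \<le> ereal r"
    using i r N.KL_same_eq_0 by (simp add: rel_entropy_def absolutely_continuous_def)
  note csm = centered_second_moment_gaussian[OF W]
  have "(matrix_inv W - L) \<bullet> W + ln (det W) + ln (det L) \<le> 2 * r" if L: "pd L" for L
  proof -
    obtain G where G: "integrable ?N G" "(\<integral>x. G x \<partial>?N) \<le> r" "AE x in ?N. log_ratio W L x \<le> G x"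
      using Gibbs_inequality[OF W L N.prob_space_axioms _ ent] by auto
    note lr = log_ratio_integral[OF csm, of W L]
    have "(\<integral>x. log_ratio W L x \<partial>?N) \<le> (\<integral>x. G x \<partial>?N)"
      by (rule integral_mono_AE[OF lr(1) G(1,3)])
    with G(2) lr(2) show ?thesis by simp
  qed
  then show ?thesis using pd_imp_psd[OF W] by (auto simp: kl_cov_set_def)
qed


section \<open>Second moments of products\<close>

lemma (in pair_prob_space) product_of_coordinates:
  fixes X :: "'a \<Rightarrow> real" and Y :: "'b \<Rightarrow> real"
  assumes X: "integrable M1 X" and Y: "integrable M2 Y"
  shows "integrable (M1 \<Otimes>\<^sub>M M2) (\<lambda>\<omega>. X (fst \<omega>) * Y (snd \<omega>))"
    and "(\<integral>\<omega>. X (fst \<omega>) * Y (snd \<omega>) \<partial>(M1 \<Otimes>\<^sub>M M2)) = (\<integral>x. X x \<partial>M1) * (\<integral>y. Y y \<partial>M2)"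
proof -
  have [measurable]: "X \<in> borel_measurable M1" "Y \<in> borel_measurable M2" using X Y by auto
  show i: "integrable (M1 \<Otimes>\<^sub>M M2) (\<lambda>\<omega>. X (fst \<omega>) * Y (snd \<omega>))"
  proof (rule Fubini_integrable)
    have "integrable M1 (\<lambda>x. norm (X x) * (\<integral>y. norm (Y y) \<partial>M2))"
      using X by (intro integrable_mult_left) auto
    then show "integrable M1 (\<lambda>x. \<integral>y. norm (X (fst (x, y)) * Y (snd (x, y))) \<partial>M2)"
      by (simp add: abs_mult)
  qed (use Y in auto)
  show "(\<integral>\<omega>. X (fst \<omega>) * Y (snd \<omega>) \<partial>(M1 \<Otimes>\<^sub>M M2)) = (\<integral>x. X x \<partial>M1) * (\<integral>y. Y y \<partial>M2)"
    using integral_fst'[OF i] by simp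
qed

text \<open>
  The calculus of uncorrelated summands: covariances of sums over independent blocks add up.
\<close>

definition centered_pair :: "'a measure \<Rightarrow> ('a \<Rightarrow> real) \<Rightarrow> ('a \<Rightarrow> real) \<Rightarrow> real \<Rightarrow> bool" where
  "centered_pair M X Y c \<longleftrightarrow> integrable M X \<and> (\<integral>\<omega>. X \<omega> \<partial>M) = 0 \<and> integrable M Y \<and> (\<integral>\<omega>. Y \<omega> \<partial>M) = 0 \<and>
     integrable M (\<lambda>\<omega>. X \<omega> * Y \<omega>) \<and> (\<integral>\<omega>. X \<omega> * Y \<omega> \<partial>M) = c"

lemma centered_pair_product:
  assumes "prob_space M" "prob_space N" and X: "centered_pair M X X' c" and Y: "centered_pair N Y Y' d"
  shows "centered_pair (M \<Otimes>\<^sub>M N) (\<lambda>\<omega>. X (fst \<omega>) + Y (snd \<omega>)) (\<lambda>\<omega>. X' (fst \<omega>) + Y' (snd \<omega>)) (c + d)"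
proof -
  interpret M: prob_space M by fact
  interpret N: prob_space N by fact
  interpret pair_prob_space M N ..
  have one: "integrable M (\<lambda>_. 1::real)" "integrable N (\<lambda>_. 1::real)" by auto
  have x: "integrable M X" "integrable M X'" "integrable M (\<lambda>\<omega>. X \<omega> * X' \<omega>)"
    and y: "integrable N Y" "integrable N Y'" "integrable N (\<lambda>\<omega>. Y \<omega> * Y' \<omega>)"
    using X Y by (auto simp: centered_pair_def)
  note p = product_of_coordinates
  have i: "integrable (M \<Otimes>\<^sub>M N) (\<lambda>\<omega>. X (fst \<omega>))" "integrable (M \<Otimes>\<^sub>M N) (\<lambda>\<omega>. X' (fst \<omega>))"
    "integrable (M \<Otimes>\<^sub>M N) (\<lambda>\<omega>. Y (snd \<omega>))" "integrable (M \<Otimes>\<^sub>M N) (\<lambda>\<omega>. Y' (snd \<omega>))"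
    "integrable (M \<Otimes>\<^sub>M N) (\<lambda>\<omega>. X (fst \<omega>) * X' (fst \<omega>))" "integrable (M \<Otimes>\<^sub>M N) (\<lambda>\<omega>. Y (snd \<omega>) * Y' (snd \<omega>))"
    "integrable (M \<Otimes>\<^sub>M N) (\<lambda>\<omega>. X (fst \<omega>) * Y' (snd \<omega>))" "integrable (M \<Otimes>\<^sub>M N) (\<lambda>\<omega>. X' (fst \<omega>) * Y (snd \<omega>))"
    using p(1)[OF x(1) one(2)] p(1)[OF x(2) one(2)] p(1)[OF one(1) y(1)] p(1)[OF one(1) y(2)]
      p(1)[OF x(3) one(2)] p(1)[OF one(1) y(3)] p(1)[OF x(1) y(2)] p(1)[OF x(2) y(1)] by simp_all
  have e: "(X (fst \<omega>) + Y (snd \<omega>)) * (X' (fst \<omega>) + Y' (snd \<omega>)) =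
     (X (fst \<omega>) * X' (fst \<omega>) + Y (snd \<omega>) * Y' (snd \<omega>)) + (X (fst \<omega>) * Y' (snd \<omega>) + X' (fst \<omega>) * Y (snd \<omega>))" for \<omega>
    by (simp add: algebra_simps)
  have v: "(\<integral>\<omega>. X (fst \<omega>) \<partial>(M \<Otimes>\<^sub>M N)) = 0" "(\<integral>\<omega>. X' (fst \<omega>) \<partial>(M \<Otimes>\<^sub>M N)) = 0"
    "(\<integral>\<omega>. Y (snd \<omega>) \<partial>(M \<Otimes>\<^sub>M N)) = 0" "(\<integral>\<omega>. Y' (snd \<omega>) \<partial>(M \<Otimes>\<^sub>M N)) = 0"
    "(\<integral>\<omega>. X (fst \<omega>) * X' (fst \<omega>) \<partial>(M \<Otimes>\<^sub>M N)) = c" "(\<integral>\<omega>. Y (snd \<omega>) * Y' (snd \<omega>) \<partial>(M \<Otimes>\<^sub>M N)) = d"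
    "(\<integral>\<omega>. X (fst \<omega>) * Y' (snd \<omega>) \<partial>(M \<Otimes>\<^sub>M N)) = 0" "(\<integral>\<omega>. X' (fst \<omega>) * Y (snd \<omega>) \<partial>(M \<Otimes>\<^sub>M N)) = 0"
    using p(2)[OF x(1) one(2)] p(2)[OF x(2) one(2)] p(2)[OF one(1) y(1)] p(2)[OF one(1) y(2)]
      p(2)[OF x(3) one(2)] p(2)[OF one(1) y(3)] p(2)[OF x(1) y(2)] p(2)[OF x(2) y(1)] X Y
    by (simp_all add: centered_pair_def M.prob_space N.prob_space)
  show ?thesis
    unfolding centered_pair_def e using i v by (simp add: Bochner_Integration.integral_add Bochner_Integration.integrable_add)
qed

lemma (in product_prob_space) coordinate_integral:
  fixes X :: "'a \<Rightarrow> real"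
  assumes "finite I" "i \<in> I" and X: "integrable (M i) X"
  shows "integrable (PiM I M) (\<lambda>z. X (z i))" "(\<integral>z. X (z i) \<partial>PiM I M) = (\<integral>x. X x \<partial>M i)"
proof -
  define F where "F k = (if k = i then X else (\<lambda>_. 1))" for k
  have F: "integrable (M k) (F k)" for k using X by (auto simp: F_def)
  have P: "(\<Prod>k\<in>I. F k (z k)) = X (z i)" for z
    using assms(1,2) by (simp add: F_def prod.remove[of I i])
  have Q: "(\<Prod>k\<in>I. integral\<^sup>L (M k) (F k)) = (\<integral>x. X x \<partial>M i)"
    using assms(1,2) by (simp add: F_def prod.remove[of I i] M.prob_space)
  from product_integrable_prod[OF assms(1) F] product_integral_prod[OF assms(1) F]
  show "integrable (PiM I M) (\<lambda>z. X (z i))" "(\<integral>z. X (z i) \<partial>PiM I M) = (\<integral>x. X x \<partial>M i)"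
    by (simp_all only: P Q)
qed

lemma (in product_prob_space) coordinate_pair_integral:
  fixes X Y :: "'a \<Rightarrow> real"
  assumes "finite I" "i \<in> I" "j \<in> I" "i \<noteq> j" and X: "integrable (M i) X" and Y: "integrable (M j) Y"
  shows "integrable (PiM I M) (\<lambda>z. X (z i) * Y (z j))"
    "(\<integral>z. X (z i) * Y (z j) \<partial>PiM I M) = (\<integral>x. X x \<partial>M i) * (\<integral>x. Y x \<partial>M j)"
proof -
  define F where "F k = (if k = i then X else if k = j then Y else (\<lambda>_. 1))" for k
  have F: "integrable (M k) (F k)" for k using X Y by (auto simp: F_def)
  have P: "(\<Prod>k\<in>I. F k (z k)) = X (z i) * Y (z j)" for z
    using assms(1-4) by (simp add: F_def prod.remove[of I i] prod.remove[of "I - {i}" j])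
  have Q: "(\<Prod>k\<in>I. integral\<^sup>L (M k) (F k)) = (\<integral>x. X x \<partial>M i) * (\<integral>x. Y x \<partial>M j)"
    using assms(1-4) by (simp add: F_def prod.remove[of I i] prod.remove[of "I - {i}" j] M.prob_space)
  from product_integrable_prod[OF assms(1) F] product_integral_prod[OF assms(1) F]
  show "integrable (PiM I M) (\<lambda>z. X (z i) * Y (z j))"
    "(\<integral>z. X (z i) * Y (z j) \<partial>PiM I M) = (\<integral>x. X x \<partial>M i) * (\<integral>x. Y x \<partial>M j)"
    by (simp_all only: P Q)
qed

lemma (in product_prob_space) centered_pair_PiM:
  assumes I: "finite I" and c: "\<And>i. i \<in> I \<Longrightarrow> centered_pair (M i) (X i) (Y i) (c i)"
  shows "centered_pair (PiM I M) (\<lambda>z. \<Sum>i\<in>I. X i (z i)) (\<lambda>z. \<Sum>i\<in>I. Y i (z i)) (\<Sum>i\<in>I. c i)"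
proof -
  have XY: "integrable (PiM I M) (\<lambda>z. X i (z i) * Y j (z j))"
    "(\<integral>z. X i (z i) * Y j (z j) \<partial>PiM I M) = (if i = j then c i else 0)" if "i \<in> I" "j \<in> I" for i j
    using c[OF that(1)] c[OF that(2)] coordinate_pair_integral[OF I that, of "X i" "Y j"]
      coordinate_integral[OF I that(1), of "\<lambda>x. X i x * Y i x"]
    by (cases "i = j"; simp add: centered_pair_def)+
  have "(\<integral>z. (\<Sum>i\<in>I. X i (z i)) * (\<Sum>j\<in>I. Y j (z j)) \<partial>PiM I M) = (\<Sum>i\<in>I. \<Sum>j\<in>I. if i = j then c i else 0)"
    by (simp add: sum_product Bochner_Integration.integral_sum Bochner_Integration.integrable_sum XY)
  also have "\<dots> = (\<Sum>i\<in>I. c i)" using I by simp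
  finally show ?thesis
    unfolding centered_pair_def
    using c coordinate_integral[OF I]
    by (simp add: centered_pair_def sum_product Bochner_Integration.integral_sum Bochner_Integration.integrable_sum XY)
qed

text \<open>
  The translation part of \<open>cameron_martin\<close>, with an arbitrary density, in the form that is stable under products.
\<close>

section \<open>Quasi-invariance of products\<close>

definition quasi_invariant :: "'a measure \<Rightarrow> ('a \<Rightarrow> 'a) \<Rightarrow> ('a \<Rightarrow> ennreal) \<Rightarrow> bool" where
  "quasi_invariant M S d \<longleftrightarrow> S \<in> measurable M M \<and> d \<in> borel_measurable M \<and>
     (\<forall>F. F \<in> borel_measurable M \<longrightarrow> (\<integral>\<^sup>+\<omega>. F (S \<omega>) \<partial>M) = (\<integral>\<^sup>+\<omega>. F \<omega> * d \<omega> \<partial>M))"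

lemma quasi_invariantD:
  assumes "quasi_invariant M S d"
  shows "S \<in> measurable M M" "d \<in> borel_measurable M"
    "F \<in> borel_measurable M \<Longrightarrow> (\<integral>\<^sup>+\<omega>. F (S \<omega>) \<partial>M) = (\<integral>\<^sup>+\<omega>. F \<omega> * d \<omega> \<partial>M)"
  using assms by (auto simp: quasi_invariant_def)

text \<open>
  Both factors are translated in turn under the iterated integral.
\<close>

lemma quasi_invariant_pair:
  assumes "sigma_finite_measure M" "sigma_finite_measure N"
    and S: "quasi_invariant M S d" and S': "quasi_invariant N S' d'"
  shows "quasi_invariant (M \<Otimes>\<^sub>M N) (\<lambda>\<omega>. (S (fst \<omega>), S' (snd \<omega>))) (\<lambda>\<omega>. d (fst \<omega>) * d' (snd \<omega>))"
  unfolding quasi_invariant_def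
proof (intro conjI allI impI)
  interpret M: sigma_finite_measure M by fact
  interpret N: sigma_finite_measure N by fact
  interpret pair_sigma_finite M N ..
  note [measurable] = quasi_invariantD(1,2)[OF S] quasi_invariantD(1,2)[OF S']
  show "(\<lambda>\<omega>. (S (fst \<omega>), S' (snd \<omega>))) \<in> measurable (M \<Otimes>\<^sub>M N) (M \<Otimes>\<^sub>M N)" by measurable
  show "(\<lambda>\<omega>. d (fst \<omega>) * d' (snd \<omega>)) \<in> borel_measurable (M \<Otimes>\<^sub>M N)" by measurable
  fix F :: "_ \<Rightarrow> ennreal" assume F[measurable]: "F \<in> borel_measurable (M \<Otimes>\<^sub>M N)"
  have "(\<integral>\<^sup>+\<omega>. F (S (fst \<omega>), S' (snd \<omega>)) \<partial>(M \<Otimes>\<^sub>M N)) = (\<integral>\<^sup>+x. \<integral>\<^sup>+y. F (S x, S' y) \<partial>N \<partial>M)"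
    by (subst N.nn_integral_fst[symmetric]) auto
  also have "\<dots> = (\<integral>\<^sup>+x. \<integral>\<^sup>+y. F (S x, y) * d' y \<partial>N \<partial>M)"
  proof (rule nn_integral_cong)
    fix x assume x: "x \<in> space M"
    have "(\<lambda>y. F (S x, y)) \<in> borel_measurable N"
      using measurable_space[OF quasi_invariantD(1)[OF S] x] by measurable
    from quasi_invariantD(3)[OF S' this]
    show "(\<integral>\<^sup>+y. F (S x, S' y) \<partial>N) = (\<integral>\<^sup>+y. F (S x, y) * d' y \<partial>N)" .
  qed
  also have "\<dots> = (\<integral>\<^sup>+x. (\<integral>\<^sup>+y. F (x, y) * d' y \<partial>N) * d x \<partial>M)"
    by (rule quasi_invariantD(3)[OF S]) measurable
  also have "\<dots> = (\<integral>\<^sup>+x. \<integral>\<^sup>+y. F (x, y) * (d x * d' y) \<partial>N \<partial>M)"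
  proof (rule nn_integral_cong)
    fix x assume "x \<in> space M"
    then have "(\<lambda>y. F (x, y) * d' y) \<in> borel_measurable N" by measurable
    from nn_integral_multc[OF this, of "d x"]
    show "(\<integral>\<^sup>+y. F (x, y) * d' y \<partial>N) * d x = (\<integral>\<^sup>+y. F (x, y) * (d x * d' y) \<partial>N)"
      by (simp add: ac_simps)
  qed
  also have "\<dots> = (\<integral>\<^sup>+\<omega>. F \<omega> * (d (fst \<omega>) * d' (snd \<omega>)) \<partial>(M \<Otimes>\<^sub>M N))"
    by (subst N.nn_integral_fst[symmetric]) auto
  finally show "(\<integral>\<^sup>+\<omega>. F (S (fst \<omega>), S' (snd \<omega>)) \<partial>(M \<Otimes>\<^sub>M N)) = (\<integral>\<^sup>+\<omega>. F \<omega> * (d (fst \<omega>) * d' (snd \<omega>)) \<partial>(M \<Otimes>\<^sub>M N))" .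
qed

lemma (in product_prob_space) quasi_invariant_PiM:
  assumes "finite J" and S: "\<And>i. i \<in> J \<Longrightarrow> quasi_invariant (M i) (S i) (d i)"
  shows "quasi_invariant (PiM J M) (\<lambda>z. \<lambda>i\<in>J. S i (z i)) (\<lambda>z. \<Prod>i\<in>J. d i (z i))"
  using assms
proof (induction J)
  case empty
  have "(\<lambda>z. \<lambda>i\<in>{}. S i (z i)) = (\<lambda>_ _. undefined)" by (auto simp: fun_eq_iff)
  then show ?case
    by (auto simp: quasi_invariant_def PiM_empty nn_integral_count_space_finite intro!: measurable_PiM_single')
next
  case (insert k J)
  note IH = insert.IH[OF insert.prems[OF insertI2]]
  note [measurable] = quasi_invariantD(1,2)[OF insert.prems]
  note Sk = insert.prems[OF insertI1]
  let ?S = "\<lambda>J z. \<lambda>i\<in>J. S i (z i)" and ?d = "\<lambda>J z. \<Prod>i\<in>J. d i (z i)"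
  have mS: "?S (insert k J) \<in> measurable (PiM (insert k J) M) (PiM (insert k J) M)"
    by (intro measurable_restrict measurable_compose[OF measurable_component_singleton] quasi_invariantD(1)[OF insert.prems]) auto
  have md[measurable]: "?d (insert k J) \<in> borel_measurable (PiM (insert k J) M)"
    by (intro borel_measurable_prod_ennreal measurable_compose[OF measurable_component_singleton] quasi_invariantD(2)[OF insert.prems]) auto
  show ?case
    unfolding quasi_invariant_def
  proof (intro conjI allI impI mS md)
    fix F :: "('i \<Rightarrow> 'a) \<Rightarrow> ennreal" assume F[measurable]: "F \<in> borel_measurable (PiM (insert k J) M)"
    have upd: "(\<lambda>y. F (z(k := y))) \<in> borel_measurable (M k)" if "z \<in> space (PiM J M)" for z
      using that by measurable
    have sz: "?S J z \<in> space (PiM J M)" if "z \<in> space (PiM J M)" for z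
      by (rule measurable_space[OF quasi_invariantD(1)[OF IH] that])
    have "(\<integral>\<^sup>+z. F (?S (insert k J) z) \<partial>PiM (insert k J) M)
        = (\<integral>\<^sup>+z. \<integral>\<^sup>+y. F (?S (insert k J) (z(k := y))) \<partial>M k \<partial>PiM J M)"
      by (rule product_nn_integral_insert[OF insert.hyps]) (rule measurable_compose[OF mS F])
    also have "\<dots> = (\<integral>\<^sup>+z. \<integral>\<^sup>+y. F ((?S J z)(k := S k y)) \<partial>M k \<partial>PiM J M)"
    proof -
      have "?S (insert k J) (z(k := y)) = (?S J z)(k := S k y)" for z y
        using insert.hyps by (auto simp: fun_eq_iff)
      then show ?thesis by simp
    qed
    also have "\<dots> = (\<integral>\<^sup>+z. \<integral>\<^sup>+y. F ((?S J z)(k := y)) * d k y \<partial>M k \<partial>PiM J M)"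
      by (intro nn_integral_cong quasi_invariantD(3)[OF Sk, of "\<lambda>y. F ((?S J _)(k := y))"] upd sz)
    also have "\<dots> = (\<integral>\<^sup>+z. (\<integral>\<^sup>+y. F (z(k := y)) * d k y \<partial>M k) * ?d J z \<partial>PiM J M)"
    proof (rule quasi_invariantD(3)[OF IH, of "\<lambda>z. \<integral>\<^sup>+y. F (z(k := y)) * d k y \<partial>M k"])
      interpret sigma_finite_measure "M k" by (rule sigma_finite_measures)
      note [measurable] = quasi_invariantD(2)[OF Sk]
      show "(\<lambda>z. \<integral>\<^sup>+y. F (z(k := y)) * d k y \<partial>M k) \<in> borel_measurable (PiM J M)"
        by measurable
    qed
    also have "\<dots> = (\<integral>\<^sup>+z. \<integral>\<^sup>+y. F (z(k := y)) * ?d (insert k J) (z(k := y)) \<partial>M k \<partial>PiM J M)"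
    proof (rule nn_integral_cong)
      fix z assume z: "z \<in> space (PiM J M)"
      have "?d (insert k J) (z(k := y)) = d k y * ?d J z" for y
        using insert.hyps by (simp, intro arg_cong[where f = "\<lambda>x. d k y * x"] prod.cong) auto
      moreover have "(\<lambda>y. F (z(k := y)) * d k y) \<in> borel_measurable (M k)"
        by (intro borel_measurable_times_ennreal upd z quasi_invariantD(2)[OF Sk])
      ultimately show "(\<integral>\<^sup>+y. F (z(k := y)) * d k y \<partial>M k) * ?d J z = (\<integral>\<^sup>+y. F (z(k := y)) * ?d (insert k J) (z(k := y)) \<partial>M k)"
        by (simp only: nn_integral_multc[symmetric] mult.assoc)
    qed
    also have "\<dots> = (\<integral>\<^sup>+z. F z * ?d (insert k J) z \<partial>PiM (insert k J) M)"
      by (rule product_nn_integral_insert[OF insert.hyps, symmetric]) measurable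
    finally show "(\<integral>\<^sup>+z. F (?S (insert k J) z) \<partial>PiM (insert k J) M) = (\<integral>\<^sup>+z. F z * ?d (insert k J) z \<partial>PiM (insert k J) M)" .
  qed
qed


section \<open>The noise of the stacked system\<close>

text \<open>
  The block covariances of the initial state, the disturbances and the measurement noise.
\<close>

type_synonym ('n, 'p) covs = "(real^'n^'n) \<times> (nat \<Rightarrow> real^'n^'n) \<times> (nat \<Rightarrow> real^'p^'p)"

definition noise_space :: "nat \<Rightarrow> ('n::finite, 'p::finite) noise measure" where
  "noise_space T = borel \<Otimes>\<^sub>M (PiM {..<T} (\<lambda>_. borel) \<Otimes>\<^sub>M PiM {..<T} (\<lambda>_. borel))"

text \<open>
  The coefficients of a linear statistic of the noise are themselves arranged like a noise realization.
\<close>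

definition lin :: "nat \<Rightarrow> ('n::finite, 'p::finite) noise \<Rightarrow> ('n, 'p) noise \<Rightarrow> real" where
  "lin T a \<omega> = fst a \<bullet> fst \<omega> +
     ((\<Sum>t<T. fst (snd a) t \<bullet> fst (snd \<omega>) t) + (\<Sum>t<T. snd (snd a) t \<bullet> snd (snd \<omega>) t))"

text \<open>
  The covariance of the statistics \<open>lin T a\<close> and \<open>lin T b\<close> under independent centered blocks.
\<close>

definition cov_form :: "nat \<Rightarrow> ('n::finite, 'p::finite) covs \<Rightarrow> ('n, 'p) noise \<Rightarrow> ('n, 'p) noise \<Rightarrow> real" where
  "cov_form T \<sigma> a b = fst a \<bullet> (fst \<sigma> *v fst b) +
     ((\<Sum>t<T. fst (snd a) t \<bullet> (fst (snd \<sigma>) t *v fst (snd b) t)) +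
      (\<Sum>t<T. snd (snd a) t \<bullet> (snd (snd \<sigma>) t *v snd (snd b) t)))"

definition second_moments :: "nat \<Rightarrow> ('n::finite, 'p::finite) noise measure \<Rightarrow> ('n, 'p) covs \<Rightarrow> bool" where
  "second_moments T P \<sigma> \<longleftrightarrow> prob_space P \<and> sets P = sets (noise_space T) \<and>
     (\<forall>a b. integrable P (\<lambda>\<omega>. lin T a \<omega> * lin T b \<omega>) \<and> (\<integral>\<omega>. lin T a \<omega> * lin T b \<omega> \<partial>P) = cov_form T \<sigma> a b)"

definition pd_blocks :: "('n::finite, 'p::finite) covs \<Rightarrow> bool" where
  "pd_blocks \<sigma> \<longleftrightarrow> pd (fst \<sigma>) \<and> (\<forall>t. pd (fst (snd \<sigma>) t)) \<and> (\<forall>t. pd (snd (snd \<sigma>) t))"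

definition gauss_noise :: "nat \<Rightarrow> ('n::finite, 'p::finite) covs \<Rightarrow> ('n, 'p) noise measure" where
  "gauss_noise T \<sigma> = gaussian 0 (fst \<sigma>) \<Otimes>\<^sub>M
     (PiM {..<T} (\<lambda>t. gaussian 0 (fst (snd \<sigma>) t)) \<Otimes>\<^sub>M PiM {..<T} (\<lambda>t. gaussian 0 (snd (snd \<sigma>) t)))"

text \<open>
  Translation in the direction whose Cameron--Martin density is an exponential of \<open>lin T a\<close>. The coordinates
  beyond the horizon are reset to the default value of \<open>PiM\<close>, so that the image stays in the product space.
\<close>

definition noise_shift :: "nat \<Rightarrow> ('n::finite, 'p::finite) covs \<Rightarrow> ('n, 'p) noise \<Rightarrow> real \<Rightarrow> ('n, 'p) noise \<Rightarrow> ('n, 'p) noise" where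
  "noise_shift T \<sigma> a s \<omega> = (fst \<omega> + s *\<^sub>R (fst \<sigma> *v fst a),
     (\<lambda>t\<in>{..<T}. fst (snd \<omega>) t + s *\<^sub>R (fst (snd \<sigma>) t *v fst (snd a) t)),
     (\<lambda>t\<in>{..<T}. snd (snd \<omega>) t + s *\<^sub>R (snd (snd \<sigma>) t *v snd (snd a) t)))"

lemma lin_measurable[measurable]: "lin T a \<in> borel_measurable (noise_space T)"
  unfolding lin_def[abs_def] noise_space_def by measurable

lemma lin_noise_shift: "lin T b (noise_shift T \<sigma> a s \<omega>) = lin T b \<omega> + s * cov_form T \<sigma> b a"
  by (simp add: lin_def noise_shift_def cov_form_def inner_add_right sum.distrib sum_distrib_left distrib_left)

lemma centered_second_moment_pair:
  "centered_second_moment P S \<Longrightarrow> centered_pair P (\<lambda>x. a \<bullet> x) (\<lambda>x. b \<bullet> x) (a \<bullet> (S *v b))"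
  by (simp add: centered_second_moment_def centered_pair_def)

lemma centered_second_moment_return: "centered_second_moment (return borel 0) (0 :: real^'n^'n)"
proof -
  interpret prob_space "return borel (0 :: real^'n)" by (rule prob_space_return) simp
  show ?thesis
    by (auto simp: centered_second_moment_def prob_space_axioms integral_return
        intro!: finite_measure.integrable_const_bound)
       (auto intro!: integrable_const_bound[where B = 0] simp: AE_return)
qed

lemma centered_second_moments_PiM:
  fixes P :: "nat \<Rightarrow> (real^'n) measure"
  assumes "\<And>t. t < T \<Longrightarrow> centered_second_moment (P t) (S t)"
  shows "prob_space (PiM {..<T} P)" "sets (PiM {..<T} P) = sets (PiM {..<T} (\<lambda>_. borel))"
    "centered_pair (PiM {..<T} P) (\<lambda>z. \<Sum>t<T. a t \<bullet> z t) (\<lambda>z. \<Sum>t<T. b t \<bullet> z t) (\<Sum>t<T. a t \<bullet> (S t *v b t))"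
proof -
  define M where "M t = (if t < T then P t else return borel 0)" for t
  have eq: "PiM {..<T} P = PiM {..<T} M" by (rule PiM_cong) (auto simp: M_def)
  have M: "centered_second_moment (M t) (if t < T then S t else 0)" for t
    using assms by (simp add: M_def centered_second_moment_return)
  then have ps: "prob_space (M t)" and st: "sets (M t) = sets borel" for t
    by (auto simp: centered_second_moment_def)
  interpret product_prob_space M "{..<T}"
    by (intro product_prob_spaceI ps)
  show "prob_space (PiM {..<T} P)" unfolding eq by (rule prob_space_PiM) (rule ps)
  show "sets (PiM {..<T} P) = sets (PiM {..<T} (\<lambda>_. borel))"
    unfolding eq by (rule sets_PiM_cong) (auto simp: st)
  have "centered_pair (PiM {..<T} M) (\<lambda>z. \<Sum>t<T. a t \<bullet> z t) (\<lambda>z. \<Sum>t<T. b t \<bullet> z t) (\<Sum>t<T. a t \<bullet> ((if t < T then S t else 0) *v b t))"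
    by (intro centered_pair_PiM centered_second_moment_pair M) simp
  then show "centered_pair (PiM {..<T} P) (\<lambda>z. \<Sum>t<T. a t \<bullet> z t) (\<lambda>z. \<Sum>t<T. b t \<bullet> z t) (\<Sum>t<T. a t \<bullet> (S t *v b t))"
    unfolding eq by simp
qed

lemma second_moments_product:
  fixes Px :: "(real^'n) measure" and Pv :: "nat \<Rightarrow> (real^'p) measure"
  assumes x: "centered_second_moment Px S" and w: "\<And>t. t < T \<Longrightarrow> centered_second_moment (Pw t) (Sw t)"
    and v: "\<And>t. t < T \<Longrightarrow> centered_second_moment (Pv t) (Sv t)"
  shows "second_moments T (Px \<Otimes>\<^sub>M (PiM {..<T} Pw \<Otimes>\<^sub>M PiM {..<T} Pv)) (S, Sw, Sv)"
proof -
  note W = centered_second_moments_PiM[OF w] and V = centered_second_moments_PiM[OF v]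
  have X: "prob_space Px" "sets Px = sets borel" using x by (auto simp: centered_second_moment_def)
  interpret X: prob_space Px by (rule X)
  interpret W: prob_space "PiM {..<T} Pw" by (rule W(1))
  interpret V: prob_space "PiM {..<T} Pv" by (rule V(1))
  interpret WV: pair_prob_space "PiM {..<T} Pw" "PiM {..<T} Pv" ..
  interpret XWV: pair_prob_space Px "PiM {..<T} Pw \<Otimes>\<^sub>M PiM {..<T} Pv" ..
  have s: "sets (Px \<Otimes>\<^sub>M (PiM {..<T} Pw \<Otimes>\<^sub>M PiM {..<T} Pv)) = sets (noise_space T :: ('n, 'p) noise measure)"
    unfolding noise_space_def by (intro sets_pair_measure_cong X W V)
  have "centered_pair (Px \<Otimes>\<^sub>M (PiM {..<T} Pw \<Otimes>\<^sub>M PiM {..<T} Pv)) (lin T a) (lin T b) (cov_form T (S, Sw, Sv) a b)" for a b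
    unfolding lin_def[abs_def] cov_form_def fst_conv snd_conv
    by (intro centered_pair_product[where X = "\<lambda>x. fst a \<bullet> x" and X' = "\<lambda>x. fst b \<bullet> x"
          and Y = "\<lambda>\<eta>. (\<Sum>t<T. fst (snd a) t \<bullet> fst \<eta> t) + (\<Sum>t<T. snd (snd a) t \<bullet> snd \<eta> t)"
          and Y' = "\<lambda>\<eta>. (\<Sum>t<T. fst (snd b) t \<bullet> fst \<eta> t) + (\<Sum>t<T. snd (snd b) t \<bullet> snd \<eta> t)"]
        centered_pair_product[where X = "\<lambda>x. (\<Sum>t<T. fst (snd a) t \<bullet> x t)" and X' = "\<lambda>x. (\<Sum>t<T. fst (snd b) t \<bullet> x t)"
          and Y = "\<lambda>x. (\<Sum>t<T. snd (snd a) t \<bullet> x t)" and Y' = "\<lambda>x. (\<Sum>t<T. snd (snd b) t \<bullet> x t)"]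
        centered_second_moment_pair x W V X WV.prob_space_axioms)
  then show ?thesis
    unfolding second_moments_def using s XWV.prob_space_axioms by (auto simp: centered_pair_def)
qed

lemma second_moments_gauss_noise:
  assumes "pd_blocks \<sigma>" shows "second_moments T (gauss_noise T \<sigma>) \<sigma>"
proof -
  have "second_moments T (gauss_noise T \<sigma>) (fst \<sigma>, fst (snd \<sigma>), snd (snd \<sigma>))"
    unfolding gauss_noise_def using assms
    by (intro second_moments_product centered_second_moment_gaussian) (auto simp: pd_blocks_def)
  then show ?thesis by simp
qed

lemma quasi_invariant_gaussian:
  fixes S :: "real^'n^'n"
  assumes "pd S"
  shows "quasi_invariant (gaussian 0 S) (\<lambda>x. x + s *\<^sub>R (S *v a)) (\<lambda>x. ennreal (exp (s * (a \<bullet> x) - s\<^sup>2 * (a \<bullet> (S *v a)) / 2)))"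
  unfolding quasi_invariant_def
proof (intro conjI)
  show "\<forall>F. F \<in> borel_measurable (gaussian 0 S) \<longrightarrow> (\<integral>\<^sup>+x. F (x + s *\<^sub>R (S *v a)) \<partial>gaussian 0 S)
     = (\<integral>\<^sup>+x. F x * ennreal (exp (s * (a \<bullet> x) - s\<^sup>2 * (a \<bullet> (S *v a)) / 2)) \<partial>gaussian 0 S)"
    using cameron_martin_gaussian[OF assms, of a] unfolding cameron_martin_def by blast
qed measurable

text \<open>
  The densities of the blocks multiply to the exponential of the sum of their exponents.
\<close>

lemma cameron_martin_gauss_noise:
  fixes \<sigma> :: "('n::finite, 'p::finite) covs"
  assumes pd: "pd_blocks \<sigma>"
  shows "cameron_martin (gauss_noise T \<sigma>) (noise_shift T \<sigma> a) (lin T a) (cov_form T \<sigma> a a)"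
proof -
  note sm = second_moments_gauss_noise[OF pd, of T]
  have m: "lin T a \<in> borel_measurable (gauss_noise T \<sigma>)"
    using lin_measurable[of T a] sm by (simp add: second_moments_def cong: measurable_cong_sets)
  have pds: "pd (fst \<sigma>)" "\<And>t. pd (fst (snd \<sigma>) t)" "\<And>t. pd (snd (snd \<sigma>) t)"
    using pd by (auto simp: pd_blocks_def)
  interpret W: product_prob_space "\<lambda>t. gaussian 0 (fst (snd \<sigma>) t)" "{..<T}"
    by (intro product_prob_spaceI prob_space_gaussian pds)
  interpret V: product_prob_space "\<lambda>t. gaussian 0 (snd (snd \<sigma>) t)" "{..<T}"
    by (intro product_prob_spaceI prob_space_gaussian pds)
  have WW: "prob_space (PiM {..<T} (\<lambda>t. gaussian 0 (fst (snd \<sigma>) t)))"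
    and VV: "prob_space (PiM {..<T} (\<lambda>t. gaussian 0 (snd (snd \<sigma>) t)))"
    by (intro prob_space_PiM prob_space_gaussian pds)+
  then have WV: "prob_space (PiM {..<T} (\<lambda>t. gaussian 0 (fst (snd \<sigma>) t)) \<Otimes>\<^sub>M PiM {..<T} (\<lambda>t. gaussian 0 (snd (snd \<sigma>) t)))"
    by (rule prob_space_pair)
  note sf = prob_space_gaussian[OF pds(1), THEN prob_space_imp_sigma_finite] WW[THEN prob_space_imp_sigma_finite]
    VV[THEN prob_space_imp_sigma_finite] WV[THEN prob_space_imp_sigma_finite]
  have q: "quasi_invariant (gauss_noise T \<sigma>) (noise_shift T \<sigma> a s)
      (\<lambda>\<omega>. ennreal (exp (s * lin T a \<omega> - s\<^sup>2 * cov_form T \<sigma> a a / 2)))" for s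
  proof -
    let ?e = "\<lambda>S b x. exp (s * (b \<bullet> x) - s\<^sup>2 * (b \<bullet> (S *v b)) / 2)"
    have d: "ennreal (exp (s * lin T a \<omega> - s\<^sup>2 * cov_form T \<sigma> a a / 2)) =
       ennreal (?e (fst \<sigma>) (fst a) (fst \<omega>)) *
       ((\<Prod>t<T. ennreal (?e (fst (snd \<sigma>) t) (fst (snd a) t) (fst (snd \<omega>) t))) *
        (\<Prod>t<T. ennreal (?e (snd (snd \<sigma>) t) (snd (snd a) t) (snd (snd \<omega>) t))))" for \<omega>
      by (simp add: prod_ennreal ennreal_mult'[symmetric] exp_sum[symmetric] mult_exp_exp prod_nonneg)
         (simp add: lin_def cov_form_def sum_subtractf sum_distrib_left sum_divide_distrib algebra_simps add_divide_distrib)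
    have "quasi_invariant (gauss_noise T \<sigma>) (noise_shift T \<sigma> a s)
      (\<lambda>\<omega>. ennreal (?e (fst \<sigma>) (fst a) (fst \<omega>)) *
       ((\<Prod>t<T. ennreal (?e (fst (snd \<sigma>) t) (fst (snd a) t) (fst (snd \<omega>) t))) *
        (\<Prod>t<T. ennreal (?e (snd (snd \<sigma>) t) (snd (snd a) t) (snd (snd \<omega>) t)))))"
      unfolding gauss_noise_def noise_shift_def
      by (intro quasi_invariant_pair[where d = "\<lambda>x. ennreal (?e (fst \<sigma>) (fst a) x)" and S = "\<lambda>x. x + s *\<^sub>R (fst \<sigma> *v fst a)"
            and d' = "\<lambda>\<eta>. (\<Prod>t<T. ennreal (?e (fst (snd \<sigma>) t) (fst (snd a) t) (fst \<eta> t))) *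
               (\<Prod>t<T. ennreal (?e (snd (snd \<sigma>) t) (snd (snd a) t) (snd \<eta> t)))"
            and S' = "\<lambda>\<eta>. ((\<lambda>t\<in>{..<T}. fst \<eta> t + s *\<^sub>R (fst (snd \<sigma>) t *v fst (snd a) t)),
                 (\<lambda>t\<in>{..<T}. snd \<eta> t + s *\<^sub>R (snd (snd \<sigma>) t *v snd (snd a) t)))"]
          quasi_invariant_pair[where d = "\<lambda>z. (\<Prod>t<T. ennreal (?e (fst (snd \<sigma>) t) (fst (snd a) t) (z t)))"
            and d' = "\<lambda>z. (\<Prod>t<T. ennreal (?e (snd (snd \<sigma>) t) (snd (snd a) t) (z t)))"
            and S = "\<lambda>z. (\<lambda>t\<in>{..<T}. z t + s *\<^sub>R (fst (snd \<sigma>) t *v fst (snd a) t))"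
            and S' = "\<lambda>z. (\<lambda>t\<in>{..<T}. z t + s *\<^sub>R (snd (snd \<sigma>) t *v snd (snd a) t))"]
          W.quasi_invariant_PiM[where S = "\<lambda>t x. x + s *\<^sub>R (fst (snd \<sigma>) t *v fst (snd a) t)"]
          V.quasi_invariant_PiM[where S = "\<lambda>t x. x + s *\<^sub>R (snd (snd \<sigma>) t *v snd (snd a) t)"]
          quasi_invariant_gaussian pds finite_lessThan sf)
    then show ?thesis unfolding d .
  qed
  show ?thesis
    unfolding cameron_martin_def
    using quasi_invariantD[OF q] m sm lin_noise_shift[of T a \<sigma> a] by (auto simp: second_moments_def)
qed

section \<open>Linear and quadratic statistics of the noise\<close>

definition noise_linear :: "nat \<Rightarrow> (('n::finite, 'p::finite) noise \<Rightarrow> real) \<Rightarrow> bool" where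
  "noise_linear T f \<longleftrightarrow> (\<exists>a. f = lin T a)"

lemma noise_linear_zero: "noise_linear T (\<lambda>_. 0)"
  unfolding noise_linear_def by (intro exI[of _ "(0, \<lambda>_. 0, \<lambda>_. 0)"]) (auto simp: lin_def)

lemma noise_linear_scale: "noise_linear T f \<Longrightarrow> noise_linear T (\<lambda>\<omega>. c * f \<omega>)"
  unfolding noise_linear_def
  by (elim exE, rule_tac x = "(c *\<^sub>R fst a, \<lambda>t. c *\<^sub>R fst (snd a) t, \<lambda>t. c *\<^sub>R snd (snd a) t)" in exI)
     (auto simp: lin_def fun_eq_iff sum_distrib_left distrib_left)

lemma noise_linear_add: "noise_linear T f \<Longrightarrow> noise_linear T g \<Longrightarrow> noise_linear T (\<lambda>\<omega>. f \<omega> + g \<omega>)"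
  unfolding noise_linear_def
  by (elim exE, rule_tac x = "(fst a + fst aa, \<lambda>t. fst (snd a) t + fst (snd aa) t, \<lambda>t. snd (snd a) t + snd (snd aa) t)" in exI)
     (auto simp: lin_def fun_eq_iff sum.distrib inner_add_left)

lemma noise_linear_sum: "(\<And>i. i \<in> I \<Longrightarrow> noise_linear T (f i)) \<Longrightarrow> noise_linear T (\<lambda>\<omega>. \<Sum>i\<in>I. f i \<omega>)"
  by (induction I rule: infinite_finite_induct) (auto intro: noise_linear_zero noise_linear_add)

lemma noise_linear_state: "noise_linear T (\<lambda>\<omega>. c \<bullet> fst \<omega>)"
  unfolding noise_linear_def by (intro exI[of _ "(c, \<lambda>_. 0, \<lambda>_. 0)"]) (auto simp: lin_def)

lemma noise_linear_process:
  assumes "t < T" shows "noise_linear T (\<lambda>\<omega>. c \<bullet> fst (snd \<omega>) t)"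
  unfolding noise_linear_def using assms
  by (intro exI[of _ "(0, (\<lambda>s. if s = t then c else 0), \<lambda>_. 0)"])
     (auto simp: lin_def fun_eq_iff if_distrib[of "\<lambda>x. x \<bullet> _"] cong: if_cong)

lemma noise_linear_measurement:
  assumes "t < T" shows "noise_linear T (\<lambda>\<omega>. c \<bullet> snd (snd \<omega>) t)"
  unfolding noise_linear_def using assms
  by (intro exI[of _ "(0, \<lambda>_. 0, (\<lambda>s. if s = t then c else 0))"])
     (auto simp: lin_def fun_eq_iff if_distrib[of "\<lambda>x. x \<bullet> _"] cong: if_cong)

text \<open>
  An inductive presentation spares an explicit coefficient matrix over all blocks; the costs below are
  members by construction.
\<close>

inductive noise_quadratic :: "nat \<Rightarrow> (('n::finite, 'p::finite) noise \<Rightarrow> real) \<Rightarrow> bool" for T where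
  zero: "noise_quadratic T (\<lambda>_. 0)"
| product: "noise_linear T f \<Longrightarrow> noise_linear T g \<Longrightarrow> noise_quadratic T (\<lambda>\<omega>. f \<omega> * g \<omega>)"
| add: "noise_quadratic T c \<Longrightarrow> noise_quadratic T d \<Longrightarrow> noise_quadratic T (\<lambda>\<omega>. c \<omega> + d \<omega>)"

lemma noise_quadratic_sum:
  "(\<And>i. i \<in> I \<Longrightarrow> noise_quadratic T (f i)) \<Longrightarrow> noise_quadratic T (\<lambda>\<omega>. \<Sum>i\<in>I. f i \<omega>)"
  by (induction I rule: infinite_finite_induct) (auto intro: noise_quadratic.intros)

definition comb_covs :: "real \<Rightarrow> ('n::finite, 'p::finite) covs \<Rightarrow> real \<Rightarrow> ('n, 'p) covs \<Rightarrow> ('n, 'p) covs" where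
  "comb_covs r \<sigma> s \<tau> = (r *\<^sub>R fst \<sigma> + s *\<^sub>R fst \<tau>, (\<lambda>t. r *\<^sub>R fst (snd \<sigma>) t + s *\<^sub>R fst (snd \<tau>) t),
     (\<lambda>t. r *\<^sub>R snd (snd \<sigma>) t + s *\<^sub>R snd (snd \<tau>) t))"

lemma cov_form_comb: "cov_form T (comb_covs r \<sigma> s \<tau>) a b = r * cov_form T \<sigma> a b + s * cov_form T \<tau> a b"
  by (simp add: cov_form_def comb_covs_def matrix_vector_mult_add_rdistrib scaleR_matrix_vector
      inner_add_right sum.distrib sum_distrib_left algebra_simps)

lemma continuous_on_covs_coordinates:
  "continuous_on UNIV (\<lambda>\<sigma> :: ('n::finite, 'p::finite) covs. fst (snd \<sigma>) t)"
  "continuous_on UNIV (\<lambda>\<sigma> :: ('n::finite, 'p::finite) covs. snd (snd \<sigma>) t)"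
  by (rule continuous_on_product_then_coordinatewise[where f = "\<lambda>\<sigma>. fst (snd \<sigma>)"],
        intro continuous_on_fst continuous_on_snd continuous_on_id)
     (rule continuous_on_product_then_coordinatewise[where f = "\<lambda>\<sigma>. snd (snd \<sigma>)"],
        intro continuous_on_snd continuous_on_id)

lemma continuous_on_quadratic_entry:
  fixes f :: "'a::topological_space \<Rightarrow> real^'n^'n"
  shows "continuous_on S f \<Longrightarrow> continuous_on S (\<lambda>\<sigma>. x \<bullet> (f \<sigma> *v y))"
  unfolding inner_matrix_vector_mult_sum by (intro continuous_intros)

lemma cov_form_continuous: "continuous_on UNIV (\<lambda>\<sigma>. cov_form T \<sigma> a b)"
  unfolding cov_form_def
  by (intro continuous_on_add continuous_on_sum continuous_on_quadratic_entry
      continuous_on_covs_coordinates continuous_on_fst continuous_on_id)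

text \<open>
  The expectation of a quadratic statistic sees the law only through its covariances, linearly and
  continuously. This is what replaces the ambiguity set by a compact convex set of covariances.
\<close>

lemma noise_quadratic_expectation:
  fixes c :: "('n::finite, 'p::finite) noise \<Rightarrow> real"
  assumes "noise_quadratic T c"
  obtains \<Phi> where "\<And>P \<sigma>. second_moments T P \<sigma> \<Longrightarrow> integrable P c" "\<And>P \<sigma>. second_moments T P \<sigma> \<Longrightarrow> (\<integral>\<omega>. c \<omega> \<partial>P) = \<Phi> \<sigma>"
    "\<And>r \<sigma> s \<tau>. \<Phi> (comb_covs r \<sigma> s \<tau>) = r * \<Phi> \<sigma> + s * \<Phi> \<tau>" "continuous_on UNIV \<Phi>"
proof -
  have "\<exists>\<Phi>. (\<forall>P \<sigma>. second_moments T P \<sigma> \<longrightarrow> integrable P c \<and> (\<integral>\<omega>. c \<omega> \<partial>P) = \<Phi> \<sigma>) \<and>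
    (\<forall>r \<sigma> s \<tau>. \<Phi> (comb_covs r \<sigma> s \<tau>) = r * \<Phi> \<sigma> + s * \<Phi> \<tau>) \<and> continuous_on UNIV \<Phi>"
    using assms
  proof induction
    case zero
    then show ?case by (intro exI[of _ "\<lambda>_. 0"]) auto
  next
    case (product f g)
    then obtain a b where fg: "f = lin T a" "g = lin T b" by (auto simp: noise_linear_def)
    have "integrable P (\<lambda>\<omega>. lin T a \<omega> * lin T b \<omega>) \<and> (\<integral>\<omega>. lin T a \<omega> * lin T b \<omega> \<partial>P) = cov_form T \<sigma> a b"
      if "second_moments T P \<sigma>" for P \<sigma>
      using that unfolding second_moments_def by blast
    note v = this
    show ?case unfolding fg
      by (intro exI[of _ "\<lambda>\<sigma>. cov_form T \<sigma> a b"] conjI allI impI cov_form_comb cov_form_continuous)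
         (use v in blast)+
  next
    case (add c d)
    then obtain \<Phi> \<Psi> where
      1: "\<forall>P \<sigma>. second_moments T P \<sigma> \<longrightarrow> integrable P c \<and> (\<integral>\<omega>. c \<omega> \<partial>P) = \<Phi> \<sigma>"
        "\<forall>r \<sigma> s \<tau>. \<Phi> (comb_covs r \<sigma> s \<tau>) = r * \<Phi> \<sigma> + s * \<Phi> \<tau>" "continuous_on UNIV \<Phi>" and
      2: "\<forall>P \<sigma>. second_moments T P \<sigma> \<longrightarrow> integrable P d \<and> (\<integral>\<omega>. d \<omega> \<partial>P) = \<Psi> \<sigma>"
        "\<forall>r \<sigma> s \<tau>. \<Psi> (comb_covs r \<sigma> s \<tau>) = r * \<Psi> \<sigma> + s * \<Psi> \<tau>" "continuous_on UNIV \<Psi>"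
      by (elim exE conjE) (rule that)
    show ?case
      using 1(1,2) 2(1,2) by (intro exI[of _ "\<lambda>\<sigma>. \<Phi> \<sigma> + \<Psi> \<sigma>"] conjI continuous_intros 1(3) 2(3)) (auto simp: algebra_simps)
  qed
  then obtain \<Phi> where
    1: "\<forall>P \<sigma>. second_moments T P \<sigma> \<longrightarrow> integrable P c \<and> (\<integral>\<omega>. c \<omega> \<partial>P) = \<Phi> \<sigma>"
      "\<forall>r \<sigma> s \<tau>. \<Phi> (comb_covs r \<sigma> s \<tau>) = r * \<Phi> \<sigma> + s * \<Phi> \<tau>" "continuous_on UNIV \<Phi>"
    by (elim exE conjE)
  then show ?thesis by (intro that[of \<Phi>]) auto
qed


lemma inner_transpose: "c \<bullet> (M *v x) = (transpose M *v c) \<bullet> x" for M :: "real^'b^'a"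
  by (metis dot_lmul_matrix transpose_matrix_vector)

lemma inner_transpose_left: "(M *v h) \<bullet> y = h \<bullet> (transpose M *v y)" for M :: "real^'b^'a"
  by (metis inner_commute inner_transpose)

definition noise_vector :: "nat \<Rightarrow> (('n::finite, 'p::finite) noise \<Rightarrow> real^'k) \<Rightarrow> bool" where
  "noise_vector T f \<longleftrightarrow> (\<forall>c. noise_linear T (\<lambda>\<omega>. c \<bullet> f \<omega>))"

lemma noise_vector_add: "noise_vector T f \<Longrightarrow> noise_vector T g \<Longrightarrow> noise_vector T (\<lambda>\<omega>. f \<omega> + g \<omega>)"
  by (simp add: noise_vector_def inner_add_right noise_linear_add)

lemma noise_vector_sum: "(\<And>i. i \<in> I \<Longrightarrow> noise_vector T (f i)) \<Longrightarrow> noise_vector T (\<lambda>\<omega>. \<Sum>i\<in>I. f i \<omega>)"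
  by (simp add: noise_vector_def inner_sum_right noise_linear_sum)

lemma noise_vector_matrix: "noise_vector T f \<Longrightarrow> noise_vector T (\<lambda>\<omega>. M *v f \<omega>)" for M :: "real^'b^'a"
  by (simp add: noise_vector_def inner_transpose)

lemma noise_vector_component: "noise_vector T f \<Longrightarrow> noise_linear T (\<lambda>\<omega>. f \<omega> $ i)"
proof -
  assume "noise_vector T f"
  then have "noise_linear T (\<lambda>\<omega>. axis i 1 \<bullet> f \<omega>)" by (simp add: noise_vector_def)
  then show ?thesis by (simp add: inner_axis')
qed

lemma noise_vector_quadratic:
  fixes M :: "real^'b^'a"
  assumes "noise_vector T f" "noise_vector T g"
  shows "noise_quadratic T (\<lambda>\<omega>. f \<omega> \<bullet> (M *v g \<omega>))"
proof -
  have "noise_quadratic T (\<lambda>\<omega>. \<Sum>i\<in>UNIV. \<Sum>j\<in>UNIV. f \<omega> $ i * (M $ i $ j * g \<omega> $ j))"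
    by (intro noise_quadratic_sum noise_quadratic.product noise_linear_scale noise_vector_component assms)
  then show ?thesis by (simp add: inner_matrix_vector_mult_sum ac_simps)
qed

text \<open>
  Solvability of the normal equations of a semidefinite least squares problem with finitely many
  unknowns. The form \<open>B\<close> may be degenerate; the condition on its null vectors says that \<open>b\<close> is in its range.
  The induction adds one unknown \<open>k\<close>. Subtracting from the unit vector of \<open>k\<close> its projection on the previous
  ones gives a direction \<open>d\<close> that is orthogonal to them, along which the equation for \<open>k\<close> can be solved
  without disturbing the others.
\<close>

section \<open>Normal equations and domination\<close>

lemma normal_equations:
  fixes B :: "('i \<Rightarrow> real) \<Rightarrow> ('i \<Rightarrow> real) \<Rightarrow> real" and b :: "('i \<Rightarrow> real) \<Rightarrow> real"
  assumes "finite I"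
    and lin: "\<And>c d f s. B (\<lambda>e. c e + s * d e) f = B c f + s * B d f" and sym: "\<And>c d. B c d = B d c"
    and nonneg: "\<And>c. 0 \<le> B c c"
    and b: "\<And>c d s. b (\<lambda>e. c e + s * d e) = b c + s * b d"
    and null: "\<And>c. B c c = 0 \<Longrightarrow> b c = 0"
  shows "\<exists>\<theta>. \<forall>c. (\<forall>e. e \<notin> I \<longrightarrow> c e = 0) \<longrightarrow> b c + B \<theta> c = 0"
proof -
  have lin': "B f (\<lambda>e. c e + s * d e) = B f c + s * B f d" for c d f s
    using lin sym by metis
  have B0: "B (\<lambda>_. 0) c = 0" for c using lin[of c "-1" c c] by simp
  have "\<forall>b. (\<forall>c d s. b (\<lambda>e. c e + s * d e) = b c + s * b d) \<longrightarrow> (\<forall>c. B c c = 0 \<longrightarrow> b c = 0) \<longrightarrow>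
     (\<exists>\<theta>. (\<forall>e. e \<notin> I \<longrightarrow> \<theta> e = 0) \<and> (\<forall>c. (\<forall>e. e \<notin> I \<longrightarrow> c e = 0) \<longrightarrow> b c + B \<theta> c = 0))"
    using \<open>finite I\<close>
  proof (induction I)
    case empty
    show ?case
    proof (intro allI impI exI[of _ "\<lambda>_. 0"] conjI)
      fix b :: "('i \<Rightarrow> real) \<Rightarrow> real" and c :: "'i \<Rightarrow> real"
      assume n: "\<forall>c. B c c = 0 \<longrightarrow> b c = 0" and "\<forall>e. e \<notin> {} \<longrightarrow> c e = 0"
      then have "c = (\<lambda>_. 0)" by auto
      then show "b c + B (\<lambda>_. 0) c = 0" using n B0 by simp
    qed simp
  next
    case (insert k I)
    show ?case
    proof (intro allI impI)
      fix b :: "('i \<Rightarrow> real) \<Rightarrow> real"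
      assume bl: "\<forall>c d s. b (\<lambda>e. c e + s * d e) = b c + s * b d" and n: "\<forall>c. B c c = 0 \<longrightarrow> b c = 0"
      obtain \<theta> where \<theta>: "\<And>e. e \<notin> I \<Longrightarrow> \<theta> e = 0" "\<And>c. (\<forall>e. e \<notin> I \<longrightarrow> c e = 0) \<Longrightarrow> b c + B \<theta> c = 0"
        using insert.IH[rule_format, of b] bl n by blast
      define ek :: "'i \<Rightarrow> real" where "ek e = (if e = k then 1 else 0)" for e
      have "B ek c = 0" if "B c c = 0" for c
      proof -
        have "0 \<le> B ek ek + 2 * s * B ek c + s\<^sup>2 * B c c" for s
          using nonneg[of "\<lambda>e. ek e + s * c e"] by (simp add: lin lin' sym[of c ek] power2_eq_square algebra_simps)
        from nonneg_quadratic_discriminant[OF this] that show ?thesis by simp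
      qed
      then obtain \<psi> where \<psi>: "\<And>e. e \<notin> I \<Longrightarrow> \<psi> e = 0" "\<And>c. (\<forall>e. e \<notin> I \<longrightarrow> c e = 0) \<Longrightarrow> B ek c + B \<psi> c = 0"
        using insert.IH[rule_format, of "B ek"] lin' by blast
      define d where "d = (\<lambda>e. ek e + 1 * \<psi> e)"
      have dI: "B d c = 0" if "\<forall>e. e \<notin> I \<longrightarrow> c e = 0" for c
        unfolding d_def lin using \<psi>(2)[OF that] by simp
      have dd: "B d d = B d ek" using dI[of \<psi>] \<psi>(1) unfolding lin'[of d ek 1 \<psi>, folded d_def] by simp
      define \<rho> where "\<rho> = b ek + B \<theta> ek"
      have bd: "b d + B \<theta> d = \<rho>"
      proof -
        have "b d = b ek + 1 * b \<psi>" unfolding d_def using bl by blast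
        moreover have "B \<theta> d = B \<theta> ek + 1 * B \<theta> \<psi>" unfolding d_def by (rule lin')
        ultimately show ?thesis using \<theta>(2)[of \<psi>] \<psi>(1) by (simp add: \<rho>_def)
      qed
      \<comment> \<open>If \<open>d\<close> is a null vector, the range condition makes the residual \<open>\<rho>\<close> vanish already.\<close>
      define \<tau> where "\<tau> = (if B d d = 0 then 0 else - \<rho> / B d d)"
      have r0: "\<rho> + \<tau> * B d ek = 0"
      proof (cases "B d d = 0")
        case True
        then have "b d = 0" using n by blast
        moreover have "B \<theta> d = 0" using dI[of \<theta>] \<theta>(1) sym by metis
        ultimately show ?thesis using True bd by (simp add: \<tau>_def)
      next
        case False
        then show ?thesis by (simp add: \<tau>_def dd)
      qed
      show "\<exists>\<theta>. (\<forall>e. e \<notin> insert k I \<longrightarrow> \<theta> e = 0) \<and> (\<forall>c. (\<forall>e. e \<notin> insert k I \<longrightarrow> c e = 0) \<longrightarrow> b c + B \<theta> c = 0)"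
      proof (intro exI[of _ "\<lambda>e. \<theta> e + \<tau> * d e"] conjI allI impI)
        show "\<theta> e + \<tau> * d e = 0" if "e \<notin> insert k I" for e
          using that \<theta>(1) \<psi>(1) by (simp add: d_def ek_def)
        fix c :: "'i \<Rightarrow> real" assume c: "\<forall>e. e \<notin> insert k I \<longrightarrow> c e = 0"
        define c' where "c' = c(k := 0)"
        have c': "\<forall>e. e \<notin> I \<longrightarrow> c' e = 0" using c by (auto simp: c'_def)
        have ce: "c = (\<lambda>e. c' e + c k * ek e)" by (auto simp: c'_def ek_def)
        have "b c + B (\<lambda>e. \<theta> e + \<tau> * d e) c = (b c' + c k * b ek) + (B \<theta> c' + c k * B \<theta> ek) + \<tau> * (B d c' + c k * B d ek)"
          unfolding lin by (subst (1 2 3) ce) (simp only: lin' bl[rule_format])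
        also have "\<dots> = (b c' + B \<theta> c') + \<tau> * B d c' + c k * (\<rho> + \<tau> * B d ek)"
          by (simp add: \<rho>_def algebra_simps)
        also have "\<dots> = 0" using \<theta>(2)[OF c'] dI[OF c'] r0 by simp
        finally show "b c + B (\<lambda>e. \<theta> e + \<tau> * d e) c = 0" .
      qed
    qed
  qed
  from this[rule_format, of b] b null show ?thesis by blast
qed

text \<open>
  The form of \<open>M\<close> dominates the Euclidean norm, with constant the trace of its inverse, and the norm
  dominates the form of \<open>N\<close>.
\<close>

lemma pd_dominates:
  fixes M N :: "real^'n^'n"
  assumes M: "pd M" and N: "transpose N = N"
  obtains c where "0 \<le> c" "\<And>C. c < C \<Longrightarrow> pd (C *\<^sub>R M - N)"
proof -
  let ?Mi = "matrix_inv M"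
  have Mi: "pd ?Mi" by (rule pd_matrix_inv[OF M])
  define tr where "tr = (\<Sum>i\<in>UNIV. axis i 1 \<bullet> (?Mi *v axis i 1))"
  define o1 where "o1 = onorm ((*v) N)"
  have o0: "0 \<le> o1" unfolding o1_def by (rule onorm_pos_le) (simp add: matrix_vector_mul_bounded_linear)
  have tr0: "0 \<le> tr" unfolding tr_def using pd_imp_psd[OF Mi] by (intro sum_nonneg) (auto simp: psd_def)
  have xx: "x \<bullet> x \<le> tr * (x \<bullet> (M *v x))" for x
  proof -
    have "x \<bullet> x = (\<Sum>i\<in>UNIV. (axis i 1 \<bullet> x)\<^sup>2)" by (simp add: inner_axis' power2_eq_square) (simp add: inner_vec_def)
    also have "\<dots> \<le> (\<Sum>i\<in>UNIV. (axis i 1 \<bullet> (?Mi *v axis i 1)) * (x \<bullet> (M *v x)))"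
      using pd_inner_le[OF Mi] matrix_inv_matrix_inv[OF pd_invertible[OF M]] by (intro sum_mono) metis
    finally show ?thesis by (simp add: tr_def sum_distrib_right)
  qed
  have Nx: "x \<bullet> (N *v x) \<le> o1 * (x \<bullet> x)" for x
  proof -
    have "x \<bullet> (N *v x) \<le> norm x * norm (N *v x)" by (rule norm_cauchy_schwarz)
    also have "\<dots> \<le> norm x * (o1 * norm x)" unfolding o1_def
      by (intro mult_left_mono onorm) (simp_all add: matrix_vector_mul_bounded_linear)
    finally show ?thesis by (simp add: power2_norm_eq_inner[symmetric] power2_eq_square ac_simps)
  qed
  have "pd (C *\<^sub>R M - N)" if "o1 * tr < C" for C
    unfolding pd_def
  proof (intro conjI allI impI)
    have "transpose (C *\<^sub>R M - N) = C *\<^sub>R transpose M - transpose N"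
      by (simp add: transpose_def vec_eq_iff)
    then show "transpose (C *\<^sub>R M - N) = C *\<^sub>R M - N" using M N by (simp add: pd_def)
    fix x :: "real^'n" assume "x \<noteq> 0"
    then have p: "0 < x \<bullet> (M *v x)" using M by (simp add: pd_def)
    have "x \<bullet> (N *v x) \<le> o1 * (tr * (x \<bullet> (M *v x)))"
      using Nx[of x] mult_left_mono[OF xx[of x] o0] by linarith
    also have "\<dots> < C * (x \<bullet> (M *v x))" using p that by (simp add: mult.assoc[symmetric])
    finally show "0 < x \<bullet> ((C *\<^sub>R M - N) *v x)"
      by (simp add: matrix_vector_mult_diff_rdistrib scaleR_matrix_vector inner_diff_right)
  qed
  then show ?thesis using that[of "o1 * tr"] o0 tr0 by simp
qed


section \<open>The cost of linear policies\<close>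

locale lqg =
  fixes T :: nat
    and A :: "real^'n^'n" and B :: "real^'m^'n" and C :: "real^'n^'p"
    and Q Q\<^sub>T :: "real^'n^'n" and R :: "real^'m^'m"
  assumes Q: "psd Q" and QT: "psd Q\<^sub>T" and R: "pd R"
begin

definition stage_weight :: "nat \<Rightarrow> real^'n^'n" where
  "stage_weight t = (if t = T then Q\<^sub>T else Q)"

definition cost_form :: "(nat \<Rightarrow> real^'m) \<Rightarrow> (nat \<Rightarrow> real^'n) \<Rightarrow> (nat \<Rightarrow> real^'m) \<Rightarrow> (nat \<Rightarrow> real^'n) \<Rightarrow> real" where
  "cost_form u x u' x' = (\<Sum>t<T. u t \<bullet> (R *v u' t)) + (\<Sum>t<Suc T. x t \<bullet> (stage_weight t *v x' t))"

lemma stage_weight_psd: "psd (stage_weight t)"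
  using Q QT by (simp add: stage_weight_def)

lemma bquad_cost_form:
  "bquad T (Rmat R) u + bquad (Suc T) (Qmat T Q Q\<^sub>T) x = cost_form u x u x"
proof -
  have "bmv T (Rmat R) u t = R *v u t" if "t < T" for t
  proof -
    have "bmv T (Rmat R) u t = (\<Sum>s<T. if s = t then R *v u s else 0)"
      unfolding bmv_def Rmat_def by (intro sum.cong) auto
    then show ?thesis using that by simp
  qed
  moreover have "bmv (Suc T) (Qmat T Q Q\<^sub>T) x t = stage_weight t *v x t" if "t < Suc T" for t
  proof -
    have "bmv (Suc T) (Qmat T Q Q\<^sub>T) x t = (\<Sum>s<Suc T. if s = t then stage_weight t *v x s else 0)"
      unfolding bmv_def Qmat_def stage_weight_def by (intro sum.cong) auto
    then show ?thesis using that by simp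
  qed
  ultimately show ?thesis unfolding cost_form_def bquad_def by (intro arg_cong2[where f = "(+)"] sum.cong) auto
qed

lemma cost_form_cong:
  assumes "\<And>t. t < T \<Longrightarrow> u t = v t" "\<And>t. t < T \<Longrightarrow> u' t = v' t"
    "\<And>t. t \<le> T \<Longrightarrow> x t = y t" "\<And>t. t \<le> T \<Longrightarrow> x' t = y' t"
  shows "cost_form u x u' x' = cost_form v y v' y'"
  unfolding cost_form_def using assms by (intro arg_cong2[where f = "(+)"] sum.cong) auto

lemma cost_form_sym: "cost_form u x u' x' = cost_form u' x' u x"
proof -
  have s: "transpose R = R" "transpose (stage_weight t) = stage_weight t" for t
    using R stage_weight_psd by (auto simp: pd_def psd_def)
  show ?thesis unfolding cost_form_def
    by (intro arg_cong2[where f = "(+)"] sum.cong refl psd_inner_commute s)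
qed

lemma cost_form_nonneg: "0 \<le> cost_form u x u x"
  unfolding cost_form_def using pd_imp_psd[OF R] stage_weight_psd
  by (intro add_nonneg_nonneg sum_nonneg) (auto simp: psd_def)

lemma cost_form_lin:
  "cost_form (\<lambda>t. u t + s *\<^sub>R v t) (\<lambda>t. x t + s *\<^sub>R y t) u' x' = cost_form u x u' x' + s * cost_form v y u' x'"
  by (simp add: cost_form_def inner_add_left sum.distrib sum_distrib_left distrib_left)

lemma cost_form_lin_right:
  "cost_form u' x' (\<lambda>t. u t + s *\<^sub>R v t) (\<lambda>t. x t + s *\<^sub>R y t) = cost_form u' x' u x + s * cost_form u' x' v y"
  by (simp only: cost_form_sym[of u' x'] cost_form_lin)

lemma cost_form_square:
  "cost_form (\<lambda>t. u t + s *\<^sub>R v t) (\<lambda>t. x t + s *\<^sub>R y t) (\<lambda>t. u t + s *\<^sub>R v t) (\<lambda>t. x t + s *\<^sub>R y t)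
     = cost_form u x u x + 2 * s * cost_form v y u x + s\<^sup>2 * cost_form v y v y"
  by (simp only: cost_form_lin cost_form_lin_right cost_form_sym[of u x v y]) (simp add: power2_eq_square algebra_simps)

definition response :: "(nat \<Rightarrow> real^'m) \<Rightarrow> nat \<Rightarrow> real^'n" where
  "response h t = bmv T (Hmat A B) h t"

definition free_state :: "('n, 'p) noise \<Rightarrow> nat \<Rightarrow> real^'n" where
  "free_state \<omega> t = bmv (Suc T) (Gmat A) (wstack \<omega>) t"

definition eta :: "nat \<Rightarrow> ('n, 'p) noise \<Rightarrow> real^'p" where
  "eta t \<omega> = bmv (Suc T) (bmm (Suc T) (Cmat C) (Gmat A)) (wstack \<omega>) t + vstack \<omega> t"

lemma response_lin: "response (\<lambda>t. u t + s *\<^sub>R v t) = (\<lambda>t. response u t + s *\<^sub>R response v t)"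
  by (simp add: response_def fun_eq_iff bmv_def matrix_vector_right_distrib matrix_vector_mult_scaleR sum.distrib scaleR_sum_right)

lemma trajectory_eq: "trajectory T A B u \<omega> t = response u t + free_state \<omega> t"
  by (simp add: trajectory_def response_def free_state_def)

text \<open>
  Gains are indexed by time of use, time of observation and the two matrix coordinates, so that a gain
  is a single real-valued function as required by \<open>normal_equations\<close>.
\<close>

definition policy :: "(nat \<times> nat \<times> 'm \<times> 'p \<Rightarrow> real) \<Rightarrow> ('n, 'p) noise \<Rightarrow> nat \<Rightarrow> real^'m" where
  "policy c \<omega> t = (\<Sum>r\<le>t. (\<chi> i j. c (t, r, i, j)) *v eta r \<omega>)"

definition closed_loop :: "(nat \<times> nat \<times> 'm \<times> 'p \<Rightarrow> real) \<Rightarrow> ('n, 'p) noise \<Rightarrow> nat \<Rightarrow> real^'n" where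
  "closed_loop c \<omega> t = response (policy c \<omega>) t + free_state \<omega> t"

definition run_cost :: "(nat \<times> nat \<times> 'm \<times> 'p \<Rightarrow> real) \<Rightarrow> ('n, 'p) noise \<Rightarrow> real" where
  "run_cost c \<omega> = cost_form (policy c \<omega>) (closed_loop c \<omega>) (policy c \<omega>) (closed_loop c \<omega>)"

definition cross_cost :: "(nat \<times> nat \<times> 'm \<times> 'p \<Rightarrow> real) \<Rightarrow> (nat \<times> nat \<times> 'm \<times> 'p \<Rightarrow> real) \<Rightarrow> ('n, 'p) noise \<Rightarrow> real" where
  "cross_cost d c \<omega> = cost_form (policy d \<omega>) (response (policy d \<omega>)) (policy c \<omega>) (closed_loop c \<omega>)"

text \<open>
  The bilinear form of the quadratic part of the cost as a function of the gain, as \<open>cross_cost d c\<close> is half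
  of the derivative of the cost at \<open>c\<close> in the direction \<open>d\<close>.
\<close>

definition gain_form :: "(nat \<times> nat \<times> 'm \<times> 'p \<Rightarrow> real) \<Rightarrow> (nat \<times> nat \<times> 'm \<times> 'p \<Rightarrow> real) \<Rightarrow> ('n, 'p) noise \<Rightarrow> real" where
  "gain_form d c \<omega> = cost_form (policy d \<omega>) (response (policy d \<omega>)) (policy c \<omega>) (response (policy c \<omega>))"

text \<open>
  Half of the derivative of the cost with respect to the input at time \<open>s\<close>: the direct input cost and,
  through the transposed response, the cost of the induced change of the states.
\<close>

definition gradient :: "(nat \<times> nat \<times> 'm \<times> 'p \<Rightarrow> real) \<Rightarrow> nat \<Rightarrow> ('n, 'p) noise \<Rightarrow> real^'m" where
  "gradient c s \<omega> = R *v policy c \<omega> s +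
     (\<Sum>t<Suc T. transpose (Hmat A B t s) *v (stage_weight t *v closed_loop c \<omega> t))"

lemma policy_lin: "policy (\<lambda>e. c e + s * d e) \<omega> = (\<lambda>t. policy c \<omega> t + s *\<^sub>R policy d \<omega> t)"
proof
  fix t
  have "((\<chi> i j. c (t, r, i, j) + s * d (t, r, i, j)) :: real^'p^'m) = (\<chi> i j. c (t, r, i, j)) + s *\<^sub>R (\<chi> i j. d (t, r, i, j))" for r
    by (simp add: vec_eq_iff)
  then show "policy (\<lambda>e. c e + s * d e) \<omega> t = policy c \<omega> t + s *\<^sub>R policy d \<omega> t"
    by (simp add: policy_def matrix_vector_mult_add_rdistrib scaleR_matrix_vector sum.distrib scaleR_sum_right)
qed

lemma policy_zero: "policy (\<lambda>_. 0) \<omega> t = 0"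
proof -
  have "((\<chi> i j. 0) :: real^'p^'m) = 0" by (simp add: vec_eq_iff)
  then show ?thesis by (simp add: policy_def)
qed

lemma closed_loop_lin: "closed_loop (\<lambda>e. c e + s * d e) \<omega> = (\<lambda>t. closed_loop c \<omega> t + s *\<^sub>R response (policy d \<omega>) t)"
  by (simp add: closed_loop_def fun_eq_iff policy_lin response_lin)

lemma run_cost_expand:
  "run_cost (\<lambda>e. c e + s * d e) \<omega> = run_cost c \<omega> + 2 * s * cross_cost d c \<omega> + s\<^sup>2 * gain_form d d \<omega>"
  unfolding run_cost_def cross_cost_def gain_form_def policy_lin closed_loop_lin by (rule cost_form_square)

lemma cost_form_gradient:
  "cost_form h (response h) (policy c \<omega>) (closed_loop c \<omega>) = (\<Sum>s<T. h s \<bullet> gradient c s \<omega>)"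
proof -
  have "(\<Sum>t<Suc T. response h t \<bullet> (stage_weight t *v closed_loop c \<omega> t)) =
      (\<Sum>t<Suc T. \<Sum>s<T. h s \<bullet> (transpose (Hmat A B t s) *v (stage_weight t *v closed_loop c \<omega> t)))"
    by (simp only: response_def bmv_def inner_sum_left inner_transpose_left)
  also have "\<dots> = (\<Sum>s<T. \<Sum>t<Suc T. h s \<bullet> (transpose (Hmat A B t s) *v (stage_weight t *v closed_loop c \<omega> t)))"
    by (rule sum.swap)
  finally show ?thesis
    by (simp add: cost_form_def gradient_def inner_add_right inner_sum_right sum.distrib)
qed

lemma noise_vector_wstack: "s < Suc T \<Longrightarrow> noise_vector T (\<lambda>\<omega> :: ('n, 'p) noise. wstack \<omega> s)"
  by (cases s) (auto simp: noise_vector_def wstack_def noise_linear_state noise_linear_process)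

lemma noise_vector_free_state: "noise_vector T (\<lambda>\<omega>. free_state \<omega> t)"
  unfolding free_state_def bmv_def by (intro noise_vector_sum noise_vector_matrix noise_vector_wstack) simp

lemma noise_vector_eta: "t < T \<Longrightarrow> noise_vector T (eta t)"
  unfolding eta_def bmv_def
  by (intro noise_vector_add noise_vector_sum noise_vector_matrix noise_vector_wstack)
     (auto simp: noise_vector_def vstack_def noise_linear_measurement)

lemma noise_vector_policy: "t < T \<Longrightarrow> noise_vector T (\<lambda>\<omega>. policy c \<omega> t)"
  unfolding policy_def by (intro noise_vector_sum noise_vector_matrix noise_vector_eta) auto

lemma noise_vector_response: "noise_vector T (\<lambda>\<omega>. response (policy c \<omega>) t)"
  unfolding response_def bmv_def by (intro noise_vector_sum noise_vector_matrix noise_vector_policy) auto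

lemma noise_vector_closed_loop: "noise_vector T (\<lambda>\<omega>. closed_loop c \<omega> t)"
  unfolding closed_loop_def by (intro noise_vector_add noise_vector_response noise_vector_free_state)

lemma noise_vector_gradient: "s < T \<Longrightarrow> noise_vector T (gradient c s)"
  unfolding gradient_def
  by (intro noise_vector_add noise_vector_sum noise_vector_matrix noise_vector_policy noise_vector_closed_loop)

lemma noise_quadratic_cost_form:
  assumes "\<And>t. t < T \<Longrightarrow> noise_vector T (\<lambda>\<omega>. u \<omega> t)" "\<And>t. noise_vector T (\<lambda>\<omega>. x \<omega> t)"
    "\<And>t. t < T \<Longrightarrow> noise_vector T (\<lambda>\<omega>. u' \<omega> t)" "\<And>t. noise_vector T (\<lambda>\<omega>. x' \<omega> t)"
  shows "noise_quadratic T (\<lambda>\<omega> :: ('n, 'p) noise. cost_form (u \<omega>) (x \<omega>) (u' \<omega>) (x' \<omega>))"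
  unfolding cost_form_def
  by (intro noise_quadratic.add noise_quadratic_sum noise_vector_quadratic assms) auto

lemma noise_quadratic_costs:
  "noise_quadratic T (run_cost c)" "noise_quadratic T (cross_cost d c)" "noise_quadratic T (gain_form d c)"
  unfolding run_cost_def cross_cost_def gain_form_def
  by (intro noise_quadratic_cost_form noise_vector_policy noise_vector_closed_loop noise_vector_response; assumption)+

abbreviation "expect \<sigma> f \<equiv> (\<integral>\<omega>. f \<omega> \<partial>gauss_noise T \<sigma>)"

lemma quadratic_integrable:
  "pd_blocks \<sigma> \<Longrightarrow> noise_quadratic T f \<Longrightarrow> integrable (gauss_noise T \<sigma>) f"
  using noise_quadratic_expectation second_moments_gauss_noise by metis

text \<open>
  Only finitely many entries of a gain influence the cost. A gain that costs nothing has vanishing cross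
  cost with the uncontrolled system, by Cauchy--Schwarz, so the normal equations are solvable.
\<close>

lemma normal_gain_exists:
  assumes pd: "pd_blocks \<sigma>"
  shows "\<exists>c. \<forall>d. expect \<sigma> (cross_cost d c) = 0"
proof -
  define I where "I = {(t, r, i :: 'm, j :: 'p). t < T \<and> r < T}"
  have "I = {..<T} \<times> {..<T} \<times> UNIV \<times> UNIV" by (auto simp: I_def)
  then have fin: "finite I" by simp
  note int = quadratic_integrable[OF pd noise_quadratic_costs(1)] quadratic_integrable[OF pd noise_quadratic_costs(2)]
    quadratic_integrable[OF pd noise_quadratic_costs(3)]
  define zero :: "nat \<times> nat \<times> 'm \<times> 'p \<Rightarrow> real" where "zero = (\<lambda>_. 0)"
  have gl: "gain_form (\<lambda>e. c e + s * d e) f \<omega> = gain_form c f \<omega> + s * gain_form d f \<omega>" for c s d f \<omega>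
    unfolding gain_form_def policy_lin response_lin by (rule cost_form_lin)
  have gs: "gain_form c d \<omega> = gain_form d c \<omega>" for c d \<omega> unfolding gain_form_def by (rule cost_form_sym)
  have cl: "cross_cost (\<lambda>e. c e + s * d e) f \<omega> = cross_cost c f \<omega> + s * cross_cost d f \<omega>" for c s d f \<omega>
    unfolding cross_cost_def policy_lin response_lin by (rule cost_form_lin)
  have "\<exists>\<theta>. \<forall>c. (\<forall>e. e \<notin> I \<longrightarrow> c e = 0) \<longrightarrow> expect \<sigma> (cross_cost c zero) + expect \<sigma> (gain_form \<theta> c) = 0"
  proof (rule normal_equations[OF fin])
    show "expect \<sigma> (gain_form (\<lambda>e. c e + s * d e) f) = expect \<sigma> (gain_form c f) + s * expect \<sigma> (gain_form d f)" for c s d f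
      unfolding gl using int by simp
    show "expect \<sigma> (gain_form c d) = expect \<sigma> (gain_form d c)" for c d
      by (rule Bochner_Integration.integral_cong[OF refl gs])
    show "0 \<le> expect \<sigma> (gain_form c c)" for c
      unfolding gain_form_def by (rule Bochner_Integration.integral_nonneg) (rule cost_form_nonneg)
    show "expect \<sigma> (cross_cost (\<lambda>e. c e + s * d e) zero) = expect \<sigma> (cross_cost c zero) + s * expect \<sigma> (cross_cost d zero)" for c s d
      unfolding cl using int by simp
    fix c assume 0: "expect \<sigma> (gain_form c c) = 0"
    have "0 \<le> expect \<sigma> (run_cost zero) + 2 * s * expect \<sigma> (cross_cost c zero) + s\<^sup>2 * expect \<sigma> (gain_form c c)" for s
    proof -
      have "0 \<le> expect \<sigma> (run_cost (\<lambda>e. zero e + s * c e))"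
        unfolding run_cost_def by (rule Bochner_Integration.integral_nonneg) (rule cost_form_nonneg)
      then show ?thesis unfolding run_cost_expand using int by simp
    qed
    from nonneg_quadratic_discriminant[OF this] 0 show "expect \<sigma> (cross_cost c zero) = 0" by simp
  qed
  then obtain \<theta> where \<theta>: "\<And>c. (\<forall>e. e \<notin> I \<longrightarrow> c e = 0) \<Longrightarrow> expect \<sigma> (cross_cost c zero) + expect \<sigma> (gain_form \<theta> c) = 0"
    by blast
  have "expect \<sigma> (cross_cost d \<theta>) = 0" for d
  proof -
    define d' where "d' e = (if e \<in> I then d e else 0)" for e
    have p: "policy d \<omega> t = policy d' \<omega> t" if "t < T" for \<omega> t
      unfolding policy_def d'_def I_def using that by (intro sum.cong) auto
    then have r: "response (policy d \<omega>) t = response (policy d' \<omega>) t" for \<omega> t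
      unfolding response_def bmv_def by (intro sum.cong) auto
    have "cross_cost d \<theta> \<omega> = cross_cost d' zero \<omega> + gain_form \<theta> d' \<omega>" for \<omega>
    proof -
      have z: "policy zero \<omega> = (\<lambda>_. 0)" by (simp add: zero_def fun_eq_iff policy_zero)
      have rz: "response (\<lambda>_. 0) = (\<lambda>_. 0)" by (simp add: response_def bmv_def fun_eq_iff)
      have "cross_cost d \<theta> \<omega> = cross_cost d' \<theta> \<omega>"
        unfolding cross_cost_def by (rule cost_form_cong) (auto simp: p r)
      also have "\<dots> = cost_form (policy d' \<omega>) (response (policy d' \<omega>)) (\<lambda>t. policy zero \<omega> t + 1 *\<^sub>R policy \<theta> \<omega> t)
          (\<lambda>t. closed_loop zero \<omega> t + 1 *\<^sub>R response (policy \<theta> \<omega>) t)"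
        by (simp add: cross_cost_def closed_loop_def[abs_def] z rz add.commute)
      also have "\<dots> = cross_cost d' zero \<omega> + gain_form d' \<theta> \<omega>"
        unfolding cost_form_lin_right cross_cost_def gain_form_def by simp
      finally show ?thesis by (simp add: gs[of d'])
    qed
    then have "expect \<sigma> (cross_cost d \<theta>) = expect \<sigma> (cross_cost d' zero) + expect \<sigma> (gain_form \<theta> d')"
      using int by simp
    then show ?thesis using \<theta>[of d'] by (simp add: d'_def)
  qed
  then show ?thesis by blast
qed

end


section \<open>The saddle point over gains and covariances\<close>

lemma pd_mat_1: "pd (mat 1 :: real^'k^'k)"
  by (simp add: pd_def)

lemma second_moments_cong:
  assumes "second_moments T P \<sigma>" "fst \<sigma> = fst \<tau>"
    "\<And>t. t < T \<Longrightarrow> fst (snd \<sigma>) t = fst (snd \<tau>) t" "\<And>t. t < T \<Longrightarrow> snd (snd \<sigma>) t = snd (snd \<tau>) t"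
  shows "second_moments T P \<tau>"
proof -
  have "cov_form T \<sigma> a b = cov_form T \<tau> a b" for a b
    unfolding cov_form_def using assms(2-4) by simp
  then show ?thesis using assms(1) by (simp add: second_moments_def)
qed

text \<open>
  For large \<open>C\<close> the blockwise difference of \<open>C\<close> times \<open>\<sigma>\<close> and \<open>\<tau>\<close> is positive definite, hence the covariance of a
  Gaussian, under which a nonnegative statistic has nonnegative expectation; linearity in the covariances
  does the rest.
\<close>

lemma noise_quadratic_dominated:
  fixes \<sigma> \<tau> :: "('n::finite, 'p::finite) covs"
  assumes \<sigma>: "pd_blocks \<sigma>" and \<tau>: "pd_blocks \<tau>"
  obtains C where "0 \<le> C" "\<And>f :: ('n, 'p) noise \<Rightarrow> real. noise_quadratic T f \<Longrightarrow> (\<And>\<omega>. 0 \<le> f \<omega>) \<Longrightarrow>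
    (\<integral>\<omega>. f \<omega> \<partial>gauss_noise T \<tau>) \<le> C * (\<integral>\<omega>. f \<omega> \<partial>gauss_noise T \<sigma>)"
proof -
  have ex: "\<exists>c. 0 \<le> c \<and> (\<forall>C. c < C \<longrightarrow> pd (C *\<^sub>R M - N))" if "pd M" "pd N" for M N :: "real^'k^'k"
  proof -
    have "transpose N = N" using that(2) by (simp add: pd_def)
    from pd_dominates[OF that(1) this] show ?thesis by metis
  qed
  have b: "pd (fst \<sigma>)" "pd (fst \<tau>)" "\<And>t. pd (fst (snd \<sigma>) t)" "\<And>t. pd (fst (snd \<tau>) t)"
    "\<And>t. pd (snd (snd \<sigma>) t)" "\<And>t. pd (snd (snd \<tau>) t)"
    using \<sigma> \<tau> by (auto simp: pd_blocks_def)
  obtain c0 where c0: "0 \<le> c0" "\<And>C. c0 < C \<Longrightarrow> pd (C *\<^sub>R fst \<sigma> - fst \<tau>)" using ex[OF b(1,2)] by blast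
  have "\<forall>t. \<exists>c. 0 \<le> c \<and> (\<forall>C. c < C \<longrightarrow> pd (C *\<^sub>R fst (snd \<sigma>) t - fst (snd \<tau>) t))"
    by (rule allI) (rule ex[OF b(3) b(4)])
  from choice[OF this] obtain cw where "\<forall>t. 0 \<le> cw t \<and> (\<forall>C. cw t < C \<longrightarrow> pd (C *\<^sub>R fst (snd \<sigma>) t - fst (snd \<tau>) t))" ..
  then have cw: "\<And>t. 0 \<le> cw t" "\<And>t C. cw t < C \<Longrightarrow> pd (C *\<^sub>R fst (snd \<sigma>) t - fst (snd \<tau>) t)"
    by simp_all
  have "\<forall>t. \<exists>c. 0 \<le> c \<and> (\<forall>C. c < C \<longrightarrow> pd (C *\<^sub>R snd (snd \<sigma>) t - snd (snd \<tau>) t))"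
    by (rule allI) (rule ex[OF b(5) b(6)])
  from choice[OF this] obtain cv where "\<forall>t. 0 \<le> cv t \<and> (\<forall>C. cv t < C \<longrightarrow> pd (C *\<^sub>R snd (snd \<sigma>) t - snd (snd \<tau>) t))" ..
  then have cv: "\<And>t. 0 \<le> cv t" "\<And>t C. cv t < C \<Longrightarrow> pd (C *\<^sub>R snd (snd \<sigma>) t - snd (snd \<tau>) t)"
    by simp_all
  define C where "C = c0 + (\<Sum>t<T. cw t) + (\<Sum>t<T. cv t) + 1"
  have S: "0 \<le> (\<Sum>t<T. cw t)" "0 \<le> (\<Sum>t<T. cv t)" using cw cv by (auto intro: sum_nonneg)
  have le: "cw t \<le> (\<Sum>t<T. cw t)" "cv t \<le> (\<Sum>t<T. cv t)" if "t < T" for t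
    using cw(1) cv(1) that by (auto intro!: member_le_sum)
  have C: "c0 < C" "\<And>t. t < T \<Longrightarrow> cw t < C" "\<And>t. t < T \<Longrightarrow> cv t < C" "0 \<le> C"
    using S c0(1) le by (auto simp: C_def intro: add_pos_nonneg) (smt (verit) le)+
  \<comment> \<open>Only blocks before the horizon are compared; the identity keeps the others positive definite.\<close>
  define \<delta> :: "('n, 'p) covs" where "\<delta> = (C *\<^sub>R fst \<sigma> - fst \<tau>,
     (\<lambda>t. if t < T then C *\<^sub>R fst (snd \<sigma>) t - fst (snd \<tau>) t else mat 1),
     (\<lambda>t. if t < T then C *\<^sub>R snd (snd \<sigma>) t - snd (snd \<tau>) t else mat 1))"
  have "pd_blocks \<delta>" unfolding pd_blocks_def \<delta>_def using C c0 cw cv by (auto simp: pd_mat_1)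
  from second_moments_gauss_noise[OF this, of T]
  have sm: "second_moments T (gauss_noise T \<delta>) (comb_covs C \<sigma> (-1) \<tau>)"
    by (rule second_moments_cong) (auto simp: \<delta>_def comb_covs_def)
  show ?thesis
  proof (rule that[of C])
    fix f :: "('n, 'p) noise \<Rightarrow> real" assume q: "noise_quadratic T f" and f0: "\<And>\<omega>. 0 \<le> f \<omega>"
    obtain \<Phi> where \<Phi>: "\<And>P \<sigma>. second_moments T P \<sigma> \<Longrightarrow> (\<integral>\<omega>. f \<omega> \<partial>P) = \<Phi> \<sigma>"
      "\<And>r \<sigma> s \<tau>. \<Phi> (comb_covs r \<sigma> s \<tau>) = r * \<Phi> \<sigma> + s * \<Phi> \<tau>"
      using noise_quadratic_expectation[OF q] by metis
    have "0 \<le> (\<integral>\<omega>. f \<omega> \<partial>gauss_noise T \<delta>)" by (rule Bochner_Integration.integral_nonneg) (rule f0)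
    also have "\<dots> = C * \<Phi> \<sigma> + (-1) * \<Phi> \<tau>" using \<Phi> sm by metis
    finally show "(\<integral>\<omega>. f \<omega> \<partial>gauss_noise T \<tau>) \<le> C * (\<integral>\<omega>. f \<omega> \<partial>gauss_noise T \<sigma>)"
      using \<Phi>(1)[OF second_moments_gauss_noise[OF \<sigma>]] \<Phi>(1)[OF second_moments_gauss_noise[OF \<tau>]] by simp
  qed (rule C)
qed

lemma noise_vector_measurable:
  assumes "noise_vector T f" shows "f \<in> borel_measurable (noise_space T)"
proof (subst borel_measurable_euclidean_space, intro ballI)
  fix b
  obtain a where "(\<lambda>\<omega>. b \<bullet> f \<omega>) = lin T a"
    using assms unfolding noise_vector_def noise_linear_def by blast
  then show "(\<lambda>\<omega>. f \<omega> \<bullet> b) \<in> borel_measurable (noise_space T)"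
    using lin_measurable[of T a] by (simp add: inner_commute[of _ b])
qed

text \<open>
  The quantitative core of the saddle point argument. Here \<open>\<phi>\<close> and \<open>\<alpha>\<close> are the costs of a gain under
  two covariances, for the first of which it is optimal, and \<open>q\<close>, \<open>\<beta>\<close>, \<open>\<kappa>\<close> are the quadratic and linear terms of an arbitrary change of the
  gain. The loss \<open>2 * \<beta>\<close> is absorbed, by the inequality of arithmetic and geometric means, into half of the
  gap \<open>\<alpha> - \<phi>\<close> and a multiple of \<open>q\<close> that is outweighed by the term \<open>q\<close> when \<open>e\<close> is small. The bound is uniform
  in the change of the gain.
\<close>

lemma perturbation_bound:
  fixes \<alpha> \<beta> \<kappa> \<phi> q e Cc :: real
  assumes q: "0 \<le> q" and \<kappa>: "0 \<le> \<kappa>" "\<kappa> \<le> Cc * q" and C: "0 \<le> Cc"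
    and \<alpha>: "0 \<le> \<alpha>" and \<delta>: "\<phi> < \<alpha>" and \<beta>: "\<beta>\<^sup>2 \<le> \<alpha> * \<kappa>"
    and e: "e = 1 / (2 * (1 + 2 * \<alpha> * Cc / (\<alpha> - \<phi>)))"
  shows "\<phi> + e * (\<alpha> - \<phi>) / 2 \<le> (1 - e) * (\<phi> + q) + e * (\<alpha> + 2 * \<beta> + \<kappa>)"
proof -
  define d where "d = \<alpha> - \<phi>"
  have d: "0 < d" using \<delta> by (simp add: d_def)
  define k where "k = 2 * \<alpha> * Cc / d"
  have k: "0 \<le> k" using \<alpha> C d by (simp add: k_def)
  have e': "e = 1 / (2 * (1 + k))" by (simp add: e k_def d_def)
  have e0: "0 < e" using k by (simp add: e')
  \<comment> \<open>The choice of \<open>e\<close> leaves half of the term \<open>q\<close> after the absorption.\<close>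
  have ek: "e * (1 + k) = 1 / 2" using k by (simp add: e' field_simps)
  define m where "m = d / 2 + 2 * \<alpha> * \<kappa> / d"
  have m0: "0 \<le> m" using d \<alpha> \<kappa> by (simp add: m_def)
  have "(2 * \<beta>)\<^sup>2 \<le> m\<^sup>2"
  proof -
    have "(2 * \<beta>)\<^sup>2 \<le> 4 * (\<alpha> * \<kappa>)" using \<beta> by (simp add: power2_eq_square)
    also have "\<dots> = 2 * (d / 2) * (2 * \<alpha> * \<kappa> / d) + 2 * (d / 2) * (2 * \<alpha> * \<kappa> / d)" using d by simp
    also have "\<dots> \<le> m\<^sup>2"
      using sum_squares_bound[of "d / 2" "2 * \<alpha> * \<kappa> / d"] unfolding m_def power2_sum by linarith
    finally show ?thesis .
  qed
  then have "\<bar>2 * \<beta>\<bar> \<le> m" using m0 by (metis abs_le_square_iff abs_of_nonneg)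
  then have b: "- m \<le> 2 * \<beta>" by linarith
  have "2 * \<alpha> * \<kappa> / d \<le> k * q"
  proof -
    have "2 * \<alpha> * \<kappa> / d \<le> 2 * \<alpha> * (Cc * q) / d" using \<kappa> \<alpha> d by (intro divide_right_mono mult_left_mono) auto
    then show ?thesis by (simp add: k_def)
  qed
  moreover have "\<alpha> = \<phi> + d" by (simp add: d_def)
  ultimately have "\<alpha> + 2 * \<beta> + \<kappa> \<ge> \<phi> + d / 2 - k * q"
    using b \<kappa>(1) unfolding m_def by linarith
  then have "e * (\<alpha> + 2 * \<beta> + \<kappa>) \<ge> e * (\<phi> + d / 2 - k * q)" using e0 by (intro mult_left_mono) auto
  moreover have "(1 - e) * (\<phi> + q) + e * (\<phi> + d / 2 - k * q) = \<phi> + e * d / 2 + q * (1 - e * (1 + k))"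
    by (simp add: algebra_simps)
  moreover have "0 \<le> q * (1 - e * (1 + k))" using q ek by simp
  ultimately show ?thesis unfolding d_def by linarith
qed

context lqg
begin

text \<open>
  The maximizer \<open>\<sigma>\<close> of the optimal value is the limit of a maximizing sequence: for each fixed gain the cost
  is continuous in the covariances, so the value is upper semicontinuous. If \<open>c\<close>, optimal at \<open>\<sigma>\<close>, were costlier
  at \<open>\<tau>\<close>, then by \<open>perturbation_bound\<close> the optimal value at a mixture close to \<open>\<sigma>\<close> would exceed the maximum.
\<close>

lemma saddle_point:
  fixes S :: "('n, 'p) covs set"
  assumes comp: "compact S" and ne: "S \<noteq> {}" and pd: "\<And>\<sigma>. \<sigma> \<in> S \<Longrightarrow> pd_blocks \<sigma>"
    and conv: "\<And>\<sigma> \<tau> e. \<sigma> \<in> S \<Longrightarrow> \<tau> \<in> S \<Longrightarrow> 0 \<le> e \<Longrightarrow> e \<le> 1 \<Longrightarrow> comb_covs (1 - e) \<sigma> e \<tau> \<in> S"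
  shows "\<exists>\<sigma>\<in>S. \<exists>c. (\<forall>d. expect \<sigma> (cross_cost d c) = 0) \<and> (\<forall>\<tau>\<in>S. expect \<tau> (run_cost c) \<le> expect \<sigma> (run_cost c))"
proof -
  have "\<forall>c. \<exists>\<Phi>. (\<forall>P \<sigma>. second_moments T P \<sigma> \<longrightarrow> (\<integral>\<omega>. run_cost c \<omega> \<partial>P) = \<Phi> \<sigma>) \<and>
     (\<forall>r \<sigma> s \<tau>. \<Phi> (comb_covs r \<sigma> s \<tau>) = r * \<Phi> \<sigma> + s * \<Phi> \<tau>) \<and> continuous_on UNIV \<Phi>"
  proof
    fix c
    obtain \<Phi> where "\<And>P \<sigma>. second_moments T P \<sigma> \<Longrightarrow> (\<integral>\<omega>. run_cost c \<omega> \<partial>P) = \<Phi> \<sigma>"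
      "\<And>r \<sigma> s \<tau>. \<Phi> (comb_covs r \<sigma> s \<tau>) = r * \<Phi> \<sigma> + s * \<Phi> \<tau>" "continuous_on UNIV \<Phi>"
      using noise_quadratic_expectation[OF noise_quadratic_costs(1)] by metis
    then show "\<exists>\<Phi>. (\<forall>P \<sigma>. second_moments T P \<sigma> \<longrightarrow> (\<integral>\<omega>. run_cost c \<omega> \<partial>P) = \<Phi> \<sigma>) \<and>
     (\<forall>r \<sigma> s \<tau>. \<Phi> (comb_covs r \<sigma> s \<tau>) = r * \<Phi> \<sigma> + s * \<Phi> \<tau>) \<and> continuous_on UNIV \<Phi>"
      by blast
  qed
  from choice[OF this] obtain \<Phi> where
    "\<forall>c. (\<forall>P \<sigma>. second_moments T P \<sigma> \<longrightarrow> (\<integral>\<omega>. run_cost c \<omega> \<partial>P) = \<Phi> c \<sigma>) \<and>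
     (\<forall>r \<sigma> s \<tau>. \<Phi> c (comb_covs r \<sigma> s \<tau>) = r * \<Phi> c \<sigma> + s * \<Phi> c \<tau>) \<and> continuous_on UNIV (\<Phi> c)" by blast
  then have \<Phi>: "\<And>c \<sigma>. \<sigma> \<in> S \<Longrightarrow> expect \<sigma> (run_cost c) = \<Phi> c \<sigma>"
    and \<Phi>_lin: "\<And>c r \<sigma> s \<tau>. \<Phi> c (comb_covs r \<sigma> s \<tau>) = r * \<Phi> c \<sigma> + s * \<Phi> c \<tau>"
    and \<Phi>_cont: "\<And>c. continuous_on UNIV (\<Phi> c)"
    using second_moments_gauss_noise[OF pd] by blast+
  have \<Phi>0: "0 \<le> \<Phi> c \<sigma>" if "\<sigma> \<in> S" for c \<sigma>
    unfolding \<Phi>[OF that, symmetric] run_cost_def by (rule Bochner_Integration.integral_nonneg) (rule cost_form_nonneg)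
  define v where "v \<sigma> = (INF c. \<Phi> c \<sigma>)" for \<sigma>
  have v_le: "v \<sigma> \<le> \<Phi> c \<sigma>" if "\<sigma> \<in> S" for c \<sigma>
    unfolding v_def by (rule cINF_lower) (auto intro!: bdd_belowI2[of _ 0] \<Phi>0 that)
  have "continuous_on S (\<Phi> (\<lambda>_. 0))" using \<Phi>_cont continuous_on_subset by blast
  from continuous_attains_sup[OF comp ne this] obtain M0 where "\<And>\<sigma>. \<sigma> \<in> S \<Longrightarrow> \<Phi> (\<lambda>_. 0) \<sigma> \<le> M0" by blast
  then have "v \<sigma> \<le> M0" if "\<sigma> \<in> S" for \<sigma> using v_le[OF that] that order.trans by blast
  then have bdd: "bdd_above (v ` S)" by (auto intro!: bdd_aboveI2)
  define M where "M = (SUP \<sigma>\<in>S. v \<sigma>)"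
  have "\<exists>\<sigma>\<in>S. M - 1 / real (Suc n) < v \<sigma>" for n
  proof -
    have "M - 1 / real (Suc n) < M" by simp
    then show ?thesis unfolding M_def using less_cSUP_iff[OF ne bdd] by blast
  qed
  then obtain s where s: "\<And>n. s n \<in> S" "\<And>n. M - 1 / real (Suc n) < v (s n)" by metis
  from compact_imp_seq_compact[OF comp] s(1) obtain \<sigma> r where
    \<sigma>: "\<sigma> \<in> S" and r: "strict_mono r" and lim: "(s \<circ> r) \<longlonglongrightarrow> \<sigma>"
    unfolding seq_compact_def by blast
  \<comment> \<open>For every gain, the lower bounds along the maximizing sequence pass to the limit.\<close>
  have M\<sigma>: "M \<le> \<Phi> c \<sigma>" for c
  proof (rule LIMSEQ_le)
    have "isCont (\<Phi> c) \<sigma>" using \<Phi>_cont[of c] continuous_on_eq_continuous_at[OF open_UNIV] by blast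
    from isCont_tendsto_compose[OF this lim] show "(\<lambda>n. \<Phi> c ((s \<circ> r) n)) \<longlonglongrightarrow> \<Phi> c \<sigma>" .
    have "((\<lambda>n. 1 / real (Suc n)) \<circ> r) \<longlonglongrightarrow> 0"
      by (rule LIMSEQ_subseq_LIMSEQ[OF LIMSEQ_Suc[OF lim_1_over_n] r])
    then have "(\<lambda>n. M - ((\<lambda>n. 1 / real (Suc n)) \<circ> r) n) \<longlonglongrightarrow> M - 0" by (intro tendsto_diff tendsto_const)
    then show "(\<lambda>n. M - 1 / real (Suc (r n))) \<longlonglongrightarrow> M" by simp
    have "M - 1 / real (Suc (r n)) \<le> \<Phi> c ((s \<circ> r) n)" for n
      using s(2)[of "r n"] v_le[OF s(1), of "r n" c] by simp
    then show "\<exists>N. \<forall>n\<ge>N. M - 1 / real (Suc (r n)) \<le> \<Phi> c ((s \<circ> r) n)" by blast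
  qed
  obtain c where c: "\<And>d. expect \<sigma> (cross_cost d c) = 0"
    using normal_gain_exists[OF pd[OF \<sigma>]] by blast
  have vM: "v \<tau> \<le> M" if "\<tau> \<in> S" for \<tau>
    unfolding M_def by (rule cSUP_upper[OF that bdd])
  have "\<Phi> c \<tau> \<le> \<Phi> c \<sigma>" if \<tau>: "\<tau> \<in> S" for \<tau>
  proof (rule ccontr)
    assume "\<not> \<Phi> c \<tau> \<le> \<Phi> c \<sigma>"
    then have gt: "\<Phi> c \<sigma> < \<Phi> c \<tau>" by simp
    obtain K where K: "0 \<le> K" "\<And>f :: ('n, 'p) noise \<Rightarrow> real. noise_quadratic T f \<Longrightarrow> (\<And>\<omega>. 0 \<le> f \<omega>) \<Longrightarrow> expect \<tau> f \<le> K * expect \<sigma> f"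
      using noise_quadratic_dominated[OF pd[OF \<sigma>] pd[OF \<tau>]] by blast
    define e where "e = 1 / (2 * (1 + 2 * \<Phi> c \<tau> * K / (\<Phi> c \<tau> - \<Phi> c \<sigma>)))"
    have k0: "0 \<le> 2 * \<Phi> c \<tau> * K / (\<Phi> c \<tau> - \<Phi> c \<sigma>)" using \<Phi>0[OF \<tau>] K(1) gt by simp
    have "0 < 1 / (2 * (1 + k)) \<and> 1 / (2 * (1 + k)) \<le> 1" if "0 \<le> k" for k :: real
      using that by (auto simp: divide_simps)
    from this[OF k0] have e: "0 < e" "e \<le> 1" unfolding e_def by blast+
    have mixS: "comb_covs (1 - e) \<sigma> e \<tau> \<in> S" using conv[OF \<sigma> \<tau>] e by simp
    have ex: "expect \<rho> (run_cost (\<lambda>i. c i + s * d i)) = expect \<rho> (run_cost c) + 2 * s * expect \<rho> (cross_cost d c) + s\<^sup>2 * expect \<rho> (gain_form d d)"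
      if "\<rho> \<in> S" for \<rho> s d
    proof -
      note int = quadratic_integrable[OF pd[OF that] noise_quadratic_costs(1)] quadratic_integrable[OF pd[OF that] noise_quadratic_costs(2)]
        quadratic_integrable[OF pd[OF that] noise_quadratic_costs(3)]
      show ?thesis unfolding run_cost_expand using int by simp
    qed
    have gf: "0 \<le> gain_form d d \<omega>" for d \<omega> unfolding gain_form_def by (rule cost_form_nonneg)
    have "\<Phi> c \<sigma> + e * (\<Phi> c \<tau> - \<Phi> c \<sigma>) / 2 \<le> \<Phi> c' (comb_covs (1 - e) \<sigma> e \<tau>)" for c'
    proof -
      define d where "d i = c' i - c i" for i
      have c': "c' = (\<lambda>i. c i + 1 * d i)" by (simp add: d_def fun_eq_iff)
      have 1: "\<Phi> c' \<sigma> = \<Phi> c \<sigma> + expect \<sigma> (gain_form d d)"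
        using ex[OF \<sigma>, of 1 d] c[of d] unfolding c'[symmetric] by (simp add: \<Phi>[OF \<sigma>])
      have 2: "\<Phi> c' \<tau> = \<Phi> c \<tau> + 2 * expect \<tau> (cross_cost d c) + expect \<tau> (gain_form d d)"
        using ex[OF \<tau>, of 1 d] unfolding c'[symmetric] by (simp add: \<Phi>[OF \<tau>])
      have "0 \<le> \<Phi> c \<tau> + 2 * s * expect \<tau> (cross_cost d c) + s\<^sup>2 * expect \<tau> (gain_form d d)" for s
        using \<Phi>0[OF \<tau>, of "\<lambda>i. c i + s * d i"] ex[OF \<tau>, of s d] by (simp add: \<Phi>[OF \<tau>])
      from nonneg_quadratic_discriminant[OF this]
      have D: "(expect \<tau> (cross_cost d c))\<^sup>2 \<le> \<Phi> c \<tau> * expect \<tau> (gain_form d d)" .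
      show ?thesis
        unfolding \<Phi>_lin 1 2
        by (rule perturbation_bound[OF _ _ K(2) K(1) \<Phi>0[OF \<tau>] gt D e_def])
           (auto intro: Bochner_Integration.integral_nonneg gf noise_quadratic_costs)
    qed
    then have "\<Phi> c \<sigma> + e * (\<Phi> c \<tau> - \<Phi> c \<sigma>) / 2 \<le> v (comb_covs (1 - e) \<sigma> e \<tau>)"
      unfolding v_def by (intro cINF_greatest) auto
    also have "\<dots> \<le> \<Phi> c \<sigma>" using vM[OF mixS] M\<sigma>[of c] by simp
    finally show False using mult_pos_pos[OF e(1), of "\<Phi> c \<tau> - \<Phi> c \<sigma>"] gt by simp
  qed
  then show ?thesis using \<sigma> c \<Phi> by (intro bexI[OF _ \<sigma>] exI[of _ c]) auto
qed

section \<open>Optimality among all causal policies\<close>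

lemma restrict_purified:
  assumes "t < T" shows "restrict (purified T A B C u \<omega>) {..t} = restrict (\<lambda>s. eta s \<omega>) {..t}"
  using assms by (auto simp: restrict_def fun_eq_iff purified_eq eta_def)

text \<open>
  The normal equation in the direction of the gain with a single nonzero entry.
\<close>

lemma gradient_orthogonal:
  assumes c: "\<And>d. expect \<sigma> (cross_cost d c) = 0" and "t < T" "r \<le> t"
  shows "expect \<sigma> (\<lambda>\<omega>. eta r \<omega> $ j * gradient c t \<omega> $ i) = 0"
proof -
  define d :: "nat \<times> nat \<times> 'm \<times> 'p \<Rightarrow> real" where "d e = (if e = (t, r, i, j) then 1 else 0)" for e
  have p: "policy d \<omega> s = (if s = t then eta r \<omega> $ j *\<^sub>R axis i 1 else 0)" for \<omega> s
  proof (rule vec_eq_iff[THEN iffD2], rule allI)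
    fix i'
    have "policy d \<omega> s $ i' = (\<Sum>r'\<le>s. \<Sum>j'\<in>UNIV. d (s, r', i', j') * eta r' \<omega> $ j')"
      by (simp add: policy_def matrix_vector_mult_def)
    also have "\<dots> = (\<Sum>r'\<le>s. if r' = r then (if s = t \<and> i' = i then eta r \<omega> $ j else 0) else 0)"
    proof (rule sum.cong[OF refl])
      fix r'
      have "(\<Sum>j'\<in>UNIV. d (s, r', i', j') * eta r' \<omega> $ j') = (\<Sum>j'\<in>UNIV. if j' = j then (if r' = r \<and> s = t \<and> i' = i then eta r \<omega> $ j else 0) else 0)"
        by (rule sum.cong[OF refl]) (auto simp: d_def)
      then show "(\<Sum>j'\<in>UNIV. d (s, r', i', j') * eta r' \<omega> $ j') = (if r' = r then (if s = t \<and> i' = i then eta r \<omega> $ j else 0) else 0)"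
        by simp
    qed
    also have "\<dots> = (if s = t then eta r \<omega> $ j *\<^sub>R axis i 1 else 0) $ i'"
      using assms(3) by (simp add: axis_def)
    finally show "policy d \<omega> s $ i' = (if s = t then eta r \<omega> $ j *\<^sub>R axis i 1 else 0) $ i'" .
  qed
  have "cross_cost d c \<omega> = eta r \<omega> $ j * gradient c t \<omega> $ i" for \<omega>
  proof -
    have "cross_cost d c \<omega> = (\<Sum>s<T. if s = t then eta r \<omega> $ j * gradient c t \<omega> $ i else 0)"
      unfolding cross_cost_def cost_form_gradient
      by (rule sum.cong[OF refl]) (auto simp: p inner_axis')
    then show ?thesis using assms(2) by simp
  qed
  then show ?thesis using c[of d] by simp
qed

text \<open>
  A policy of infinite cost is no competitor. Otherwise \<open>R\<close> being definite makes its inputs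
  square integrable, so the deviation \<open>h\<close> from the linear policy is a square-integrable function of the
  purified observations. The cost exceeds that of the linear policy by at least twice the pairing of
  \<open>h\<close> with the gradient, which has mean \<open>0\<close> by \<open>cameron_martin_orthogonal\<close>.
\<close>

lemma gaussian_optimal:
  assumes pd: "pd_blocks \<sigma>" and c: "\<And>d. expect \<sigma> (cross_cost d c) = 0"
    and feas: "(x', u') \<in> feasible T A B C"
  shows "ennreal (expect \<sigma> (run_cost c)) \<le> expected_cost T Q Q\<^sub>T R x' u' (gauss_noise T \<sigma>)"
proof -
  let ?G = "gauss_noise T \<sigma>"
  note sm = second_moments_gauss_noise[OF pd, of T]
  have sG: "sets ?G = sets (noise_space T)" using sm by (simp add: second_moments_def)
  have mG: "borel_measurable ?G = (borel_measurable (noise_space T) :: (('n, 'p) noise \<Rightarrow> 'z::topological_space) set)"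
    by (rule measurable_cong_sets[OF sG refl])
  obtain \<pi> where \<pi>: "\<And>t. t < T \<Longrightarrow> \<pi> t \<in> borel_measurable (PiM {..t} (\<lambda>_. borel))"
    and u': "\<And>t \<omega>. t < T \<Longrightarrow> u' \<omega> t = \<pi> t (restrict (purified T A B C (u' \<omega>) \<omega>) {..t})"
    and x': "\<And>t \<omega>. t \<le> T \<Longrightarrow> x' \<omega> t = trajectory T A B (u' \<omega>) \<omega> t"
    using feas unfolding feasible_def admissible_def by blast
  have u'': "u' \<omega> t = \<pi> t (restrict (\<lambda>s. eta s \<omega>) {..t})" if "t < T" for t \<omega>
    by (subst u'[OF that]) (simp only: restrict_purified[OF that])
  have um: "(\<lambda>\<omega>. u' \<omega> t) \<in> borel_measurable ?G" if t: "t < T" for t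
  proof -
    have "(\<lambda>\<omega>. restrict (\<lambda>s. eta s \<omega>) {..t}) \<in> measurable ?G (PiM {..t} (\<lambda>_. borel))"
      unfolding measurable_cong_sets[OF sG refl] using t
      by (intro measurable_restrict noise_vector_measurable noise_vector_eta) auto
    from measurable_compose[OF this \<pi>[OF t]] show ?thesis by (simp add: u''[OF t])
  qed
  define cost where "cost \<omega> = cost_form (u' \<omega>) (x' \<omega>) (u' \<omega>) (x' \<omega>)" for \<omega>
  define h where "h \<omega> t = u' \<omega> t - policy c \<omega> t" for \<omega> t
  have ec: "expected_cost T Q Q\<^sub>T R x' u' ?G = (\<integral>\<^sup>+\<omega>. ennreal (cost \<omega>) \<partial>?G)"
    by (simp add: expected_cost_def bquad_cost_form cost_def)
  have xm: "(\<lambda>\<omega>. x' \<omega> t) \<in> borel_measurable ?G" if "t \<le> T" for t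
  proof -
    have "(\<lambda>\<omega>. response (u' \<omega>) t + free_state \<omega> t) \<in> borel_measurable ?G"
      unfolding response_def bmv_def
      by (intro borel_measurable_add borel_measurable_sum measurable_compose[OF _ borel_measurable_matrix_vector_mult] um)
         (auto simp: mG intro: noise_vector_measurable noise_vector_free_state)
    then show ?thesis by (simp add: x'[OF that] trajectory_eq)
  qed
  have cm[measurable]: "cost \<in> borel_measurable ?G"
    unfolding cost_def[abs_def] cost_form_def
    by (intro borel_measurable_add borel_measurable_sum borel_measurable_inner
        measurable_compose[OF _ borel_measurable_matrix_vector_mult] um xm) auto
  have c0: "0 \<le> cost \<omega>" for \<omega> unfolding cost_def by (rule cost_form_nonneg)
  show ?thesis
  proof (cases "(\<integral>\<^sup>+\<omega>. ennreal (cost \<omega>) \<partial>?G) = \<infinity>")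
    case True then show ?thesis by (simp add: ec)
  next
    case False
    then have ic: "integrable ?G cost"
      using c0 by (intro integrableI_nonneg) (auto simp: less_top)
    have lower: "run_cost c \<omega> + 2 * (\<Sum>s<T. h \<omega> s \<bullet> gradient c s \<omega>) \<le> cost \<omega>" for \<omega>
    proof -
      have u: "u' \<omega> = (\<lambda>t. policy c \<omega> t + 1 *\<^sub>R h \<omega> t)" by (simp add: h_def fun_eq_iff)
      have "cost \<omega> = cost_form (\<lambda>t. policy c \<omega> t + 1 *\<^sub>R h \<omega> t) (\<lambda>t. closed_loop c \<omega> t + 1 *\<^sub>R response (h \<omega>) t)
          (\<lambda>t. policy c \<omega> t + 1 *\<^sub>R h \<omega> t) (\<lambda>t. closed_loop c \<omega> t + 1 *\<^sub>R response (h \<omega>) t)"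
      proof -
        have "x' \<omega> t = closed_loop c \<omega> t + 1 *\<^sub>R response (h \<omega>) t" if "t \<le> T" for t
          unfolding x'[OF that] trajectory_eq u response_lin closed_loop_def by simp
        then show ?thesis unfolding cost_def by (intro cost_form_cong) (simp_all add: u)
      qed
      also have "\<dots> = run_cost c \<omega> + 2 * (\<Sum>s<T. h \<omega> s \<bullet> gradient c s \<omega>) + cost_form (h \<omega>) (response (h \<omega>)) (h \<omega>) (response (h \<omega>))"
        unfolding cost_form_square cost_form_gradient run_cost_def by simp
      finally show ?thesis using cost_form_nonneg[of "h \<omega>" "response (h \<omega>)"] by simp
    qed
    have orth: "integrable ?G (\<lambda>\<omega>. h \<omega> t $ i * gradient c t \<omega> $ i)" "expect \<sigma> (\<lambda>\<omega>. h \<omega> t $ i * gradient c t \<omega> $ i) = 0"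
      if t: "t < T" for t i
    proof -
      obtain a where a: "(\<lambda>\<omega>. gradient c t \<omega> $ i) = lin T a"
        using noise_vector_component[OF noise_vector_gradient[OF t]] unfolding noise_linear_def by blast
      note cmart = cameron_martin_gauss_noise[OF pd, of T a]
      \<comment> \<open>The shift in the direction of the gradient does not move the observations available at \<open>t\<close>.\<close>
      have inv: "eta r (noise_shift T \<sigma> a s \<omega>) = eta r \<omega>" if r: "r \<le> t" for r s \<omega>
      proof (rule vec_eq_iff[THEN iffD2], rule allI)
        fix j
        obtain b where b: "(\<lambda>\<omega>. eta r \<omega> $ j) = lin T b"
          using noise_vector_component[OF noise_vector_eta, of r j] r t unfolding noise_linear_def by auto
        have "cov_form T \<sigma> b a = expect \<sigma> (\<lambda>\<omega>. lin T b \<omega> * lin T a \<omega>)"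
          by (rule sym) (use sm in \<open>unfold second_moments_def, blast\<close>)
        also have "\<dots> = 0"
          using gradient_orthogonal[of \<sigma> c t r j i, OF c t r] fun_cong[OF a] fun_cong[OF b] by simp
        finally show "eta r (noise_shift T \<sigma> a s \<omega>) $ j = eta r \<omega> $ j"
          using fun_cong[OF b] by (simp add: lin_noise_shift)
      qed
      let ?F = "\<lambda>\<omega>. h \<omega> t $ i"
      have pm: "(\<lambda>\<omega>. policy c \<omega> t) \<in> borel_measurable ?G"
        unfolding mG by (intro noise_vector_measurable noise_vector_policy t)
      have ci: "(\<lambda>x. x $ i) \<in> borel_measurable (borel :: (real^'m) measure)"
        by (intro borel_measurable_continuous_onI continuous_intros)
      have Fm: "?F \<in> borel_measurable ?G"
        unfolding h_def by (intro measurable_compose[OF borel_measurable_diff[OF um[OF t] pm] ci])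
      have "integrable ?G (\<lambda>\<omega>. 2 * ((axis i 1 \<bullet> (matrix_inv R *v axis i 1)) * cost \<omega>) + 2 * (policy c \<omega> t $ i * policy c \<omega> t $ i))"
        using quadratic_integrable[OF pd noise_quadratic.product[OF noise_vector_component noise_vector_component], OF noise_vector_policy noise_vector_policy, OF t t] ic
        by (intro Bochner_Integration.integrable_add integrable_mult_right)
      then have sq: "integrable ?G (\<lambda>\<omega>. (?F \<omega>)\<^sup>2)"
      proof (rule Bochner_Integration.integrable_bound)
        show "(\<lambda>\<omega>. (?F \<omega>)\<^sup>2) \<in> borel_measurable ?G" using Fm by measurable
        show "AE \<omega> in ?G. norm ((?F \<omega>)\<^sup>2) \<le> norm (2 * ((axis i 1 \<bullet> (matrix_inv R *v axis i 1)) * cost \<omega>) + 2 * (policy c \<omega> t $ i * policy c \<omega> t $ i))"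
        proof (rule AE_I2)
          fix \<omega>
          have "(u' \<omega> t $ i)\<^sup>2 \<le> (axis i 1 \<bullet> (matrix_inv R *v axis i 1)) * (u' \<omega> t \<bullet> (R *v u' \<omega> t))"
            using pd_inner_le[OF pd_matrix_inv[OF R], of "axis i 1" "u' \<omega> t"]
            by (simp add: matrix_inv_matrix_inv[OF pd_invertible[OF R]] inner_axis')
          also have "\<dots> \<le> (axis i 1 \<bullet> (matrix_inv R *v axis i 1)) * cost \<omega>"
          proof (rule mult_left_mono)
            have "u' \<omega> t \<bullet> (R *v u' \<omega> t) \<le> (\<Sum>t<T. u' \<omega> t \<bullet> (R *v u' \<omega> t))"
              using t pd_imp_psd[OF R] by (intro member_le_sum) (auto simp: psd_def)
            moreover have "0 \<le> (\<Sum>t<Suc T. x' \<omega> t \<bullet> (stage_weight t *v x' \<omega> t))"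
              using stage_weight_psd by (intro sum_nonneg) (auto simp: psd_def)
            ultimately show "u' \<omega> t \<bullet> (R *v u' \<omega> t) \<le> cost \<omega>" unfolding cost_def cost_form_def by linarith
            show "0 \<le> axis i 1 \<bullet> (matrix_inv R *v axis i 1)"
              using pd_imp_psd[OF pd_matrix_inv[OF R]] by (simp add: psd_def)
          qed
          finally have 1: "(u' \<omega> t $ i)\<^sup>2 \<le> (axis i 1 \<bullet> (matrix_inv R *v axis i 1)) * cost \<omega>" .
          have "(?F \<omega>)\<^sup>2 \<le> 2 * (u' \<omega> t $ i)\<^sup>2 + 2 * (policy c \<omega> t $ i)\<^sup>2"
          proof -
            have "(p - q)\<^sup>2 \<le> 2 * p\<^sup>2 + 2 * q\<^sup>2" for p q :: real
              using zero_le_power2[of "p + q"] by (simp add: power2_sum power2_diff)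
            then show ?thesis by (simp add: h_def)
          qed
          with 1 have "(?F \<omega>)\<^sup>2 \<le> 2 * ((axis i 1 \<bullet> (matrix_inv R *v axis i 1)) * cost \<omega>) + 2 * (policy c \<omega> t $ i * policy c \<omega> t $ i)"
            unfolding power2_eq_square[of "policy c \<omega> t $ i"] by linarith
          then show "norm ((?F \<omega>)\<^sup>2) \<le> norm (2 * ((axis i 1 \<bullet> (matrix_inv R *v axis i 1)) * cost \<omega>) + 2 * (policy c \<omega> t $ i * policy c \<omega> t $ i))"
            unfolding real_norm_def by (smt (verit) zero_le_power2)
        qed
      qed
      have Finv: "?F (noise_shift T \<sigma> a s \<omega>) = ?F \<omega>" for s \<omega>
      proof -
        have "restrict (\<lambda>r. eta r (noise_shift T \<sigma> a s \<omega>)) {..t} = restrict (\<lambda>r. eta r \<omega>) {..t}"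
          by (rule restrict_ext) (simp add: inv)
        moreover have "policy c (noise_shift T \<sigma> a s \<omega>) t = policy c \<omega> t"
          unfolding policy_def by (intro sum.cong refl) (simp add: inv)
        ultimately show ?thesis by (simp add: h_def u''[OF t])
      qed
      have "integrable ?G (\<lambda>\<omega>. ?F \<omega> * lin T a \<omega>)" "expect \<sigma> (\<lambda>\<omega>. ?F \<omega> * lin T a \<omega>) = 0"
        by (rule cameron_martin_orthogonal[where F = ?F, OF cmart Fm sq], rule Finv)+
      then show "integrable ?G (\<lambda>\<omega>. h \<omega> t $ i * gradient c t \<omega> $ i)" "expect \<sigma> (\<lambda>\<omega>. h \<omega> t $ i * gradient c t \<omega> $ i) = 0"
        using fun_cong[OF a] by simp_all
    qed
    have ih: "integrable ?G (\<lambda>\<omega>. \<Sum>s<T. h \<omega> s \<bullet> gradient c s \<omega>)"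
      unfolding inner_vec_def inner_real_def
      by (intro Bochner_Integration.integrable_sum orth(1)) simp
    have vh: "expect \<sigma> (\<lambda>\<omega>. \<Sum>s<T. h \<omega> s \<bullet> gradient c s \<omega>) = 0"
    proof -
      have "expect \<sigma> (\<lambda>\<omega>. \<Sum>s<T. h \<omega> s \<bullet> gradient c s \<omega>) = (\<Sum>s<T. \<Sum>i\<in>UNIV. expect \<sigma> (\<lambda>\<omega>. h \<omega> s $ i * gradient c s \<omega> $ i))"
        unfolding inner_vec_def inner_real_def
        by (subst Bochner_Integration.integral_sum, (intro Bochner_Integration.integrable_sum orth(1); simp))
           (intro sum.cong refl, subst Bochner_Integration.integral_sum, auto intro: orth(1))
      also have "\<dots> = 0" by (simp add: orth(2))
      finally show ?thesis .
    qed
    have ir: "integrable ?G (run_cost c)" by (rule quadratic_integrable[OF pd noise_quadratic_costs(1)])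
    have "expect \<sigma> (run_cost c) = expect \<sigma> (\<lambda>\<omega>. run_cost c \<omega> + 2 * (\<Sum>s<T. h \<omega> s \<bullet> gradient c s \<omega>))"
      by (subst Bochner_Integration.integral_add[OF ir integrable_mult_right[OF ih]]) (simp add: vh)
    also have "\<dots> \<le> expect \<sigma> cost"
      by (rule integral_mono[OF Bochner_Integration.integrable_add[OF ir integrable_mult_right[OF ih]] ic]) (rule lower)
    finally have "ennreal (expect \<sigma> (run_cost c)) \<le> ennreal (expect \<sigma> cost)" by (rule ennreal_leI)
    also have "\<dots> = (\<integral>\<^sup>+\<omega>. ennreal (cost \<omega>) \<partial>?G)"
      by (rule nn_integral_eq_integral[symmetric, OF ic]) (simp add: c0)
    finally show ?thesis by (simp add: ec)
  qed
qed

end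


section \<open>Output feedback and conclusion\<close>

lemma compact_product_UNIV:
  fixes K :: "'i \<Rightarrow> 'a::topological_space set"
  assumes "\<And>i. compact (K i)"
  shows "compact {f. \<forall>i. f i \<in> K i}"
proof -
  have "compactin (product_topology (\<lambda>_. euclidean) UNIV) (PiE UNIV K)"
    unfolding compactin_PiE using assms by simp
  moreover have "PiE UNIV K = {f. \<forall>i. f i \<in> K i}" by (auto simp: PiE_iff)
  ultimately show ?thesis by (simp add: euclidean_product_topology)
qed

lemma gaussian_dists_subset: "gaussian_dists \<subseteq> ac_dists"
  by (auto simp: gaussian_dists_def)

lemma kl_ball_mono: "D \<subseteq> E \<Longrightarrow> kl_ball D P r \<subseteq> kl_ball E P r"
  by (auto simp: kl_ball_def)

lemma independent_couplings_mono:
  assumes "Bx \<subseteq> Bx'" "\<And>t. Bw t \<subseteq> Bw' t" "\<And>t. Bv t \<subseteq> Bv' t"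
  shows "independent_couplings T Bx Bw Bv \<subseteq> independent_couplings T Bx' Bw' Bv'"
proof
  fix P assume "P \<in> independent_couplings T Bx Bw Bv"
  then obtain Px Pw Pv where "P = Px \<Otimes>\<^sub>M (PiM {..<T} Pw \<Otimes>\<^sub>M PiM {..<T} Pv)"
    "Px \<in> Bx" "\<forall>t<T. Pw t \<in> Bw t" "\<forall>t<T. Pv t \<in> Bv t"
    unfolding independent_couplings_def by (elim CollectE exE conjE) (rule that)
  moreover have "\<forall>t<T. Pw t \<in> Bw' t" "\<forall>t<T. Pv t \<in> Bv' t" "Px \<in> Bx'"
    using assms calculation(2-4) by (simp_all add: subset_iff)
  ultimately show "P \<in> independent_couplings T Bx' Bw' Bv'"
    unfolding independent_couplings_def by (intro CollectI exI conjI)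
qed

lemma gaussian_ambiguity_set_subset:
  "gaussian_ambiguity_set T W\<^sub>0 W V \<rho>\<^sub>x \<rho>\<^sub>w \<rho>\<^sub>v \<subseteq> ambiguity_set T W\<^sub>0 W V \<rho>\<^sub>x \<rho>\<^sub>w \<rho>\<^sub>v"
  unfolding gaussian_ambiguity_set_def ambiguity_set_def
  by (intro independent_couplings_mono kl_ball_mono gaussian_dists_subset)

context lqg
begin

text \<open>
  Closing the loop is possible because the predicted state at time \<open>r\<close> depends on earlier inputs only:
  by strong induction on time each input is a causal linear function of the observations.
\<close>

lemma output_feedback_gain:
  fixes K :: "nat \<Rightarrow> nat \<Rightarrow> real^'p^'m"
  shows "\<exists>U. (\<forall>t s. t < s \<longrightarrow> U t s = 0) \<and>
    (\<forall>u y. (\<forall>t<T. u t = (\<Sum>r\<le>t. K t r *v (y r - C *v response u r))) \<longrightarrow> (\<forall>t<T. u t = bmv T U y t))"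
proof -
  define loop where "loop u y \<longleftrightarrow> (\<forall>t<T. u t = (\<Sum>r\<le>t. K t r *v (y r - C *v response u r)))" for u and y :: "nat \<Rightarrow> real^'p"
  define causal :: "nat \<Rightarrow> ((nat \<Rightarrow> real^'m) \<Rightarrow> (nat \<Rightarrow> real^'p) \<Rightarrow> real^'m) \<Rightarrow> bool"
    where "causal t f \<longleftrightarrow> (\<exists>M. (\<forall>s. t < s \<longrightarrow> M s = 0) \<and> (\<forall>u y. loop u y \<longrightarrow> f u y = (\<Sum>s<T. M s *v y s)))" for t f
  have mono: "causal t f" if "causal r f" "r \<le> t" for r t f
  proof -
    obtain M where "\<forall>s. r < s \<longrightarrow> M s = 0" "\<forall>u y. loop u y \<longrightarrow> f u y = (\<Sum>s<T. M s *v y s)"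
      using \<open>causal r f\<close> unfolding causal_def by (elim exE conjE)
    then show ?thesis unfolding causal_def using \<open>r \<le> t\<close> by (intro exI[of _ M]) simp
  qed
  have add: "causal t (\<lambda>u y. f u y + g u y)" if f: "causal t f" and g: "causal t g" for t f g
  proof -
    obtain M where M: "\<forall>s. t < s \<longrightarrow> M s = 0" "\<forall>u y. loop u y \<longrightarrow> f u y = (\<Sum>s<T. M s *v y s)"
      using f unfolding causal_def by (elim exE conjE)
    obtain N where N: "\<forall>s. t < s \<longrightarrow> N s = 0" "\<forall>u y. loop u y \<longrightarrow> g u y = (\<Sum>s<T. N s *v y s)"
      using g unfolding causal_def by (elim exE conjE)
    show ?thesis unfolding causal_def
      by (rule exI[of _ "\<lambda>s. M s + N s"]) (use M N in \<open>simp add: matrix_vector_mult_add_rdistrib sum.distrib\<close>)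
  qed
  have zero: "causal t (\<lambda>_ _. 0)" for t
    unfolding causal_def by (rule exI[of _ "\<lambda>_. 0"]) simp
  have sum: "causal t (\<lambda>u y. \<Sum>i\<in>I. f i u y)" if "\<And>i. i \<in> I \<Longrightarrow> causal t (f i)" for t f and I :: "nat set"
    using that by (induction I rule: infinite_finite_induct) (auto intro: zero add)
  have mult: "causal t (\<lambda>u y. N *v f u y)" if f: "causal t f" for t f and N :: "real^'m^'m"
  proof -
    obtain M where M: "\<forall>s. t < s \<longrightarrow> M s = 0" "\<forall>u y. loop u y \<longrightarrow> f u y = (\<Sum>s<T. M s *v y s)"
      using f unfolding causal_def by (elim exE conjE)
    show ?thesis unfolding causal_def
      by (rule exI[of _ "\<lambda>s. N ** M s"])
         (use M in \<open>simp add: matrix_vector_mult_sum matrix_vector_mul_assoc\<close>)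
  qed
  have out: "causal t (\<lambda>u y. N *v y r)" if "r \<le> t" "t < T" for t r and N :: "real^'p^'m"
    unfolding causal_def
  proof (rule exI[of _ "\<lambda>s. if s = r then N else 0"], intro conjI allI impI)
    fix u y
    have "(\<Sum>s<T. (if s = r then N else 0) *v y s) = (\<Sum>s<T. if s = r then N *v y s else 0)"
      by (rule sum.cong) auto
    then show "N *v y r = (\<Sum>s<T. (if s = r then N else 0) *v y s)" using that by simp
  qed (use that in auto)
  have neg: "(- N) *v x = - (N *v x)" for N :: "real^'m^'m" and x
    by (simp add: vec_eq_iff matrix_vector_mult_def sum_negf)
  have input: "t < T \<Longrightarrow> causal t (\<lambda>u y. u t)" for t
  proof (induction t rule: less_induct)
    case (less t)
    \<comment> \<open>Inputs before \<open>r\<close> are causal by induction, and \<open>r \<le> t\<close>.\<close>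
    have "causal t (\<lambda>u y. \<Sum>r\<le>t. K t r *v y r + (\<Sum>s<r. (- (K t r ** C ** (mpow A (r - 1 - s) ** B))) *v u s))"
      by (intro sum add out mult mono[OF less.IH]) (use less.prems in auto)
    moreover have "u t = (\<Sum>r\<le>t. K t r *v y r + (\<Sum>s<r. (- (K t r ** C ** (mpow A (r - 1 - s) ** B))) *v u s))"
      if "loop u y" for u y
    proof -
      have "K t r *v (y r - C *v response u r) = K t r *v y r + (\<Sum>s<r. (- (K t r ** C ** (mpow A (r - 1 - s) ** B))) *v u s)"
        if "r \<le> t" for r
      proof -
        have "response u r = (\<Sum>s<r. (mpow A (r - 1 - s) ** B) *v u s)"
          unfolding response_def using that less.prems by (intro bmv_Hmat) simp
        then show ?thesis
          by (simp add: matrix_vector_mult_diff_distrib matrix_vector_mult_sum matrix_vector_mul_assoc matrix_mul_assoc sum_negf neg)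
      qed
      then show ?thesis using that less.prems unfolding loop_def by (metis (no_types, lifting) atMost_iff sum.cong)
    qed
    ultimately show ?case unfolding causal_def by simp
  qed
  have "\<forall>t. \<exists>M. (\<forall>s. t < s \<longrightarrow> M s = 0) \<and> (\<forall>u y. loop u y \<longrightarrow> t < T \<longrightarrow> u t = (\<Sum>s<T. M s *v y s))"
  proof
    fix t
    show "\<exists>M. (\<forall>s. t < s \<longrightarrow> M s = 0) \<and> (\<forall>u y. loop u y \<longrightarrow> t < T \<longrightarrow> u t = (\<Sum>s<T. M s *v y s))"
    proof (cases "t < T")
      case True
      from input[OF this] obtain M where "\<forall>s. t < s \<longrightarrow> M s = 0" "\<forall>u y. loop u y \<longrightarrow> u t = (\<Sum>s<T. M s *v y s)"
        unfolding causal_def by (elim exE conjE)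
      then show ?thesis by (intro exI[of _ M]) simp
    next
      case False
      then show ?thesis by (intro exI[of _ "\<lambda>_. 0"]) simp
    qed
  qed
  from choice[OF this] obtain U where U: "\<forall>t. (\<forall>s. t < s \<longrightarrow> U t s = 0) \<and> (\<forall>u y. loop u y \<longrightarrow> t < T \<longrightarrow> u t = (\<Sum>s<T. U t s *v y s))" ..
  show ?thesis
    unfolding loop_def[symmetric] bmv_def
    by (rule exI[of _ U], intro conjI allI impI) (simp_all add: U)
qed

lemma linear_policy_feasible:
  "((closed_loop c), (policy c)) \<in> feasible T A B C"
proof -
  define \<pi> where "\<pi> t z = (\<Sum>r\<le>t. (\<chi> i j. c (t, r, i, j)) *v z r)" for t and z :: "nat \<Rightarrow> real^'p"
  have "\<pi> t \<in> borel_measurable (PiM {..t} (\<lambda>_. borel))" for t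
    unfolding \<pi>_def[abs_def]
    by (intro borel_measurable_sum measurable_compose[OF _ borel_measurable_matrix_vector_mult] measurable_component_singleton) auto
  moreover have "policy c \<omega> t = \<pi> t (restrict (purified T A B C (policy c \<omega>) \<omega>) {..t})" if "t < T" for t \<omega>
    unfolding restrict_purified[OF that] \<pi>_def policy_def by (intro sum.cong) auto
  ultimately have "policy c \<in> admissible T A B C"
    unfolding admissible_def by blast
  then show ?thesis by (simp add: feasible_def closed_loop_def trajectory_eq)
qed

lemma linear_policy_output_feedback:
  "\<exists>U. (\<forall>t s. t < s \<longrightarrow> U t s = 0) \<and>
    (\<forall>\<omega>. \<forall>t<T. policy c \<omega> t = bmv T U (observation T C (closed_loop c \<omega>) \<omega>) t)"
proof -
  obtain U :: "nat \<Rightarrow> nat \<Rightarrow> real^'p^'m" where U: "\<forall>t s. t < s \<longrightarrow> U t s = 0"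
    "\<And>u y. (\<forall>t<T. u t = (\<Sum>r\<le>t. (\<chi> i j. c (t, r, i, j)) *v (y r - C *v response u r))) \<Longrightarrow> \<forall>t<T. u t = bmv T U y t"
    using output_feedback_gain[of "\<lambda>t r. \<chi> i j. c (t, r, i, j)"] by blast
  have "eta r \<omega> = observation T C (closed_loop c \<omega>) \<omega> r - C *v response (policy c \<omega>) r" if "r < T" for r \<omega>
  proof -
    have "eta r \<omega> = purified T A B C (policy c \<omega>) \<omega> r" using that by (simp add: purified_eq eta_def)
    also have "\<dots> = observation T C (closed_loop c \<omega>) \<omega> r - C *v response (policy c \<omega>) r"
      using that by (simp add: purified_def observation_eq xhat_eq[of r T] response_def trajectory_eq closed_loop_def)
    finally show ?thesis .
  qed
  note e = this
  have "\<forall>t<T. policy c \<omega> t = bmv T U (observation T C (closed_loop c \<omega>) \<omega>) t" for \<omega>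
  proof (rule U(2), intro allI impI)
    fix t assume "t < T"
    have "policy c \<omega> t = (\<Sum>r\<le>t. (\<chi> i j. c (t, r, i, j)) *v eta r \<omega>)" by (rule policy_def)
    also have "\<dots> = (\<Sum>r\<le>t. (\<chi> i j. c (t, r, i, j)) *v
        (observation T C (closed_loop c \<omega>) \<omega> r - C *v response (policy c \<omega>) r))"
      using \<open>t < T\<close> by (intro sum.cong refl arg_cong2[where f = "(*v)"] e) simp
    finally show "policy c \<omega> t = (\<Sum>r\<le>t. (\<chi> i j. c (t, r, i, j)) *v
        (observation T C (closed_loop c \<omega>) \<omega> r - C *v response (policy c \<omega>) r))" .
  qed
  then show ?thesis using U(1) by blast
qed

lemma expected_cost_linear_policy:
  assumes "second_moments T P \<sigma>" "pd_blocks \<sigma>"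
  shows "expected_cost T Q Q\<^sub>T R (closed_loop c) (policy c) P = ennreal (expect \<sigma> (run_cost c))"
proof -
  obtain \<Phi> where "\<And>P \<sigma>. second_moments T P \<sigma> \<Longrightarrow> integrable P (run_cost c)"
    "\<And>P \<sigma>. second_moments T P \<sigma> \<Longrightarrow> (\<integral>\<omega>. run_cost c \<omega> \<partial>P) = \<Phi> \<sigma>"
    using noise_quadratic_expectation[OF noise_quadratic_costs(1)] by metis
  then have i: "integrable P (run_cost c)" and e: "(\<integral>\<omega>. run_cost c \<omega> \<partial>P) = expect \<sigma> (run_cost c)"
    using assms(1) second_moments_gauss_noise[OF assms(2), of T] by simp_all
  have "expected_cost T Q Q\<^sub>T R (closed_loop c) (policy c) P = (\<integral>\<^sup>+\<omega>. ennreal (run_cost c \<omega>) \<partial>P)"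
    by (simp add: expected_cost_def bquad_cost_form run_cost_def)
  also have "\<dots> = ennreal (\<integral>\<omega>. run_cost c \<omega> \<partial>P)"
    by (rule nn_integral_eq_integral[OF i]) (simp add: run_cost_def cost_form_nonneg)
  finally show ?thesis by (simp add: e)
qed

end

lemma convex_combination_mem: "convex K \<Longrightarrow> x \<in> K \<Longrightarrow> y \<in> K \<Longrightarrow> 0 \<le> e \<Longrightarrow> e \<le> 1 \<Longrightarrow> (1 - e) *\<^sub>R x + e *\<^sub>R y \<in> K"
  by (rule convexD) auto

text \<open>
  Blocks beyond the horizon do not influence the noise. Fixing them to the identity makes the set of all
  block sequences compact and all its members positive definite.
\<close>

definition cov_blocks :: "nat \<Rightarrow> (nat \<Rightarrow> real^'k^'k) \<Rightarrow> (nat \<Rightarrow> real) \<Rightarrow> nat \<Rightarrow> (real^'k^'k) set" where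
  "cov_blocks T W \<rho> t = (if t < T then kl_cov_set (W t) (\<rho> t) else {mat 1})"

lemma cov_blocks_props:
  assumes "\<And>t. t < T \<Longrightarrow> pd (W t)" "\<And>t. t < T \<Longrightarrow> 0 \<le> \<rho> t"
  shows "compact (cov_blocks T W \<rho> t)" "convex (cov_blocks T W \<rho> t)" "cov_blocks T W \<rho> t \<noteq> {}"
    "S \<in> cov_blocks T W \<rho> t \<Longrightarrow> pd S"
  using assms kl_cov_set_pd[of S "W t" "\<rho> t"]
  by (auto simp: cov_blocks_def pd_mat_1 kl_cov_set_compact kl_cov_set_convex kl_cov_set_nonempty split: if_splits)

theorem theorem4:
  fixes T :: nat
    and A :: "real^'n^'n" and B :: "real^'m^'n" and C :: "real^'n^'p"
    and Q Q\<^sub>T :: "real^'n^'n" and R :: "real^'m^'m"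
    and W\<^sub>0 :: "real^'n^'n" and W :: "nat \<Rightarrow> real^'n^'n" and V :: "nat \<Rightarrow> real^'p^'p"
    and \<rho>\<^sub>x :: real and \<rho>\<^sub>w \<rho>\<^sub>v :: "nat \<Rightarrow> real"
  assumes "psd Q" and "psd Q\<^sub>T" and "pd R"
    and "pd W\<^sub>0" and "\<And>t. t < T \<Longrightarrow> pd (W t)" and "\<And>t. t < T \<Longrightarrow> pd (V t)"
    and "\<rho>\<^sub>x \<ge> 0" and "\<And>t. t < T \<Longrightarrow> \<rho>\<^sub>w t \<ge> 0" and "\<And>t. t < T \<Longrightarrow> \<rho>\<^sub>v t \<ge> 0"
  shows "\<exists>(U :: nat \<Rightarrow> nat \<Rightarrow> real^'p^'m) (q :: nat \<Rightarrow> real^'m) x u.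
    \<exists>P \<in> gaussian_ambiguity_set T W\<^sub>0 W V \<rho>\<^sub>x \<rho>\<^sub>w \<rho>\<^sub>v.
      (\<forall>t<T. \<forall>s<T. t < s \<longrightarrow> U t s = 0) \<and>
      (x, u) \<in> feasible T A B C \<and>
      (\<forall>\<omega>. \<forall>t<T. u \<omega> t = bmv T U (observation T C (x \<omega>) \<omega>) t + q t) \<and>
      (\<forall>(x', u') \<in> feasible T A B C.
         (SUP P'\<in>ambiguity_set T W\<^sub>0 W V \<rho>\<^sub>x \<rho>\<^sub>w \<rho>\<^sub>v. expected_cost T Q Q\<^sub>T R x u P')
           \<le> (SUP P'\<in>ambiguity_set T W\<^sub>0 W V \<rho>\<^sub>x \<rho>\<^sub>w \<rho>\<^sub>v. expected_cost T Q Q\<^sub>T R x' u' P')) \<and>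
      (\<forall>P'\<in>ambiguity_set T W\<^sub>0 W V \<rho>\<^sub>x \<rho>\<^sub>w \<rho>\<^sub>v.
         expected_cost T Q Q\<^sub>T R x u P' \<le> expected_cost T Q Q\<^sub>T R x u P)"
proof -
  interpret lqg T A B C Q Q\<^sub>T R by unfold_locales (fact assms)+
  note wb = cov_blocks_props[of T W \<rho>\<^sub>w, OF assms(5,8)] and vb = cov_blocks_props[of T V \<rho>\<^sub>v, OF assms(6,9)]
  let ?amb = "ambiguity_set T W\<^sub>0 W V \<rho>\<^sub>x \<rho>\<^sub>w \<rho>\<^sub>v"
  define S :: "('n, 'p) covs set" where "S = kl_cov_set W\<^sub>0 \<rho>\<^sub>x \<times>
    ({f. \<forall>t. f t \<in> cov_blocks T W \<rho>\<^sub>w t} \<times> {f. \<forall>t. f t \<in> cov_blocks T V \<rho>\<^sub>v t})"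
  have comp: "compact S"
    unfolding S_def by (intro compact_Times compact_product_UNIV kl_cov_set_compact assms(4) wb(1) vb(1))
  have ne: "S \<noteq> {}"
  proof -
    have "\<exists>f. \<forall>t. f t \<in> cov_blocks T W \<rho>\<^sub>w t" "\<exists>f. \<forall>t. f t \<in> cov_blocks T V \<rho>\<^sub>v t"
      using wb(3) vb(3) by (meson all_not_in_conv)+
    then show ?thesis using kl_cov_set_nonempty[OF assms(4,7)] by (auto simp: S_def)
  qed
  have pd: "pd_blocks \<sigma>" if "\<sigma> \<in> S" for \<sigma>
    unfolding pd_blocks_def
  proof (intro conjI allI)
    show "pd (fst \<sigma>)" using that by (intro kl_cov_set_pd[of _ W\<^sub>0 \<rho>\<^sub>x]) (auto simp: S_def)
    show "pd (fst (snd \<sigma>) t)" for t using that by (intro wb(4)[of _ t]) (auto simp: S_def)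
    show "pd (snd (snd \<sigma>) t)" for t using that by (intro vb(4)[of _ t]) (auto simp: S_def)
  qed
  have conv: "comb_covs (1 - e) \<sigma> e \<tau> \<in> S" if "\<sigma> \<in> S" "\<tau> \<in> S" "0 \<le> e" "e \<le> 1" for \<sigma> \<tau> e
    unfolding S_def comb_covs_def mem_Times_iff fst_conv snd_conv mem_Collect_eq
    using that by (intro conjI allI convex_combination_mem kl_cov_set_convex wb(2) vb(2)) (auto simp: S_def)
  obtain \<sigma> c where \<sigma>: "\<sigma> \<in> S" and c: "\<And>d. expect \<sigma> (cross_cost d c) = 0"
    and worst: "\<And>\<tau>. \<tau> \<in> S \<Longrightarrow> expect \<tau> (run_cost c) \<le> expect \<sigma> (run_cost c)"
    using saddle_point[OF comp ne pd conv] by blast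
  obtain U where U: "\<forall>t s. t < s \<longrightarrow> U t s = 0"
    "\<forall>\<omega>. \<forall>t<T. policy c \<omega> t = bmv T U (observation T C (closed_loop c \<omega>) \<omega>) t"
    using linear_policy_output_feedback[of c] by blast
  let ?P = "gauss_noise T \<sigma>"
  have PG: "?P \<in> gaussian_ambiguity_set T W\<^sub>0 W V \<rho>\<^sub>x \<rho>\<^sub>w \<rho>\<^sub>v"
  proof -
    have "gaussian 0 (fst \<sigma>) \<in> kl_ball gaussian_dists (gaussian 0 W\<^sub>0) \<rho>\<^sub>x"
      using \<sigma> by (intro kl_cov_set_gaussian assms(4)) (auto simp: S_def)
    moreover have "gaussian 0 (fst (snd \<sigma>) t) \<in> kl_ball gaussian_dists (gaussian 0 (W t)) (\<rho>\<^sub>w t)" if "t < T" for t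
      using \<sigma> that by (intro kl_cov_set_gaussian assms(5)) (auto simp: S_def cov_blocks_def dest!: spec[of _ t])
    moreover have "gaussian 0 (snd (snd \<sigma>) t) \<in> kl_ball gaussian_dists (gaussian 0 (V t)) (\<rho>\<^sub>v t)" if "t < T" for t
      using \<sigma> that by (intro kl_cov_set_gaussian assms(6)) (auto simp: S_def cov_blocks_def dest!: spec[of _ t])
    ultimately show ?thesis
      unfolding gaussian_ambiguity_set_def independent_couplings_def gauss_noise_def
      by (intro CollectI exI conjI allI impI) simp_all
  qed
  have Pamb: "?P \<in> ?amb" using PG gaussian_ambiguity_set_subset by blast
  have costP: "expected_cost T Q Q\<^sub>T R (closed_loop c) (policy c) ?P = ennreal (expect \<sigma> (run_cost c))"
    by (rule expected_cost_linear_policy[OF second_moments_gauss_noise[OF pd[OF \<sigma>]] pd[OF \<sigma>]])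
  \<comment> \<open>The ambiguity set enters only through the covariances, which lie in \<open>S\<close>.\<close>
  have inner: "expected_cost T Q Q\<^sub>T R (closed_loop c) (policy c) P' \<le> expected_cost T Q Q\<^sub>T R (closed_loop c) (policy c) ?P"
    if P': "P' \<in> ?amb" for P'
  proof -
    obtain Px Pw Pv where eq: "P' = Px \<Otimes>\<^sub>M (PiM {..<T} Pw \<Otimes>\<^sub>M PiM {..<T} Pv)"
      and x: "Px \<in> kl_ball ac_dists (gaussian 0 W\<^sub>0) \<rho>\<^sub>x"
      and w: "\<And>t. t < T \<Longrightarrow> Pw t \<in> kl_ball ac_dists (gaussian 0 (W t)) (\<rho>\<^sub>w t)"
      and v: "\<And>t. t < T \<Longrightarrow> Pv t \<in> kl_ball ac_dists (gaussian 0 (V t)) (\<rho>\<^sub>v t)"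
      using P' unfolding ambiguity_set_def independent_couplings_def by (elim CollectE exE conjE) simp
    obtain Sx where Sx: "Sx \<in> kl_cov_set W\<^sub>0 \<rho>\<^sub>x" "centered_second_moment Px Sx"
      using kl_ball_second_moment[OF assms(4) x] by blast
    have "\<forall>t. \<exists>M. M \<in> cov_blocks T W \<rho>\<^sub>w t \<and> (t < T \<longrightarrow> centered_second_moment (Pw t) M)"
      using kl_ball_second_moment[OF assms(5) w] by (metis cov_blocks_def insertI1)
    from choice[OF this] obtain Sw where Sw: "\<forall>t. Sw t \<in> cov_blocks T W \<rho>\<^sub>w t \<and> (t < T \<longrightarrow> centered_second_moment (Pw t) (Sw t))" ..
    have "\<forall>t. \<exists>M. M \<in> cov_blocks T V \<rho>\<^sub>v t \<and> (t < T \<longrightarrow> centered_second_moment (Pv t) M)"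
      using kl_ball_second_moment[OF assms(6) v] by (metis cov_blocks_def insertI1)
    from choice[OF this] obtain Sv where Sv: "\<forall>t. Sv t \<in> cov_blocks T V \<rho>\<^sub>v t \<and> (t < T \<longrightarrow> centered_second_moment (Pv t) (Sv t))" ..
    have \<tau>: "(Sx, Sw, Sv) \<in> S" using Sx Sw Sv by (simp add: S_def)
    have "second_moments T P' (Sx, Sw, Sv)"
      unfolding eq by (rule second_moments_product) (use Sx Sw Sv in auto)
    from expected_cost_linear_policy[OF this pd[OF \<tau>]] worst[OF \<tau>] show ?thesis
      unfolding costP by (simp add: ennreal_leI)
  qed
  have outer: "(SUP P'\<in>?amb. expected_cost T Q Q\<^sub>T R (closed_loop c) (policy c) P')
      \<le> (SUP P'\<in>?amb. expected_cost T Q Q\<^sub>T R x' u' P')" if "(x', u') \<in> feasible T A B C" for x' u'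
  proof -
    have "(SUP P'\<in>?amb. expected_cost T Q Q\<^sub>T R (closed_loop c) (policy c) P') \<le> ennreal (expect \<sigma> (run_cost c))"
      unfolding costP[symmetric] by (rule SUP_least) (rule inner)
    also have "\<dots> \<le> expected_cost T Q Q\<^sub>T R x' u' ?P"
      by (rule gaussian_optimal[OF pd[OF \<sigma>] c that])
    also have "\<dots> \<le> (SUP P'\<in>?amb. expected_cost T Q Q\<^sub>T R x' u' P')"
      by (rule SUP_upper[OF Pamb])
    finally show ?thesis .
  qed
  show ?thesis
  proof (rule exI[of _ U], rule exI[of _ "\<lambda>_. 0"], rule exI[of _ "closed_loop c"], rule exI[of _ "policy c"],
      rule bexI[OF _ PG], intro conjI)
    show "\<forall>t<T. \<forall>s<T. t < s \<longrightarrow> U t s = 0" using U(1) by simp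
    show "(closed_loop c, policy c) \<in> feasible T A B C" by (rule linear_policy_feasible)
    show "\<forall>\<omega>. \<forall>t<T. policy c \<omega> t = bmv T U (observation T C (closed_loop c \<omega>) \<omega>) t + 0" using U(2) by simp
    show "\<forall>(x', u')\<in>feasible T A B C. (SUP P'\<in>?amb. expected_cost T Q Q\<^sub>T R (closed_loop c) (policy c) P')
        \<le> (SUP P'\<in>?amb. expected_cost T Q Q\<^sub>T R x' u' P')" using outer by blast
    show "\<forall>P'\<in>?amb. expected_cost T Q Q\<^sub>T R (closed_loop c) (policy c) P' \<le> expected_cost T Q Q\<^sub>T R (closed_loop c) (policy c) ?P"
      using inner by blast
  qed
qed

end
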